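(* Let $E=J^1(T,M)$ and let $h=(h_{\alpha\beta})$ be a semi-Riemannian metric on $T$. (i) If $G^{(i)}_{(\alpha)\beta}$ are the components of a spatial spray on $E$ and $G^i=h^{\alpha\beta}G^{(i)}_{(\alpha)\beta}$ is the $h$-trace of this spray, then the coefficients $$N^{(i)}_{(\alpha)j}=\frac{\partial G^i}{\partial x^j_\gamma}h_{\gamma\alpha}$$ represent a spatial nonlinear connection on $E$. (ii) Conversely, a spatial nonlinear connection $N^{(i)}_{(\alpha)j}$ on $E$ induces a spatial spray on $E$ with components $G^{(i)}_{(\alpha)\beta}$ given by $$2G^{(i)}_{(\alpha)\beta}=N^{(i)}_{(\alpha)j}x^j_\beta.$$
   Context: $T$ and $M$ are smooth manifolds of dimensions $p$ and $n$; Greek indices run over $1,\dots,p$, Latin indices over $1,\dots,n$; repeated indices are summed. $(h^{\alpha\beta})$ denotes the inverse matrix of $(h_{\alpha\beta})$. $E=J^1(T,M)$ is the bundle of 1-jets of smooth maps $T\to M$, a vector bundle over $T\times M$. Charts $(t^\alpha)$ of $T$ and $(x^i)$ of $M$ induce a chart $(t^\alpha,x^i,x^i_\alpha)$ of $E$, where $x^i_\alpha$ of the 1-jet of $f$ at $t_0$ is $\frac{\partial (x^i\circ f)}{\partial t^\alpha}(t_0)$. Changes of induced charts have the form $\tilde t^\alpha=\tilde t^\alpha(t^\beta)$, $\tilde x^i=\tilde x^i(x^j)$, $\tilde x^i_\alpha=\frac{\partial\tilde x^i}{\partial x^j}\frac{\partial t^\beta}{\partial\tilde t^\alpha}x^j_\beta$,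 with invertible Jacobians. In $\frac{\partial\tilde x^k_\mu}{\partial x^i}$ the function $\tilde x^k_\mu$ is regarded as a function of $(t,x,x^j_\beta)$. All local functions are smooth functions on the domains of induced charts of $E$, and tilded quantities refer to a second induced chart. A spatial spray on $E$ is a globally defined (1,1)-tensor field on $E$ that in every induced chart has the form $G=x^i_\alpha\,dt^\alpha\otimes\frac{\partial}{\partial x^i}-2G^{(j)}_{(\beta)\alpha}\,dt^\alpha\otimes\frac{\partial}{\partial x^j_\beta}$; the local functions $G^{(j)}_{(\beta)\alpha}$ are its components. A spatial nonlinear connection on $E$ is the family of coefficients $N^{(j)}_{(\beta)i}$ of a nonlinear connection, i.e. a family of local functions on induced charts, transforming under changes of induced charts by $$\tilde N^{(j)}_{(\beta)k}\frac{\partial\tilde x^k}{\partial x^i}=N^{(k)}_{(\gamma)i}\frac{\partial\tilde x^j}{\partial x^k}\frac{\partial t^\gamma}{\partial\tilde t^\beta}-\frac{\partial\tilde x^j_\beta}{\partial x^i}.$$ *)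

theory Defs
  imports "HOL-Analysis.Analysis"
begin

section \<open>Smooth functions on open subsets of Euclidean spaces\<close>

text \<open>All iterated directional derivatives exist and are continuous; intended for open \<open>S\<close>.\<close>

primrec Ck_on ::
  "nat \<Rightarrow> 'm::euclidean_space set \<Rightarrow> ('m \<Rightarrow> 'v::real_normed_vector) \<Rightarrow> bool" where
  "Ck_on 0 S f \<longleftrightarrow> continuous_on S f"
| "Ck_on (Suc k) S f \<longleftrightarrow> (\<forall>x\<in>S. f differentiable (at x)) \<and>
     (\<forall>v. Ck_on k S (\<lambda>x. frechet_derivative f (at x) v))"

definition smooth_on :: "'m::euclidean_space set \<Rightarrow> ('m \<Rightarrow> 'v::real_normed_vector) \<Rightarrow> bool" where
  "smooth_on S f \<longleftrightarrow> (\<forall>k. Ck_on k S f)"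

section \<open>Charts and smooth manifolds\<close>

text \<open>A chart is a domain together with a coordinate map; the values of the coordinate map
  outside of the domain are irrelevant.\<close>

type_synonym ('a, 'm) chart = "'a set \<times> ('a \<Rightarrow> 'm)"

abbreviation dom_of :: "('a, 'm) chart \<Rightarrow> 'a set" where "dom_of c \<equiv> fst c"

abbreviation coord :: "('a, 'm) chart \<Rightarrow> 'a \<Rightarrow> 'm" where "coord c \<equiv> snd c"

definition inv_chart :: "('a, 'm) chart \<Rightarrow> 'm \<Rightarrow> 'a" where
  "inv_chart c = inv_into (dom_of c) (coord c)"

definition transition :: "('a, 'm) chart \<Rightarrow> ('a, 'm) chart \<Rightarrow> 'm \<Rightarrow> 'm" where
  "transition c d = coord d \<circ> inv_chart c"

definition topological_chart :: "'a topology \<Rightarrow> ('a, 'm::euclidean_space) chart \<Rightarrow> bool" where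
  "topological_chart X c \<longleftrightarrow> openin X (dom_of c) \<and> open (coord c ` dom_of c) \<and>
     homeomorphic_map (subtopology X (dom_of c)) (top_of_set (coord c ` dom_of c)) (coord c)"

definition compatible :: "('a, 'm::euclidean_space) chart \<Rightarrow> ('a, 'm) chart \<Rightarrow> bool" where
  "compatible c d \<longleftrightarrow>
     smooth_on (coord c ` (dom_of c \<inter> dom_of d)) (transition c d) \<and>
     smooth_on (coord d ` (dom_of c \<inter> dom_of d)) (transition d c)"

record ('a, 'm) manifold =
  mtop :: "'a topology"
  atlas :: "('a, 'm) chart set"

text \<open>The atlas of a smooth manifold is required to be maximal, so that its members are all the
  charts of the manifold. The dimension is the one of the model space \<open>'m\<close>.\<close>

definition smooth_manifold :: "('a, 'm::euclidean_space) manifold \<Rightarrow> bool" where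
  "smooth_manifold X \<longleftrightarrow>
     Hausdorff_space (mtop X) \<and> second_countable (mtop X) \<and>
     (\<forall>c\<in>atlas X. topological_chart (mtop X) c) \<and>
     (\<Union>c\<in>atlas X. dom_of c) = topspace (mtop X) \<and>
     (\<forall>c\<in>atlas X. \<forall>d\<in>atlas X. compatible c d) \<and>
     (\<forall>c. topological_chart (mtop X) c \<and> (\<forall>d\<in>atlas X. compatible c d) \<longrightarrow> c \<in> atlas X)"

definition smooth_function_in ::
  "('a, 'm::euclidean_space) chart \<Rightarrow> ('a \<Rightarrow> real) \<Rightarrow> bool" where
  "smooth_function_in c F \<longleftrightarrow> smooth_on (coord c ` dom_of c) (F \<circ> inv_chart c)"

text \<open>\<open>partial c b F q\<close> is the derivative at \<open>q\<close> of \<open>F\<close>, expressed in the chart \<open>c\<close>, in the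
  coordinate direction \<open>b\<close>.\<close>

definition partial ::
  "('a, 'm::euclidean_space) chart \<Rightarrow> 'm \<Rightarrow> ('a \<Rightarrow> real) \<Rightarrow> 'a \<Rightarrow> real" where
  "partial c b F q = frechet_derivative (F \<circ> inv_chart c) (at (coord c q)) b"

section \<open>Tangent vectors and tensor fields\<close>

text \<open>A tangent vector at \<open>q\<close>, with respect to a set \<open>C\<close> of pairwise compatible charts, assigns to
  each chart around \<open>q\<close> the tuple of its components, and these tuples are related by the
  Jacobians of the chart changes. The value \<open>0\<close> at the remaining arguments
  makes the representation unique. The vector space operations are pointwise.\<close>

type_synonym ('a, 'm) tvec = "('a, 'm) chart \<Rightarrow> 'm"

definition tangent_space ::
  "('a, 'm::euclidean_space) chart set \<Rightarrow> 'a \<Rightarrow> ('a, 'm) tvec set" where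
  "tangent_space C q = {v.
     (\<forall>c. \<not> (c \<in> C \<and> q \<in> dom_of c) \<longrightarrow> v c = 0) \<and>
     (\<forall>c\<in>C. \<forall>d\<in>C. q \<in> dom_of c \<and> q \<in> dom_of d \<longrightarrow>
        v d = frechet_derivative (transition c d) (at (coord c q)) (v c))}"

text \<open>The coordinate vector at \<open>q\<close> of the chart \<open>c\<close> that belongs to the coordinate direction \<open>b\<close>,
  and the value at the tangent vector \<open>v\<close> of the differential of that coordinate.\<close>

definition coord_vec ::
  "('a, 'm::euclidean_space) chart set \<Rightarrow> ('a, 'm) chart \<Rightarrow> 'm \<Rightarrow> 'a \<Rightarrow> ('a, 'm) tvec" where
  "coord_vec C c b q = (\<lambda>d. if d \<in> C \<and> q \<in> dom_of d
     then frechet_derivative (transition c d) (at (coord c q)) b else 0)"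

definition coord_diff ::
  "('a, 'm::euclidean_space) chart \<Rightarrow> 'm \<Rightarrow> ('a, 'm) tvec \<Rightarrow> real" where
  "coord_diff c b v = v c \<bullet> b"

text \<open>A (1,1)-tensor field is regarded as a smooth field of endomorphisms of the tangent spaces;
  the tensor product of a covector \<open>w\<close> and a vector \<open>X\<close> is the endomorphism sending \<open>v\<close> to
  \<open>w v\<close> times \<open>X\<close>.\<close>

type_synonym ('a, 'm) tensor11 = "'a \<Rightarrow> ('a, 'm) tvec \<Rightarrow> ('a, 'm) tvec"

definition tensor11_field ::
  "('a, 'm::euclidean_space) chart set \<Rightarrow> ('a, 'm) tensor11 \<Rightarrow> bool" where
  "tensor11_field C S \<longleftrightarrow>
     (\<forall>q\<in>(\<Union>c\<in>C. dom_of c).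
        S q ` tangent_space C q \<subseteq> tangent_space C q \<and>
        (\<forall>v\<in>tangent_space C q. \<forall>w\<in>tangent_space C q. \<forall>r s.
           S q (\<lambda>c. r *\<^sub>R v c + s *\<^sub>R w c) = (\<lambda>c. r *\<^sub>R S q v c + s *\<^sub>R S q w c))) \<and>
     (\<forall>c\<in>C. \<forall>b\<in>Basis. \<forall>b'\<in>Basis.
        smooth_function_in c (\<lambda>q. coord_diff c b' (S q (coord_vec C c b q))))"

definition tensor_prod ::
  "(('a, 'm) tvec \<Rightarrow> real) \<Rightarrow> ('a, 'm) tvec \<Rightarrow> ('a, 'm::euclidean_space) tvec \<Rightarrow> ('a, 'm) tvec" where
  "tensor_prod w X v = (\<lambda>d. w v *\<^sub>R X d)"

type_synonym ('a, 'm) tensor02 = "'a \<Rightarrow> ('a, 'm) tvec \<Rightarrow> ('a, 'm) tvec \<Rightarrow> real"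

definition tensor02_field ::
  "('a, 'm::euclidean_space) chart set \<Rightarrow> ('a, 'm) tensor02 \<Rightarrow> bool" where
  "tensor02_field C h \<longleftrightarrow>
     (\<forall>q\<in>(\<Union>c\<in>C. dom_of c).
        \<forall>u\<in>tangent_space C q. \<forall>v\<in>tangent_space C q. \<forall>w\<in>tangent_space C q. \<forall>r s.
          h q (\<lambda>c. r *\<^sub>R u c + s *\<^sub>R v c) w = r * h q u w + s * h q v w \<and>
          h q w (\<lambda>c. r *\<^sub>R u c + s *\<^sub>R v c) = r * h q w u + s * h q w v) \<and>
     (\<forall>c\<in>C. \<forall>b\<in>Basis. \<forall>b'\<in>Basis.
        smooth_function_in c (\<lambda>q. h q (coord_vec C c b q) (coord_vec C c b' q)))"

section \<open>Semi-Riemannian metrics\<close>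

text \<open>The maximal dimension of a subspace on which the symmetric matrix \<open>A\<close> is negative definite.\<close>

definition matrix_index :: "real^'p^'p \<Rightarrow> nat" where
  "matrix_index A = Max {dim W | W. subspace W \<and> (\<forall>w\<in>W - {0}. w \<bullet> (A *v w) < 0)}"

definition metric_matrix ::
  "('a, real^'p) manifold \<Rightarrow> ('a, real^'p) tensor02 \<Rightarrow> ('a, real^'p) chart \<Rightarrow> 'a \<Rightarrow> real^'p^'p" where
  "metric_matrix T h a q = (\<chi> \<alpha> \<beta>.
     h q (coord_vec (atlas T) a (axis \<alpha> 1) q) (coord_vec (atlas T) a (axis \<beta> 1) q))"

text \<open>A symmetric nondegenerate (0,2)-tensor field of constant index.\<close>

definition semi_riemannian_metric ::
  "('a, real^'p) manifold \<Rightarrow> ('a, real^'p) tensor02 \<Rightarrow> bool" where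
  "semi_riemannian_metric T h \<longleftrightarrow>
     tensor02_field (atlas T) h \<and>
     (\<forall>q\<in>topspace (mtop T). \<forall>v\<in>tangent_space (atlas T) q. \<forall>w\<in>tangent_space (atlas T) q.
        h q v w = h q w v) \<and>
     (\<forall>q\<in>topspace (mtop T). \<forall>v\<in>tangent_space (atlas T) q.
        (\<forall>w\<in>tangent_space (atlas T) q. h q v w = 0) \<longrightarrow> v = (\<lambda>c. 0)) \<and>
     (\<exists>\<nu>. \<forall>a\<in>atlas T. \<forall>q\<in>dom_of a. matrix_index (metric_matrix T h a q) = \<nu>)"

section \<open>The bundle of 1-jets\<close>

text \<open>As jets depend only on germs, the maps representing a jet at \<open>t\<close> are required to be defined
  and smooth only near \<open>t\<close>; their values far away from \<open>t\<close> are irrelevant.\<close>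

definition smooth_map_on ::
  "('a, 'm::euclidean_space) manifold \<Rightarrow> ('b, 'k::euclidean_space) manifold \<Rightarrow>
    'a set \<Rightarrow> ('a \<Rightarrow> 'b) \<Rightarrow> bool" where
  "smooth_map_on T M W f \<longleftrightarrow>
     openin (mtop T) W \<and> continuous_map (subtopology (mtop T) W) (mtop M) f \<and>
     (\<forall>a\<in>atlas T. \<forall>b\<in>atlas M.
        smooth_on (coord a ` {t \<in> dom_of a \<inter> W. f t \<in> dom_of b}) (coord b \<circ> f \<circ> inv_chart a))"

definition smooth_near ::
  "('a, 'm::euclidean_space) manifold \<Rightarrow> ('b, 'k::euclidean_space) manifold \<Rightarrow>
    'a \<Rightarrow> ('a \<Rightarrow> 'b) \<Rightarrow> bool" where
  "smooth_near T M t f \<longleftrightarrow> (\<exists>W. t \<in> W \<and> smooth_map_on T M W f)"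

definition same_1jet ::
  "('a, 'm::euclidean_space) manifold \<Rightarrow> ('b, 'k::euclidean_space) manifold \<Rightarrow>
    'a \<Rightarrow> ('a \<Rightarrow> 'b) \<Rightarrow> ('a \<Rightarrow> 'b) \<Rightarrow> bool" where
  "same_1jet T M t f g \<longleftrightarrow> f t = g t \<and>
     (\<forall>a\<in>atlas T. \<forall>b\<in>atlas M. t \<in> dom_of a \<and> f t \<in> dom_of b \<longrightarrow>
        frechet_derivative (coord b \<circ> f \<circ> inv_chart a) (at (coord a t)) =
        frechet_derivative (coord b \<circ> g \<circ> inv_chart a) (at (coord a t)))"

type_synonym ('a, 'b) jet = "'a \<times> ('a \<Rightarrow> 'b) set"

definition jet1 ::
  "('a, 'm::euclidean_space) manifold \<Rightarrow> ('b, 'k::euclidean_space) manifold \<Rightarrow>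
    'a \<Rightarrow> ('a \<Rightarrow> 'b) \<Rightarrow> ('a, 'b) jet" where
  "jet1 T M t f = (t, {g. smooth_near T M t g \<and> same_1jet T M t f g})"

definition J1 ::
  "('a, 'm::euclidean_space) manifold \<Rightarrow> ('b, 'k::euclidean_space) manifold \<Rightarrow>
    ('a, 'b) jet set" where
  "J1 T M = {jet1 T M t f | t f. t \<in> topspace (mtop T) \<and> smooth_near T M t f}"

definition jet_source :: "('a, 'b) jet \<Rightarrow> 'a" where
  "jet_source e = fst e"

definition jet_rep :: "('a, 'b) jet \<Rightarrow> 'a \<Rightarrow> 'b" where
  "jet_rep e = (SOME f. f \<in> snd e)"

definition jet_target :: "('a, 'b) jet \<Rightarrow> 'b" where
  "jet_target e = jet_rep e (jet_source e)"

text \<open>The model space of the bundle of 1-jets; the coordinate with Latin index \<open>i\<close> and Greek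
  index \<open>\<alpha>\<close> of \<open>(t, x, y)\<close> is \<open>y $ i $ \<alpha>\<close>.\<close>

type_synonym ('p, 'n) jmodel = "(real^'p) \<times> (real^'n) \<times> (real^'p^'n)"

definition induced_chart ::
  "('a, real^'p) manifold \<Rightarrow> ('b, real^'n) manifold \<Rightarrow>
    ('a, real^'p) chart \<Rightarrow> ('b, real^'n) chart \<Rightarrow> (('a, 'b) jet, ('p, 'n) jmodel) chart" where
  "induced_chart T M a b =
    ({e \<in> J1 T M. jet_source e \<in> dom_of a \<and> jet_target e \<in> dom_of b},
     \<lambda>e. (coord a (jet_source e), coord b (jet_target e),
       \<chi> i \<alpha>. partial a (axis \<alpha> 1) (\<lambda>t. coord b (jet_rep e t) $ i) (jet_source e)))"

definition jet_charts ::
  "('a, real^'p) manifold \<Rightarrow> ('b, real^'n) manifold \<Rightarrow>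
    (('a, 'b) jet, ('p, 'n) jmodel) chart set" where
  "jet_charts T M = {induced_chart T M a b | a b. a \<in> atlas T \<and> b \<in> atlas M}"

definition dir_t :: "'p \<Rightarrow> ('p::finite, 'n::finite) jmodel" where
  "dir_t \<alpha> = (axis \<alpha> 1, 0, 0)"

definition dir_x :: "'n \<Rightarrow> ('p::finite, 'n::finite) jmodel" where
  "dir_x i = (0, axis i 1, 0)"

definition dir_y :: "'n \<Rightarrow> 'p \<Rightarrow> ('p::finite, 'n::finite) jmodel" where
  "dir_y i \<alpha> = (0, 0, axis i (axis \<alpha> 1))"

abbreviation t_of :: "('e, ('p::finite, 'n::finite) jmodel) chart \<Rightarrow> 'p \<Rightarrow> 'e \<Rightarrow> real" where
  "t_of c \<alpha> e \<equiv> fst (coord c e) $ \<alpha>"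

abbreviation x_of :: "('e, ('p::finite, 'n::finite) jmodel) chart \<Rightarrow> 'n \<Rightarrow> 'e \<Rightarrow> real" where
  "x_of c i e \<equiv> fst (snd (coord c e)) $ i"

abbreviation y_of ::
  "('e, ('p::finite, 'n::finite) jmodel) chart \<Rightarrow> 'n \<Rightarrow> 'p \<Rightarrow> 'e \<Rightarrow> real" where
  "y_of c i \<alpha> e \<equiv> snd (snd (coord c e)) $ i $ \<alpha>"

section \<open>Spatial sprays and spatial nonlinear connections\<close>

text \<open>Families of local functions are indexed by the charts of \<open>T\<close> and of \<open>M\<close> that induce the chart
  of the jet bundle. In \<open>G a b i \<alpha> \<beta> e\<close> the arguments \<open>i\<close>, \<open>\<alpha>\<close>, \<open>\<beta>\<close> are the upper index, the lower
  index in parentheses, and the last lower index; likewise in \<open>N a b i \<alpha> j e\<close>.\<close>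

type_synonym ('a, 'b, 'p, 'n) spray_components =
  "('a, real^'p) chart \<Rightarrow> ('b, real^'n) chart \<Rightarrow> 'n \<Rightarrow> 'p \<Rightarrow> 'p \<Rightarrow> ('a, 'b) jet \<Rightarrow> real"

type_synonym ('a, 'b, 'p, 'n) connection_coefficients =
  "('a, real^'p) chart \<Rightarrow> ('b, real^'n) chart \<Rightarrow> 'n \<Rightarrow> 'p \<Rightarrow> 'n \<Rightarrow> ('a, 'b) jet \<Rightarrow> real"

text \<open>\<open>S\<close> is a spatial spray, and \<open>G\<close> are its components.\<close>

definition spatial_spray ::
  "('a, real^'p) manifold \<Rightarrow> ('b, real^'n) manifold \<Rightarrow>
    (('a, 'b) jet, ('p, 'n) jmodel) tensor11 \<Rightarrow> ('a, 'b, 'p, 'n) spray_components \<Rightarrow> bool" where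
  "spatial_spray T M S G \<longleftrightarrow>
     tensor11_field (jet_charts T M) S \<and>
     (\<forall>a\<in>atlas T. \<forall>b\<in>atlas M. let c = induced_chart T M a b; C = jet_charts T M in
        (\<forall>j \<beta> \<alpha>. smooth_function_in c (G a b j \<beta> \<alpha>)) \<and>
        (\<forall>e\<in>dom_of c. \<forall>v\<in>tangent_space C e.
           S e v = (\<lambda>d.
             (\<Sum>\<alpha>\<in>UNIV. \<Sum>i\<in>UNIV. y_of c i \<alpha> e *\<^sub>R
                tensor_prod (coord_diff c (dir_t \<alpha>)) (coord_vec C c (dir_x i) e) v d) -
             (\<Sum>\<alpha>\<in>UNIV. \<Sum>j\<in>UNIV. \<Sum>\<beta>\<in>UNIV. (2 * G a b j \<beta> \<alpha> e) *\<^sub>R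
                tensor_prod (coord_diff c (dir_t \<alpha>)) (coord_vec C c (dir_y j \<beta>) e) v d))))"

text \<open>In the transformation law, \<open>c\<close> is the first induced chart and \<open>c'\<close> the second (tilded) one.\<close>

definition spatial_nonlinear_connection ::
  "('a, real^'p) manifold \<Rightarrow> ('b, real^'n) manifold \<Rightarrow>
    ('a, 'b, 'p, 'n) connection_coefficients \<Rightarrow> bool" where
  "spatial_nonlinear_connection T M N \<longleftrightarrow>
     (\<forall>a\<in>atlas T. \<forall>b\<in>atlas M. \<forall>j \<beta> i.
        smooth_function_in (induced_chart T M a b) (N a b j \<beta> i)) \<and>
     (\<forall>a\<in>atlas T. \<forall>b\<in>atlas M. \<forall>a'\<in>atlas T. \<forall>b'\<in>atlas M.
        let c = induced_chart T M a b; c' = induced_chart T M a' b' in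
        \<forall>e \<in> dom_of c \<inter> dom_of c'. \<forall>j \<beta> i.
          (\<Sum>k\<in>UNIV. N a' b' j \<beta> k e * partial c (dir_x i) (x_of c' k) e) =
          (\<Sum>k\<in>UNIV. \<Sum>\<gamma>\<in>UNIV. N a b k \<gamma> i e * partial c (dir_x k) (x_of c' j) e *
              partial c' (dir_t \<beta>) (t_of c \<gamma>) e) -
          partial c (dir_x i) (y_of c' j \<beta>) e)"

definition h_trace ::
  "('a, real^'p) manifold \<Rightarrow> ('a, real^'p) tensor02 \<Rightarrow> ('a, 'b, 'p, 'n) spray_components \<Rightarrow>
    ('a, real^'p) chart \<Rightarrow> ('b, real^'n) chart \<Rightarrow> 'n \<Rightarrow> ('a, 'b) jet \<Rightarrow> real" where
  "h_trace T h G a b i e = (\<Sum>\<alpha>\<in>UNIV. \<Sum>\<beta>\<in>UNIV.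
     matrix_inv (metric_matrix T h a (jet_source e)) $ \<alpha> $ \<beta> * G a b i \<alpha> \<beta> e)"

definition connection_of_spray ::
  "('a, real^'p) manifold \<Rightarrow> ('b, real^'n) manifold \<Rightarrow> ('a, real^'p) tensor02 \<Rightarrow>
    ('a, 'b, 'p, 'n) spray_components \<Rightarrow> ('a, 'b, 'p, 'n) connection_coefficients" where
  "connection_of_spray T M h G a b i \<alpha> j e = (\<Sum>\<gamma>\<in>UNIV.
     partial (induced_chart T M a b) (dir_y j \<gamma>) (h_trace T h G a b i) e *
     metric_matrix T h a (jet_source e) $ \<gamma> $ \<alpha>)"

definition spray_of_connection ::
  "('a, real^'p) manifold \<Rightarrow> ('b, real^'n) manifold \<Rightarrow>
    ('a, 'b, 'p, 'n) connection_coefficients \<Rightarrow> ('a, 'b, 'p, 'n) spray_components" where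
  "spray_of_connection T M N a b i \<alpha> \<beta> e =
     (\<Sum>j\<in>UNIV. N a b i \<alpha> j e * y_of (induced_chart T M a b) j \<beta> e) / 2"

end

theory Submission
  imports Defs
begin

text \<open>
  Let a change of charts of \<open>T\<close> at a point have the Jacobian matrix \<open>P\<close> with inverse \<open>K\<close>, and let
  \<open>B\<close> be the Jacobian matrix of the change of charts of \<open>M\<close> and \<open>H\<^sup>k\<close> the Hessian of its \<open>k\<close>-th
  component. Writing the fibre coordinates of a jet as a matrix \<open>y\<close> with rows indexed by Latin and
  columns by Greek indices, the induced change of charts is \<open>(t, x, y) \<mapsto> (t', x', B y K)\<close>. Its
  derivative (\<open>jet_chart_jacobian\<close>) sends a vector \<open>(0, v, z)\<close> to \<open>(0, B v, (B z + \<partial>\<^sub>v B y) K)\<close>.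

  A spray assigns to a tangent vector with first component \<open>u\<close> the vector with components
  \<open>(0, y u, - 2 G u)\<close>. Comparing the values of the spray in two charts therefore shows that the
  matrices \<open>G\<^sup>k\<close> transform by \<open>G'\<^sup>k = K\<^sup>T (\<Sum>\<^sub>j B\<^sub>k\<^sub>j G\<^sup>j - 1/2 y\<^sup>T H\<^sup>k y) K\<close>. Since the metric transforms by
  \<open>h' = K\<^sup>T h K\<close>, contracting with its inverse removes both factors \<open>K\<close>, and the trace \<open>g\<^sup>k\<close> of the spray
  satisfies \<open>g'\<^sup>k = \<Sum>\<^sub>j B\<^sub>k\<^sub>j g\<^sup>j - 1/2 q\<^sup>k(y)\<close> with the quadratic form
  \<open>q\<^sup>k(y) = h\<^sup>\<alpha>\<^sup>\<beta> H\<^sup>k\<^sub>i\<^sub>j y\<^sup>i\<^sub>\<alpha> y\<^sup>j\<^sub>\<beta>\<close> (\<open>spray_trace_change_charts\<close>). On a fibre of the bundle all of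
  \<open>B\<close>, \<open>K\<close>, \<open>h\<close>, \<open>H\<^sup>k\<close> are constant, so differentiating in the fibre directions is elementary; as \<open>h\<close>
  and the Hessian are symmetric, the gradient of \<open>q\<^sup>k\<close> is \<open>2 H\<^sup>k y h\<^sup>-\<^sup>1\<close>, which cancels the factor
  \<open>1/2\<close> (\<open>trace_gradient_change_charts\<close>). Multiplying by \<open>h'\<close> turns the law for the gradient into
  the law of a nonlinear connection, because \<open>H\<^sup>k y K\<close> consists of the derivatives of
  the \<open>k\<close>-th row of \<open>y'\<close> with respect to \<open>x\<close>.

  Conversely, the law of a nonlinear connection, contracted with \<open>y u\<close>, says that the vectors
  \<open>(0, y u, - N (y u))\<close> in different charts correspond to each other
  (\<open>spray_vector_of_connection_change_charts\<close>), so that they define an endomorphism of each tangent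
  space.

  Differentiating at a jet presupposes that the induced charts have open images: every coordinate
  triple is realized by a jet (\<open>jet_exists\<close>), namely by that of a map which is affine in charts.
\<close>

section \<open>Calculus of smooth functions\<close>

lemma Ck_on_subset: "Ck_on k S f \<Longrightarrow> S' \<subseteq> S \<Longrightarrow> Ck_on k S' f"
  by (induction k arbitrary: f) (auto intro: continuous_on_subset)

text \<open>The induction step applies the hypothesis to the directional derivatives; only at order \<open>1\<close> it is
  used that differentiable functions are continuous.\<close>

lemma Ck_on_Suc_D: "Ck_on (Suc k) S f \<Longrightarrow> Ck_on k S f"
  by (induction k arbitrary: f)
     (auto intro!: continuous_at_imp_continuous_on differentiable_imp_continuous_within)

lemma Ck_on_cong:
  assumes "open S" "\<And>x. x \<in> S \<Longrightarrow> f x = g x" "Ck_on k S f"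
  shows "Ck_on k S g"
  using assms(2,3)
proof (induction k arbitrary: f g)
  case 0
  then show ?case by (auto cong: continuous_on_cong)
next
  case (Suc k)
  have diff: "f differentiable (at x)" if "x \<in> S" for x using Suc.prems that by simp
  have der: "(g has_derivative frechet_derivative f (at x)) (at x)" if "x \<in> S" for x
    using diff[OF that, unfolded frechet_derivative_works] \<open>open S\<close> that Suc.prems(1)
    by (rule has_derivative_transform_within_open)
  have "frechet_derivative g (at x) = frechet_derivative f (at x)" if "x \<in> S" for x
    using frechet_derivative_at[OF der[OF that]] by simp
  moreover have "Ck_on k S (\<lambda>x. frechet_derivative f (at x) v)" for v
    using Suc.prems by simp
  ultimately have "Ck_on k S (\<lambda>x. frechet_derivative g (at x) v)" for v
    using Suc.IH[of "\<lambda>x. frechet_derivative f (at x) v" "\<lambda>x. frechet_derivative g (at x) v"] by simp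
  then show ?case using der by (auto simp: differentiable_def)
qed

text \<open>Replacing \<open>frechet_derivative\<close> by an explicit derivative is what makes the product rule, the
  chain rule and the like usable as induction steps below.\<close>

lemma Ck_on_SucI:
  assumes "open S" "\<And>x. x \<in> S \<Longrightarrow> (f has_derivative f' x) (at x)"
    "\<And>v. Ck_on k S (\<lambda>x. f' x v)"
  shows "Ck_on (Suc k) S f"
proof -
  have "frechet_derivative f (at x) = f' x" if "x \<in> S" for x
    using frechet_derivative_at[OF assms(2)[OF that]] by simp
  then have "Ck_on k S (\<lambda>x. frechet_derivative f (at x) v)" for v
    by (intro Ck_on_cong[OF assms(1) _ assms(3)]) auto
  then show ?thesis using assms(2) by (auto simp: differentiable_def)
qed

lemma Ck_on_Suc_has_derivative:
  "Ck_on (Suc k) S f \<Longrightarrow> x \<in> S \<Longrightarrow> (f has_derivative frechet_derivative f (at x)) (at x)"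
  by (simp add: frechet_derivative_works[symmetric])

lemma Ck_on_const: "open S \<Longrightarrow> Ck_on k S (\<lambda>x. c)"
  by (induction k arbitrary: c) auto

lemma Ck_on_bounded_linear:
  assumes "open S" "bounded_linear L"
  shows "Ck_on k S L"
proof (cases k)
  case 0
  then show ?thesis using assms by (simp add: linear_continuous_on)
next
  case (Suc l)
  have "Ck_on (Suc l) S L"
    by (rule Ck_on_SucI[where f' = "\<lambda>x. L"])
       (simp_all add: assms Ck_on_const bounded_linear_imp_has_derivative)
  then show ?thesis by (simp add: Suc)
qed

lemma Ck_on_add:
  assumes "open S" "Ck_on k S f" "Ck_on k S g"
  shows "Ck_on k S (\<lambda>x. f x + g x)"
  using assms(2,3)
proof (induction k arbitrary: f g)
  case (Suc k)
  have "Ck_on k S (\<lambda>x. frechet_derivative f (at x) v + frechet_derivative g (at x) v)" for v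
    using Suc by simp
  moreover have "((\<lambda>x. f x + g x) has_derivative
      (\<lambda>v. frechet_derivative f (at x) v + frechet_derivative g (at x) v)) (at x)" if "x \<in> S" for x
    using that by (intro has_derivative_add Suc.prems[THEN Ck_on_Suc_has_derivative])
  ultimately show ?case by (intro Ck_on_SucI[OF assms(1)])
qed (auto intro: continuous_on_add)

lemma Ck_on_bilinear:
  assumes "bounded_bilinear p" "open S" "Ck_on k S f" "Ck_on k S g"
  shows "Ck_on k S (\<lambda>x. p (f x) (g x))"
  using assms(3,4)
proof (induction k arbitrary: f g)
  case 0
  then show ?case
    using assms(1) by (auto intro: bounded_bilinear.continuous_on)
next
  case (Suc k)
  have "Ck_on k S (\<lambda>x. p (f x) (frechet_derivative g (at x) v) + p (frechet_derivative f (at x) v) (g x))" for v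
    using Suc.prems Ck_on_Suc_D[OF Suc.prems(1)] Ck_on_Suc_D[OF Suc.prems(2)]
    by (intro Ck_on_add[OF assms(2)] Suc.IH) auto
  moreover have "((\<lambda>x. p (f x) (g x)) has_derivative
      (\<lambda>v. p (f x) (frechet_derivative g (at x) v) + p (frechet_derivative f (at x) v) (g x))) (at x)"
    if "x \<in> S" for x
    using that
    by (intro bounded_bilinear.FDERIV[OF assms(1)] Suc.prems[THEN Ck_on_Suc_has_derivative])
  ultimately show ?case by (intro Ck_on_SucI[OF assms(2)])
qed

lemma Ck_on_sum:
  assumes "open S" "\<And>i. i \<in> I \<Longrightarrow> Ck_on k S (f i)"
  shows "Ck_on k S (\<lambda>x. \<Sum>i\<in>I. f i x)"
  using assms(2)
  by (induction I rule: infinite_finite_induct) (auto intro!: Ck_on_add Ck_on_const assms(1))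

lemma Ck_on_linear_image:
  assumes "open S" "bounded_linear L" "Ck_on k S f"
  shows "Ck_on k S (\<lambda>x. L (f x))"
  using assms(3)
proof (induction k arbitrary: f)
  case 0
  then show ?case using assms(2) by (auto intro: bounded_linear.continuous_on)
next
  case (Suc k)
  then have "Ck_on k S (\<lambda>x. L (frechet_derivative f (at x) v))" for v by simp
  moreover have "((\<lambda>x. L (f x)) has_derivative (\<lambda>v. L (frechet_derivative f (at x) v))) (at x)"
    if "x \<in> S" for x
    using that by (intro bounded_linear.has_derivative[OF assms(2)]
        Suc.prems[THEN Ck_on_Suc_has_derivative])
  ultimately show ?case by (intro Ck_on_SucI[OF assms(1)])
qed

text \<open>By the chain rule the derivative of \<open>g \<circ> f\<close> in direction \<open>v\<close> is the sum over a basis of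
  the components of the derivative of \<open>f\<close> times the partial derivatives of \<open>g\<close> composed with \<open>f\<close>;
  the induction hypothesis applies to each of the latter.\<close>

lemma Ck_on_compose:
  fixes f :: "'m::euclidean_space \<Rightarrow> 'k::euclidean_space"
  assumes "open S" "open U" "f ` S \<subseteq> U" "Ck_on k S f" "Ck_on k U g"
  shows "Ck_on k S (\<lambda>x. g (f x))"
  using assms(4,5)
proof (induction k arbitrary: g)
  case 0
  then show ?case using assms(3) by (auto intro: continuous_on_compose2)
next
  case (Suc k)
  define h where "h = (\<lambda>x v. \<Sum>b\<in>Basis. (frechet_derivative f (at x) v \<bullet> b) *\<^sub>R
    frechet_derivative g (at (f x)) b)"
  have der: "((\<lambda>x. g (f x)) has_derivative h x) (at x)" if "x \<in> S" for x
  proof -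
    have "f x \<in> U" using that assms(3) by auto
    note g = Ck_on_Suc_has_derivative[OF Suc.prems(2) this]
    have lin: "linear (frechet_derivative g (at (f x)))"
      using g by (rule has_derivative_linear)
    have "h x = (\<lambda>v. frechet_derivative g (at (f x)) (frechet_derivative f (at x) v))"
    proof
      fix v
      show "h x v = frechet_derivative g (at (f x)) (frechet_derivative f (at x) v)"
        unfolding h_def
        by (subst (3) euclidean_representation[symmetric])
           (simp add: linear_sum[OF lin] linear_scale[OF lin])
    qed
    then show ?thesis
      using diff_chain_at[OF Ck_on_Suc_has_derivative[OF Suc.prems(1) that] g]
      by (simp add: o_def)
  qed
  have "Ck_on k S (\<lambda>x. h x v)" for v
    unfolding h_def
  proof (intro Ck_on_sum[OF assms(1)] Ck_on_bilinear[OF bounded_bilinear_scaleR assms(1)])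
    fix b :: 'k
    show "Ck_on k S (\<lambda>x. frechet_derivative f (at x) v \<bullet> b)"
      using Suc.prems(1) by (intro Ck_on_linear_image[OF assms(1) bounded_linear_inner_left]) auto
    show "Ck_on k S (\<lambda>x. frechet_derivative g (at (f x)) b)"
      using Suc.prems(2) by (intro Suc.IH Ck_on_Suc_D[OF Suc.prems(1)]) auto
  qed
  with der show ?case by (intro Ck_on_SucI[OF assms(1)])
qed

lemma Ck_on_inverse:
  fixes f :: "'m::euclidean_space \<Rightarrow> real"
  assumes "open S" "Ck_on k S f" "\<And>x. x \<in> S \<Longrightarrow> f x \<noteq> 0"
  shows "Ck_on k S (\<lambda>x. inverse (f x))"
  using assms(2)
proof (induction k)
  case 0
  then show ?case using assms(3) by (auto intro: continuous_on_inverse)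
next
  case (Suc k)
  have inv: "Ck_on k S (\<lambda>x. inverse (f x))"
    by (rule Suc.IH[OF Ck_on_Suc_D[OF Suc.prems]])
  have "Ck_on k S (\<lambda>x. - (inverse (f x) * frechet_derivative f (at x) v * inverse (f x)))" for v
    using Suc.prems inv
    by (intro Ck_on_linear_image[OF assms(1) bounded_linear_minus[OF bounded_linear_ident]]
        Ck_on_bilinear[OF bounded_bilinear_mult assms(1)]) auto
  moreover have "((\<lambda>x. inverse (f x)) has_derivative
      (\<lambda>v. - (inverse (f x) * frechet_derivative f (at x) v * inverse (f x)))) (at x)"
    if "x \<in> S" for x
    using that by (intro Deriv.has_derivative_inverse assms(3) Suc.prems[THEN Ck_on_Suc_has_derivative])
  ultimately show ?case by (intro Ck_on_SucI[OF assms(1)])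
qed

lemma smooth_on_cong:
  "open S \<Longrightarrow> (\<And>x. x \<in> S \<Longrightarrow> f x = g x) \<Longrightarrow> smooth_on S f \<Longrightarrow> smooth_on S g"
  unfolding smooth_on_def by (blast intro: Ck_on_cong)

lemma smooth_on_subset: "smooth_on S f \<Longrightarrow> S' \<subseteq> S \<Longrightarrow> smooth_on S' f"
  unfolding smooth_on_def by (blast intro: Ck_on_subset)

lemma smooth_on_const: "open S \<Longrightarrow> smooth_on S (\<lambda>x. c)"
  by (simp add: smooth_on_def Ck_on_const)

lemma smooth_on_bounded_linear: "open S \<Longrightarrow> bounded_linear L \<Longrightarrow> smooth_on S L"
  by (simp add: smooth_on_def Ck_on_bounded_linear)

lemma smooth_on_linear_image:
  "open S \<Longrightarrow> bounded_linear L \<Longrightarrow> smooth_on S f \<Longrightarrow> smooth_on S (\<lambda>x. L (f x))"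
  by (simp add: smooth_on_def Ck_on_linear_image)

lemma smooth_on_add:
  "open S \<Longrightarrow> smooth_on S f \<Longrightarrow> smooth_on S g \<Longrightarrow> smooth_on S (\<lambda>x. f x + g x)"
  by (simp add: smooth_on_def Ck_on_add)

lemma smooth_on_mult:
  fixes f g :: "'m::euclidean_space \<Rightarrow> real"
  shows "open S \<Longrightarrow> smooth_on S f \<Longrightarrow> smooth_on S g \<Longrightarrow> smooth_on S (\<lambda>x. f x * g x)"
  by (simp add: smooth_on_def Ck_on_bilinear[OF bounded_bilinear_mult])

lemma smooth_on_sum:
  "open S \<Longrightarrow> (\<And>i. i \<in> I \<Longrightarrow> smooth_on S (f i)) \<Longrightarrow> smooth_on S (\<lambda>x. \<Sum>i\<in>I. f i x)"
  by (simp add: smooth_on_def Ck_on_sum)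

lemma smooth_on_prod:
  fixes f :: "'i \<Rightarrow> 'm::euclidean_space \<Rightarrow> real"
  assumes "open S" "\<And>i. i \<in> I \<Longrightarrow> smooth_on S (f i)"
  shows "smooth_on S (\<lambda>x. \<Prod>i\<in>I. f i x)"
  using assms(2)
  by (induction I rule: infinite_finite_induct) (auto intro!: smooth_on_mult smooth_on_const assms(1))

lemma smooth_on_inverse:
  fixes f :: "'m::euclidean_space \<Rightarrow> real"
  shows "open S \<Longrightarrow> smooth_on S f \<Longrightarrow> (\<And>x. x \<in> S \<Longrightarrow> f x \<noteq> 0) \<Longrightarrow> smooth_on S (\<lambda>x. inverse (f x))"
  by (simp add: smooth_on_def Ck_on_inverse)

lemma smooth_on_compose:
  fixes f :: "'m::euclidean_space \<Rightarrow> 'k::euclidean_space"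
  shows "open S \<Longrightarrow> open U \<Longrightarrow> f ` S \<subseteq> U \<Longrightarrow> smooth_on S f \<Longrightarrow> smooth_on U g \<Longrightarrow>
    smooth_on S (\<lambda>x. g (f x))"
  by (auto simp: smooth_on_def intro: Ck_on_compose)

lemma smooth_on_derivative: "smooth_on S f \<Longrightarrow> smooth_on S (\<lambda>x. frechet_derivative f (at x) v)"
  unfolding smooth_on_def by (metis Ck_on.simps(2))

lemma smooth_on_has_derivative:
  "smooth_on S f \<Longrightarrow> x \<in> S \<Longrightarrow> (f has_derivative frechet_derivative f (at x)) (at x)"
  unfolding smooth_on_def using Ck_on_Suc_has_derivative by blast

lemma smooth_on_continuous: "smooth_on S f \<Longrightarrow> continuous_on S f"
  unfolding smooth_on_def by (metis Ck_on.simps(1))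

lemma matrix_inv_mult:
  fixes A :: "real^'p^'p"
  assumes "invertible A"
  shows "A ** matrix_inv A = mat 1" "matrix_inv A ** A = mat 1"
  using someI_ex[OF assms[unfolded invertible_def]] by (simp_all add: matrix_inv_def)

text \<open>Cramer's rule writes the entries of the inverse matrix as quotients of determinants, which
  are polynomials in the entries of the matrix.\<close>

lemma smooth_on_matrix_inv:
  fixes A :: "'m::euclidean_space \<Rightarrow> real^'p^'p"
  assumes "open S" "\<And>i j. smooth_on S (\<lambda>x. A x $ i $ j)" "\<And>x. x \<in> S \<Longrightarrow> invertible (A x)"
  shows "smooth_on S (\<lambda>x. matrix_inv (A x) $ i $ j)"
proof -
  have det: "smooth_on S (\<lambda>x. det (B x))" if "\<And>i j. smooth_on S (\<lambda>x. B x $ i $ j)"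
    for B :: "'m \<Rightarrow> real^'p^'p"
    unfolding det_def
    by (intro smooth_on_sum smooth_on_mult smooth_on_const smooth_on_prod assms(1) that)
  define B where "B = (\<lambda>x. (\<chi> k l. if l = i then axis j 1 $ k else A x $ k $ l) :: real^'p^'p)"
  have eq: "det (B x) * inverse (det (A x)) = matrix_inv (A x) $ i $ j" if "x \<in> S" for x
  proof -
    have d: "det (A x) \<noteq> 0" using assms(3)[OF that] by (simp add: invertible_det_nz)
    have "A x *v (matrix_inv (A x) *v axis j 1) = axis j 1"
      using matrix_inv_mult(1)[OF assms(3)[OF that]] by (simp add: matrix_vector_mul_assoc)
    then have "matrix_inv (A x) *v axis j 1 = (\<chi> k. det (\<chi> i' j'. if j' = k then axis j 1 $ i' else A x $ i' $ j') / det (A x))"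
      using cramer[OF d] by blast
    then have "(matrix_inv (A x) *v axis j 1) $ i = det (B x) / det (A x)"
      by (simp add: B_def)
    then show ?thesis
      by (simp add: matrix_vector_mult_basis column_def divide_inverse)
  qed
  have "smooth_on S (\<lambda>x. B x $ k $ l)" for k l
    by (cases "l = i") (auto simp: B_def intro: smooth_on_const assms)
  then have "smooth_on S (\<lambda>x. det (B x) * inverse (det (A x)))"
    using assms by (intro smooth_on_mult smooth_on_inverse det) (auto simp: invertible_det_nz)
  then show ?thesis using eq by (rule smooth_on_cong[OF assms(1), rotated])
qed

lemma has_derivative_along_line:
  assumes "(g has_derivative g') (at (p + r *\<^sub>R w))"
  shows "((\<lambda>r. g (p + r *\<^sub>R w)) has_real_derivative g' w) (at r)"
proof -
  interpret bounded_linear g' using assms by (rule has_derivative_bounded_linear)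
  have "((\<lambda>r. p + r *\<^sub>R w) has_derivative (\<lambda>r. r *\<^sub>R w)) (at r)"
    by (auto intro!: derivative_eq_intros)
  from diff_chain_at[OF this assms] show ?thesis
    by (simp add: has_field_derivative_def o_def scale mult_commute_abs)
qed

text \<open>Twice the mean value theorem: the second difference of \<open>f\<close> over the parallelogram spanned
  by \<open>s *\<^sub>R u\<close> and \<open>s *\<^sub>R v\<close> is \<open>s\<^sup>2\<close> times a mixed second derivative at a point of it.\<close>

lemma second_difference_mean_value:
  fixes f :: "'m::euclidean_space \<Rightarrow> real"
  assumes f: "Ck_on 2 S f" and "s > 0"
    and S: "\<And>a b. 0 \<le> a \<Longrightarrow> a \<le> s \<Longrightarrow> 0 \<le> b \<Longrightarrow> b \<le> s \<Longrightarrow> x + a *\<^sub>R u + b *\<^sub>R v \<in> S"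
  shows "\<exists>a b. 0 < a \<and> a < s \<and> 0 < b \<and> b < s \<and>
    f (x + s *\<^sub>R u + s *\<^sub>R v) - f (x + s *\<^sub>R u) - f (x + s *\<^sub>R v) + f x =
    s * (s * frechet_derivative (\<lambda>y. frechet_derivative f (at y) u) (at (x + a *\<^sub>R u + b *\<^sub>R v)) v)"
proof -
  define D where "D = (\<lambda>y. frechet_derivative f (at y) u)"
  have "Ck_on (Suc (Suc 0)) S f" using f by (simp only: numeral_2_eq_2)
  then have f1: "(f has_derivative frechet_derivative f (at y)) (at y)"
    and f2: "(D has_derivative frechet_derivative D (at y)) (at y)" if "y \<in> S" for y
    using that by (auto simp: frechet_derivative_works[symmetric] D_def)
  define \<phi> where "\<phi> = (\<lambda>a. f ((x + s *\<^sub>R v) + a *\<^sub>R u) - f (x + a *\<^sub>R u))"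
  have "\<exists>a>0. a < s \<and> \<phi> s - \<phi> 0 = (s - 0) * (D ((x + s *\<^sub>R v) + a *\<^sub>R u) - D (x + a *\<^sub>R u))"
  proof (rule MVT2[OF \<open>s > 0\<close>])
    fix a assume a: "0 \<le> a" "a \<le> s"
    then have "x + s *\<^sub>R v + a *\<^sub>R u \<in> S" "x + a *\<^sub>R u \<in> S"
      using S[of a s] S[of a 0] \<open>s > 0\<close> by (simp_all add: ac_simps)
    then show "(\<phi> has_real_derivative D ((x + s *\<^sub>R v) + a *\<^sub>R u) - D (x + a *\<^sub>R u)) (at a)"
      unfolding \<phi>_def D_def by (intro DERIV_diff has_derivative_along_line f1)
  qed
  then obtain a where a: "0 < a" "a < s"
    and 1: "\<phi> s - \<phi> 0 = s * (D ((x + s *\<^sub>R v) + a *\<^sub>R u) - D (x + a *\<^sub>R u))" by auto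
  define \<psi> where "\<psi> = (\<lambda>b. D ((x + a *\<^sub>R u) + b *\<^sub>R v))"
  have "\<exists>b>0. b < s \<and> \<psi> s - \<psi> 0 = (s - 0) * frechet_derivative D (at ((x + a *\<^sub>R u) + b *\<^sub>R v)) v"
  proof (rule MVT2[OF \<open>s > 0\<close>])
    fix b assume "0 \<le> b" "b \<le> s"
    then have "x + a *\<^sub>R u + b *\<^sub>R v \<in> S" using S[of a b] a by simp
    then show "(\<psi> has_real_derivative frechet_derivative D (at ((x + a *\<^sub>R u) + b *\<^sub>R v)) v) (at b)"
      unfolding \<psi>_def by (intro has_derivative_along_line f2)
  qed
  then obtain b where b: "0 < b" "b < s"
    and 2: "\<psi> s - \<psi> 0 = s * frechet_derivative D (at ((x + a *\<^sub>R u) + b *\<^sub>R v)) v" by auto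
  have "\<phi> s - \<phi> 0 = s * (\<psi> s - \<psi> 0)" using 1 by (simp add: \<psi>_def ac_simps)
  then have "f (x + s *\<^sub>R u + s *\<^sub>R v) - f (x + s *\<^sub>R u) - f (x + s *\<^sub>R v) + f x =
      s * (s * frechet_derivative D (at (x + a *\<^sub>R u + b *\<^sub>R v)) v)"
    unfolding 2 by (simp add: \<phi>_def ac_simps)
  then show ?thesis
    using a b unfolding D_def by blast
qed

text \<open>The second difference of \<open>f\<close> over a small parallelogram is symmetric in the two edges, so by the
  mean value theorem the two mixed derivatives have equal values at two points of the
  parallelogram. The mixed derivatives are continuous, and shrinking the parallelogram gives the claim.\<close>

lemma mixed_second_derivatives_commute:
  fixes f :: "'m::euclidean_space \<Rightarrow> real"
  assumes "open S" "Ck_on 2 S f" "x \<in> S"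
  shows "frechet_derivative (\<lambda>y. frechet_derivative f (at y) u) (at x) v =
    frechet_derivative (\<lambda>y. frechet_derivative f (at y) v) (at x) u"
proof -
  define F where "F = (\<lambda>u v y. frechet_derivative (\<lambda>y. frechet_derivative f (at y) u) (at y) v)"
  have cont: "continuous (at x) (F u v)" for u v
  proof -
    have "Ck_on (Suc (Suc 0)) S f" using assms(2) by (simp only: numeral_2_eq_2)
    then have "continuous_on S (F u v)" by (simp add: F_def)
    then show ?thesis using assms(1,3) by (simp add: continuous_on_eq_continuous_at)
  qed
  obtain r where r: "r > 0" "ball x r \<subseteq> S" using assms(1,3) openE by blast
  have "\<bar>F u v x - F v u x\<bar> \<le> e" if "e > 0" for e
  proof -
    have "e / 2 > 0" using that by simp
    then obtain d1 where d1: "d1 > 0" "\<And>y. dist y x < d1 \<Longrightarrow> dist (F u v y) (F u v x) < e / 2"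
      using cont[of u v] unfolding continuous_at_eps_delta by blast
    obtain d2 where d2: "d2 > 0" "\<And>y. dist y x < d2 \<Longrightarrow> dist (F v u y) (F v u x) < e / 2"
      using cont[of v u] \<open>e / 2 > 0\<close> unfolding continuous_at_eps_delta by blast
    define d where "d = min r (min d1 d2)"
    \<comment> \<open>with this \<open>s\<close> the whole parallelogram has distance less than \<open>d\<close> from \<open>x\<close>; the summand \<open>1\<close>
      covers the case that \<open>u\<close> and \<open>v\<close> both vanish\<close>
    define s where "s = d / (2 * (norm u + norm v + 1))"
    have "d > 0" using r d1 d2 by (simp add: d_def)
    then have "s > 0" by (simp add: s_def add_nonneg_pos)
    have near: "dist (x + a *\<^sub>R u + b *\<^sub>R v) x < d" if "0 \<le> a" "a \<le> s" "0 \<le> b" "b \<le> s" for a b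
    proof -
      have "norm (a *\<^sub>R u + b *\<^sub>R v) \<le> a * norm u + b * norm v"
        using norm_triangle_ineq[of "a *\<^sub>R u" "b *\<^sub>R v"] that by simp
      also have "\<dots> \<le> s * norm u + s * norm v" using that by (intro add_mono mult_right_mono) auto
      also have "\<dots> = s * (norm u + norm v)" by (simp only: distrib_left)
      also have "\<dots> < s * (2 * (norm u + norm v + 1))"
      proof (rule mult_strict_left_mono[OF _ \<open>s > 0\<close>])
        have "0 \<le> norm u + norm v" by simp
        then show "norm u + norm v < 2 * (norm u + norm v + 1)" by argo
      qed
      also have "\<dots> = d"
      proof -
        have "0 \<le> norm u + norm v" by simp
        then have "2 * (norm u + norm v + 1) \<noteq> 0" by argo
        then show ?thesis unfolding s_def by (rule nonzero_eq_divide_eq[THEN iffD1]) simp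
      qed
      finally show ?thesis by (simp add: dist_norm add.assoc)
    qed
    have in_S: "x + a *\<^sub>R u + b *\<^sub>R v \<in> S" if "0 \<le> a" "a \<le> s" "0 \<le> b" "b \<le> s" for a b
      using near[OF that] r by (auto simp: d_def dist_commute)
    obtain a b where ab: "0 < a" "a < s" "0 < b" "b < s"
      and 1: "f (x + s *\<^sub>R u + s *\<^sub>R v) - f (x + s *\<^sub>R u) - f (x + s *\<^sub>R v) + f x =
         s * (s * F u v (x + a *\<^sub>R u + b *\<^sub>R v))"
      using second_difference_mean_value[OF assms(2) \<open>s > 0\<close> in_S] unfolding F_def by blast
    have "x + a *\<^sub>R v + b *\<^sub>R u \<in> S" if "0 \<le> a" "a \<le> s" "0 \<le> b" "b \<le> s" for a b
      using in_S[of b a] that by (simp add: ac_simps)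
    from second_difference_mean_value[OF assms(2) \<open>s > 0\<close> this]
    obtain a' b' where ab': "0 < a'" "a' < s" "0 < b'" "b' < s"
      and 2: "f (x + s *\<^sub>R v + s *\<^sub>R u) - f (x + s *\<^sub>R v) - f (x + s *\<^sub>R u) + f x =
         s * (s * F v u (x + a' *\<^sub>R v + b' *\<^sub>R u))"
      unfolding F_def by blast
    have swap: "x + s *\<^sub>R v + s *\<^sub>R u = x + s *\<^sub>R u + s *\<^sub>R v"
      "x + a' *\<^sub>R v + b' *\<^sub>R u = x + b' *\<^sub>R u + a' *\<^sub>R v"
      by (simp_all add: ac_simps)
    have "s * (s * F u v (x + a *\<^sub>R u + b *\<^sub>R v)) = s * (s * F v u (x + b' *\<^sub>R u + a' *\<^sub>R v))"
      using 1 2[unfolded swap] by argo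
    then have "F u v (x + a *\<^sub>R u + b *\<^sub>R v) = F v u (x + b' *\<^sub>R u + a' *\<^sub>R v)"
      using \<open>s > 0\<close> by simp
    moreover have "dist (F u v (x + a *\<^sub>R u + b *\<^sub>R v)) (F u v x) < e / 2"
      using near[of a b] ab by (intro d1) (auto simp: d_def)
    moreover have "dist (F v u (x + b' *\<^sub>R u + a' *\<^sub>R v)) (F v u x) < e / 2"
      using near[of b' a'] ab' by (intro d2) (auto simp: d_def)
    ultimately have "dist (F u v x) (F v u x) < e" by (metis dist_triangle_half_r)
    then show ?thesis by (simp add: dist_real_def)
  qed
  then have "F u v x = F v u x"
    using field_le_epsilon[of "\<bar>F u v x - F v u x\<bar>" 0] by simp
  then show ?thesis by (simp add: F_def)
qed

section \<open>Differentiable atlases\<close>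

lemma open_coord_image:
  assumes "topological_chart X c" "openin X U" "U \<subseteq> dom_of c"
  shows "open (coord c ` U)"
proof -
  have "openin (subtopology X (dom_of c)) U"
    using assms by (metis openin_subtopology inf.absorb1)
  then have "openin (top_of_set (coord c ` dom_of c)) (coord c ` U)"
    using assms(1) homeomorphic_imp_open_map unfolding topological_chart_def open_map_def by blast
  then show ?thesis
    using assms(1) by (auto simp: topological_chart_def intro: openin_open_trans)
qed

lemma openin_coord_preimage:
  assumes "topological_chart X c" "open V"
  shows "openin X {q \<in> dom_of c. coord c q \<in> V}"
proof -
  have X: "openin X (dom_of c)" and
    "continuous_map (subtopology X (dom_of c)) (top_of_set (coord c ` dom_of c)) (coord c)"
    using assms(1) by (auto simp: topological_chart_def dest: homeomorphic_imp_continuous_map)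
  then have "continuous_map (subtopology X (dom_of c)) euclidean (coord c)"
    by (simp add: continuous_map_in_subtopology)
  then have "openin (subtopology X (dom_of c)) {q \<in> topspace (subtopology X (dom_of c)). coord c q \<in> V}"
    using assms(2) by (intro openin_continuous_map_preimage) auto
  moreover have "topspace (subtopology X (dom_of c)) = dom_of c"
    by (rule topspace_subtopology_subset[OF openin_subset[OF X]])
  ultimately have "openin (subtopology X (dom_of c)) {q \<in> dom_of c. coord c q \<in> V}"
    by (simp only:)
  then show ?thesis using X by (rule openin_trans_full)
qed

lemma inj_on_topological_chart: "topological_chart X c \<Longrightarrow> inj_on (coord c) (dom_of c)"
  using topspace_subtopology_subset[OF openin_subset[of X "dom_of c"]]
  by (auto simp: topological_chart_def dest!: homeomorphic_imp_injective_map)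

text \<open>Only these properties of an atlas enter the calculus with tangent vectors. They are shared by the
  atlas of a manifold and by the induced charts of the jet bundle, which need not form a maximal atlas.\<close>

locale differentiable_atlas =
  fixes C :: "('a, 'm::euclidean_space) chart set"
  assumes inj_coord: "c \<in> C \<Longrightarrow> inj_on (coord c) (dom_of c)"
    and open_overlap: "c \<in> C \<Longrightarrow> d \<in> C \<Longrightarrow> open (coord c ` (dom_of c \<inter> dom_of d))"
    and transition_differentiable: "c \<in> C \<Longrightarrow> d \<in> C \<Longrightarrow> q \<in> dom_of c \<Longrightarrow> q \<in> dom_of d \<Longrightarrow>
      transition c d differentiable (at (coord c q))"

abbreviation chart_jacobian ::
  "('a, 'm::euclidean_space) chart \<Rightarrow> ('a, 'm) chart \<Rightarrow> 'a \<Rightarrow> 'm \<Rightarrow> 'm" where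
  "chart_jacobian c d q \<equiv> frechet_derivative (transition c d) (at (coord c q))"

context differentiable_atlas
begin

lemma inv_chart_coord: "c \<in> C \<Longrightarrow> q \<in> dom_of c \<Longrightarrow> inv_chart c (coord c q) = q"
  unfolding inv_chart_def by (rule inv_into_f_f[OF inj_coord])

lemma transition_coord: "c \<in> C \<Longrightarrow> q \<in> dom_of c \<Longrightarrow> transition c d (coord c q) = coord d q"
  by (simp add: transition_def inv_chart_coord)

lemma open_coord_dom: "c \<in> C \<Longrightarrow> open (coord c ` dom_of c)"
  using open_overlap[of c c] by simp

lemma transition_has_derivative:
  "c \<in> C \<Longrightarrow> d \<in> C \<Longrightarrow> q \<in> dom_of c \<Longrightarrow> q \<in> dom_of d \<Longrightarrow>
    (transition c d has_derivative chart_jacobian c d q) (at (coord c q))"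
  using transition_differentiable by (simp add: frechet_derivative_works)

lemma linear_chart_jacobian:
  "c \<in> C \<Longrightarrow> d \<in> C \<Longrightarrow> q \<in> dom_of c \<Longrightarrow> q \<in> dom_of d \<Longrightarrow> linear (chart_jacobian c d q)"
  by (rule has_derivative_linear[OF transition_has_derivative])

lemma has_derivative_change_chart:
  assumes "c \<in> C" "d \<in> C" "q \<in> dom_of c" "q \<in> dom_of d"
    and "(F \<circ> inv_chart d has_derivative F') (at (coord d q))"
  shows "(F \<circ> inv_chart c has_derivative (\<lambda>v. F' (chart_jacobian c d q v))) (at (coord c q))"
proof -
  have "((F \<circ> inv_chart d) \<circ> transition c d has_derivative F' \<circ> chart_jacobian c d q) (at (coord c q))"
    using assms
    by (intro diff_chain_at transition_has_derivative) (simp_all add: transition_coord)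
  then have "(F \<circ> inv_chart c has_derivative F' \<circ> chart_jacobian c d q) (at (coord c q))"
  proof (rule has_derivative_transform_within_open[OF _ open_overlap[OF assms(1,2)]])
    show "coord c q \<in> coord c ` (dom_of c \<inter> dom_of d)" using assms by blast
  qed (auto simp: inv_chart_coord transition_coord assms(1,2))
  then show ?thesis by (simp add: o_def)
qed

lemma chart_jacobian_trans:
  assumes "b \<in> C" "c \<in> C" "d \<in> C" "q \<in> dom_of b" "q \<in> dom_of c" "q \<in> dom_of d"
  shows "chart_jacobian c d q (chart_jacobian b c q v) = chart_jacobian b d q v"
proof -
  have "(coord d \<circ> inv_chart c has_derivative chart_jacobian c d q) (at (coord c q))"
    using transition_has_derivative[of c d q] assms by (simp add: transition_def)
  from has_derivative_change_chart[OF assms(1,2,4,5) this]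
  have "(transition b d has_derivative (\<lambda>v. chart_jacobian c d q (chart_jacobian b c q v))) (at (coord b q))"
    by (simp add: transition_def)
  then show ?thesis using frechet_derivative_at by metis
qed

lemma chart_jacobian_self:
  assumes "c \<in> C" "q \<in> dom_of c"
  shows "chart_jacobian c c q v = v"
proof -
  have "((\<lambda>x. x) has_derivative (\<lambda>v. v)) (at (coord c q))" by (rule has_derivative_ident)
  then have "(transition c c has_derivative (\<lambda>v. v)) (at (coord c q))"
  proof (rule has_derivative_transform_within_open[OF _ open_coord_dom[OF assms(1)]])
    show "coord c q \<in> coord c ` dom_of c" using assms(2) by (rule imageI)
    show "x = transition c c x" if "x \<in> coord c ` dom_of c" for x
      using that transition_coord[OF assms(1)] by (metis imageE)
  qed
  then show ?thesis using frechet_derivative_at by metis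
qed

lemma coord_vec_apply:
  "d \<in> C \<Longrightarrow> q \<in> dom_of d \<Longrightarrow> coord_vec C c w q d = chart_jacobian c d q w"
  by (simp add: coord_vec_def)

lemma coord_vec_self: "c \<in> C \<Longrightarrow> q \<in> dom_of c \<Longrightarrow> coord_vec C c w q c = w"
  by (simp add: coord_vec_apply chart_jacobian_self)

lemma coord_vec_tangent:
  "c \<in> C \<Longrightarrow> q \<in> dom_of c \<Longrightarrow> coord_vec C c w q \<in> tangent_space C q"
  by (auto simp: tangent_space_def coord_vec_def chart_jacobian_trans)

text \<open>A tangent vector is determined by its components in one chart. Hence two fields of tangent vectors
  may be compared in a single chart.\<close>

lemma tangent_vector_eq_coord_vec:
  assumes "v \<in> tangent_space C q" "c \<in> C" "q \<in> dom_of c"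
  shows "v = coord_vec C c (v c) q"
proof
  fix d
  show "v d = coord_vec C c (v c) q d"
  proof (cases "d \<in> C \<and> q \<in> dom_of d")
    case True
    then have "v d = chart_jacobian c d q (v c)"
      using assms unfolding tangent_space_def by blast
    then show ?thesis using True by (simp only: coord_vec_apply)
  next
    case False
    then have "v d = 0" using assms(1) unfolding tangent_space_def by blast
    then show ?thesis using False by (auto simp: coord_vec_def)
  qed
qed

text \<open>In every further chart around the point this is the chain rule for the transition maps.\<close>

lemma coord_vec_change_chart:
  assumes "c \<in> C" "d \<in> C" "q \<in> dom_of c" "q \<in> dom_of d"
  shows "coord_vec C c w q = coord_vec C d (chart_jacobian c d q w) q"
  using assms by (auto simp: coord_vec_def chart_jacobian_trans)

lemma coord_vec_sum:
  assumes "c \<in> C" "q \<in> dom_of c"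
  shows "coord_vec C c (\<Sum>i\<in>I. r i *\<^sub>R w i) q d = (\<Sum>i\<in>I. r i *\<^sub>R coord_vec C c (w i) q d)"
  using assms
  by (auto simp: coord_vec_def linear_sum[OF linear_chart_jacobian] linear_scale[OF linear_chart_jacobian])

lemma coord_vec_diff:
  assumes "c \<in> C" "q \<in> dom_of c"
  shows "coord_vec C c (v - w) q d = coord_vec C c v q d - coord_vec C c w q d"
  using assms by (auto simp: coord_vec_def linear_diff[OF linear_chart_jacobian])

lemma coord_vec_lincomb:
  assumes "c \<in> C" "q \<in> dom_of c"
  shows "coord_vec C c (r *\<^sub>R v + s *\<^sub>R w) q = (\<lambda>d. r *\<^sub>R coord_vec C c v q d + s *\<^sub>R coord_vec C c w q d)"
  using assms
  by (auto simp: coord_vec_def fun_eq_iff linear_add[OF linear_chart_jacobian] linear_scale[OF linear_chart_jacobian])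

lemma partial_linear_coord:
  assumes "c \<in> C" "d \<in> C" "q \<in> dom_of c" "q \<in> dom_of d" "bounded_linear L"
  shows "partial c w (\<lambda>p. L (coord d p)) q = L (chart_jacobian c d q w)"
proof -
  have "((\<lambda>x. L (transition c d x)) has_derivative (\<lambda>v. L (chart_jacobian c d q v))) (at (coord c q))"
    using assms by (intro bounded_linear.has_derivative[OF assms(5)] transition_has_derivative)
  then have "((\<lambda>p. L (coord d p)) \<circ> inv_chart c has_derivative (\<lambda>v. L (chart_jacobian c d q v)))
      (at (coord c q))"
    by (simp add: transition_def o_def)
  then show ?thesis unfolding partial_def using frechet_derivative_at by metis
qed

end

lemma smooth_manifold_topological_chart:
  "smooth_manifold X \<Longrightarrow> c \<in> atlas X \<Longrightarrow> topological_chart (mtop X) c"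
  by (simp add: smooth_manifold_def)

lemma smooth_transition:
  "smooth_manifold X \<Longrightarrow> c \<in> atlas X \<Longrightarrow> d \<in> atlas X \<Longrightarrow>
    smooth_on (coord c ` (dom_of c \<inter> dom_of d)) (transition c d)"
  unfolding smooth_manifold_def compatible_def by blast

lemma openin_dom_of: "smooth_manifold X \<Longrightarrow> c \<in> atlas X \<Longrightarrow> openin (mtop X) (dom_of c)"
  using smooth_manifold_topological_chart unfolding topological_chart_def by blast

lemma differentiable_atlas_manifold:
  assumes "smooth_manifold X"
  shows "differentiable_atlas (atlas X)"
proof
  fix c d assume c: "c \<in> atlas X" and d: "d \<in> atlas X"
  show "inj_on (coord c) (dom_of c)"
    by (rule inj_on_topological_chart[OF smooth_manifold_topological_chart[OF assms c]])
  show "open (coord c ` (dom_of c \<inter> dom_of d))"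
    by (intro open_coord_image[OF smooth_manifold_topological_chart[OF assms c]]
        openin_Int openin_dom_of[OF assms] c d Int_lower1)
  fix q assume "q \<in> dom_of c" "q \<in> dom_of d"
  then show "transition c d differentiable (at (coord c q))"
    using smooth_on_has_derivative[OF smooth_transition[OF assms c d]]
    by (auto simp: differentiable_def)
qed

section \<open>Jacobian matrices and jets\<close>

lemma bounded_bilinear_matrix_mult:
  "bounded_bilinear ((**) :: real^'n^'m \<Rightarrow> real^'k^'n \<Rightarrow> real^'k^'m)"
  unfolding bilinear_conv_bounded_bilinear[symmetric] bilinear_def
  by (auto intro!: linearI
      simp: matrix_matrix_mult_def vec_eq_iff sum_distrib_left sum.distrib algebra_simps)

text \<open>The Jacobian matrix is a sum of linear images of directional derivatives.\<close>

lemma smooth_on_jacobian_matrix: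
  fixes f :: "real^'n \<Rightarrow> real^'m"
  assumes "open S" "smooth_on S f"
  shows "smooth_on S (\<lambda>x. matrix (frechet_derivative f (at x)))"
proof -
  define L :: "'n \<Rightarrow> real^'m \<Rightarrow> real^'n^'m" where
    "L = (\<lambda>j v. \<chi> i k. if k = j then v $ i else 0)"
  have L: "bounded_linear (L j)" for j
    unfolding linear_conv_bounded_linear[symmetric]
    by (rule linearI) (auto simp: L_def vec_eq_iff)
  have "matrix g = (\<Sum>j\<in>UNIV. L j (g (axis j 1)))" for g :: "real^'n \<Rightarrow> real^'m"
    by (simp add: matrix_def L_def vec_eq_iff)
  moreover have "smooth_on S (\<lambda>x. \<Sum>j\<in>UNIV. L j (frechet_derivative f (at x) (axis j 1)))"
    by (intro smooth_on_sum smooth_on_linear_image[OF assms(1) L] smooth_on_derivative assms)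
  ultimately show ?thesis by simp
qed

lemma matrix_of_linear_mult:
  fixes f :: "real^'n \<Rightarrow> real^'m"
  assumes "linear f"
  shows "matrix f *v v = f v"
  using fun_cong[OF matrix_vector_mul(2)[OF assms]] .

abbreviation jacobi :: "('a, real^'m) chart \<Rightarrow> ('a, real^'m) chart \<Rightarrow> 'a \<Rightarrow> real^'m^'m" where
  "jacobi c d q \<equiv> matrix (chart_jacobian c d q)"

text \<open>The directional derivative of the Jacobian matrix; its entries are the second derivatives of the
  change of charts.\<close>

definition jacobi_derivative ::
  "('a, real^'m) chart \<Rightarrow> ('a, real^'m) chart \<Rightarrow> 'a \<Rightarrow> real^'m \<Rightarrow> real^'m^'m" where
  "jacobi_derivative c d q = frechet_derivative
     (\<lambda>x. matrix (frechet_derivative (transition c d) (at x))) (at (coord c q))"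

lemma jacobi_has_derivative:
  assumes "smooth_manifold X" "c \<in> atlas X" "d \<in> atlas X" "q \<in> dom_of c" "q \<in> dom_of d"
  shows "((\<lambda>x. matrix (frechet_derivative (transition c d) (at x))) has_derivative
    jacobi_derivative c d q) (at (coord c q))"
proof -
  interpret differentiable_atlas "atlas X" by (rule differentiable_atlas_manifold[OF assms(1)])
  show ?thesis
    unfolding jacobi_derivative_def
    by (rule smooth_on_has_derivative[OF smooth_on_jacobian_matrix[OF open_overlap smooth_transition]])
       (use assms in blast)+
qed

lemma linear_jacobi_derivative:
  assumes "smooth_manifold X" "c \<in> atlas X" "d \<in> atlas X" "q \<in> dom_of c" "q \<in> dom_of d"
  shows "linear (jacobi_derivative c d q)"
  by (rule has_derivative_linear[OF jacobi_has_derivative[OF assms]])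

lemma jacobi_derivative_symmetric:
  assumes X: "smooth_manifold X" "c \<in> atlas X" "d \<in> atlas X" "q \<in> dom_of c" "q \<in> dom_of d"
  shows "jacobi_derivative c d q (axis i 1) $ k $ j = jacobi_derivative c d q (axis j 1) $ k $ i"
proof -
  interpret differentiable_atlas "atlas X" by (rule differentiable_atlas_manifold[OF X(1)])
  define S where "S = coord c ` (dom_of c \<inter> dom_of d)"
  have S: "open S" "coord c q \<in> S" using open_overlap X by (auto simp: S_def)
  define f where "f = (\<lambda>x. transition c d x $ k)"
  have tr: "smooth_on S (transition c d)" unfolding S_def by (rule smooth_transition[OF X(1-3)])
  then have f: "smooth_on S f"
    unfolding f_def by (rule smooth_on_linear_image[OF S(1) bounded_linear_vec_nth])
  have f_der: "frechet_derivative f (at x) v = frechet_derivative (transition c d) (at x) v $ k"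
    if "x \<in> S" for x v
  proof -
    have "(f has_derivative (\<lambda>v. frechet_derivative (transition c d) (at x) v $ k)) (at x)"
      unfolding f_def
      by (rule bounded_linear.has_derivative[OF bounded_linear_vec_nth smooth_on_has_derivative[OF tr that]])
    from fun_cong[OF frechet_derivative_at[OF this]] show ?thesis by (rule sym)
  qed
  have second: "frechet_derivative (\<lambda>y. frechet_derivative f (at y) (axis j 1)) (at (coord c q)) v =
      jacobi_derivative c d q v $ k $ j" for j v
  proof -
    have "((\<lambda>x. matrix (frechet_derivative (transition c d) (at x)) $ k $ j) has_derivative
        (\<lambda>v. jacobi_derivative c d q v $ k $ j)) (at (coord c q))"
      by (intro bounded_linear.has_derivative[OF bounded_linear_vec_nth] jacobi_has_derivative[OF X])
    then have "((\<lambda>y. frechet_derivative f (at y) (axis j 1)) has_derivative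
        (\<lambda>v. jacobi_derivative c d q v $ k $ j)) (at (coord c q))"
      by (rule has_derivative_transform_within_open[OF _ S]) (simp add: f_der matrix_def)
    from fun_cong[OF frechet_derivative_at[OF this]] show ?thesis by (rule sym)
  qed
  have "Ck_on 2 S f" using f by (simp add: smooth_on_def)
  from mixed_second_derivatives_commute[OF S(1) this S(2), of "axis j 1" "axis i 1"]
  show ?thesis by (simp add: second)
qed

locale jet_bundle =
  fixes T :: "('a, real^'p) manifold" and M :: "('b, real^'n) manifold"
  assumes smooth_T: "smooth_manifold T" and smooth_M: "smooth_manifold M"
begin

sublocale T: differentiable_atlas "atlas T"
  by (rule differentiable_atlas_manifold[OF smooth_T])

sublocale M: differentiable_atlas "atlas M"
  by (rule differentiable_atlas_manifold[OF smooth_M])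

abbreviation local_rep ::
  "('a, real^'p) chart \<Rightarrow> ('b, real^'n) chart \<Rightarrow> ('a \<Rightarrow> 'b) \<Rightarrow> real^'p \<Rightarrow> real^'n" where
  "local_rep a b f \<equiv> coord b \<circ> f \<circ> inv_chart a"

lemma smooth_near_local_rep:
  assumes "smooth_near T M t f" "a \<in> atlas T" "b \<in> atlas M" "t \<in> dom_of a" "f t \<in> dom_of b"
  obtains U where "open (coord a ` U)" "t \<in> U" "U \<subseteq> dom_of a" "f ` U \<subseteq> dom_of b"
    "smooth_on (coord a ` U) (local_rep a b f)"
proof -
  obtain W where W: "t \<in> W" "smooth_map_on T M W f"
    using assms(1) by (auto simp: smooth_near_def)
  then have W_open: "openin (mtop T) W" and cont: "continuous_map (subtopology (mtop T) W) (mtop M) f"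
    and smooth: "smooth_on (coord a ` {t \<in> dom_of a \<inter> W. f t \<in> dom_of b}) (local_rep a b f)"
    using assms(2,3) unfolding smooth_map_on_def by blast+
  have "openin (subtopology (mtop T) W) {t \<in> topspace (subtopology (mtop T) W). f t \<in> dom_of b}"
    using cont openin_dom_of[OF smooth_M assms(3)] by (rule openin_continuous_map_preimage)
  then have "openin (subtopology (mtop T) W) {t \<in> W. f t \<in> dom_of b}"
    by (simp only: topspace_subtopology_subset[OF openin_subset[OF W_open]])
  then have "openin (mtop T) {t \<in> W. f t \<in> dom_of b}"
    using W_open by (rule openin_trans_full)
  then have "openin (mtop T) (dom_of a \<inter> {t \<in> W. f t \<in> dom_of b})"
    by (rule openin_Int[OF openin_dom_of[OF smooth_T assms(2)]])
  moreover have "dom_of a \<inter> {t \<in> W. f t \<in> dom_of b} = {t \<in> dom_of a \<inter> W. f t \<in> dom_of b}" by blast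
  ultimately have "open (coord a ` {t \<in> dom_of a \<inter> W. f t \<in> dom_of b})"
    using smooth_manifold_topological_chart[OF smooth_T assms(2)]
    by (intro open_coord_image[of "mtop T"]) simp_all
  then show ?thesis by (rule that) (use W smooth assms in blast)+
qed

lemma local_rep_has_derivative:
  assumes "smooth_near T M t f" "a \<in> atlas T" "b \<in> atlas M" "t \<in> dom_of a" "f t \<in> dom_of b"
  shows "(local_rep a b f has_derivative frechet_derivative (local_rep a b f) (at (coord a t))) (at (coord a t))"
  by (rule smooth_near_local_rep[OF assms]) (blast intro: smooth_on_has_derivative)

lemma local_rep_derivative_change_charts:
  assumes "smooth_near T M t f"
    and "a \<in> atlas T" "b \<in> atlas M" "t \<in> dom_of a" "f t \<in> dom_of b"
    and "a' \<in> atlas T" "b' \<in> atlas M" "t \<in> dom_of a'" "f t \<in> dom_of b'"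
  shows "frechet_derivative (local_rep a' b' f) (at (coord a' t)) =
    (\<lambda>v. chart_jacobian b b' (f t) (frechet_derivative (local_rep a b f) (at (coord a t)) (chart_jacobian a' a t v)))"
proof -
  obtain U where U: "open (coord a ` U)" "t \<in> U" "U \<subseteq> dom_of a" "f ` U \<subseteq> dom_of b"
    by (rule smooth_near_local_rep[OF assms(1-5)])
  have inv: "inv_chart a (coord a t) = t" by (rule T.inv_chart_coord[OF assms(2,4)])
  have "(transition b b' \<circ> local_rep a b f has_derivative
      chart_jacobian b b' (f t) \<circ> frechet_derivative (local_rep a b f) (at (coord a t))) (at (coord a t))"
  proof (rule diff_chain_at[OF local_rep_has_derivative[OF assms(1-5)]])
    show "(transition b b' has_derivative chart_jacobian b b' (f t)) (at (local_rep a b f (coord a t)))"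
      using M.transition_has_derivative[OF assms(3,7,5,9)] by (simp add: inv)
  qed
  then have "(local_rep a b' f has_derivative
      chart_jacobian b b' (f t) \<circ> frechet_derivative (local_rep a b f) (at (coord a t))) (at (coord a t))"
  proof (rule has_derivative_transform_within_open[OF _ U(1)])
    show "coord a t \<in> coord a ` U" using U(2) by (rule imageI)
    fix x assume "x \<in> coord a ` U"
    then obtain s where s: "s \<in> U" "x = coord a s" by blast
    then have "inv_chart a x = s" "f s \<in> dom_of b"
      using U(3,4) T.inv_chart_coord[OF assms(2)] by blast+
    then show "(transition b b' \<circ> local_rep a b f) x = local_rep a b' f x"
      by (simp add: M.transition_coord[OF assms(3)])
  qed
  then have "((coord b' \<circ> f) \<circ> inv_chart a' has_derivative
      (\<lambda>v. (chart_jacobian b b' (f t) \<circ> frechet_derivative (local_rep a b f) (at (coord a t)))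
        (chart_jacobian a' a t v))) (at (coord a' t))"
    by (intro T.has_derivative_change_chart assms)
  from frechet_derivative_at[OF this] show ?thesis by (simp add: o_def)
qed

text \<open>By the chain rule, equality of the derivatives in one pair of charts suffices for equality of the
  jets.\<close>

lemma same_1jetI:
  assumes "smooth_near T M t f" "smooth_near T M t g" "f t = g t"
    and "a \<in> atlas T" "b \<in> atlas M" "t \<in> dom_of a" "f t \<in> dom_of b"
    and "frechet_derivative (local_rep a b f) (at (coord a t)) =
      frechet_derivative (local_rep a b g) (at (coord a t))"
  shows "same_1jet T M t f g"
  unfolding same_1jet_def
proof (intro conjI ballI impI)
  fix a' b' assume *: "a' \<in> atlas T" "b' \<in> atlas M" "t \<in> dom_of a' \<and> f t \<in> dom_of b'"
  then show "frechet_derivative (local_rep a' b' f) (at (coord a' t)) =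
      frechet_derivative (local_rep a' b' g) (at (coord a' t))"
    using assms local_rep_derivative_change_charts[OF assms(1,4-7), of a' b']
      local_rep_derivative_change_charts[OF assms(2,4-6), of a' b']
    by simp
qed (fact assms(3))

lemma jet1_eq:
  assumes "same_1jet T M t f g"
  shows "jet1 T M t f = jet1 T M t g"
proof -
  have "same_1jet T M t f k \<longleftrightarrow> same_1jet T M t g k" for k
    using assms unfolding same_1jet_def by metis
  then show ?thesis by (simp add: jet1_def)
qed

lemma jet_source_jet1: "jet_source (jet1 T M t f) = t"
  by (simp add: jet_source_def jet1_def)

lemma jet_rep_jet1:
  assumes "smooth_near T M t f"
  shows "smooth_near T M t (jet_rep (jet1 T M t f))" "same_1jet T M t f (jet_rep (jet1 T M t f))"
proof -
  have "f \<in> snd (jet1 T M t f)" using assms by (simp add: jet1_def same_1jet_def)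
  then have "jet_rep (jet1 T M t f) \<in> snd (jet1 T M t f)"
    unfolding jet_rep_def by (rule someI[of "\<lambda>g. g \<in> snd (jet1 T M t f)"])
  then show "smooth_near T M t (jet_rep (jet1 T M t f))" "same_1jet T M t f (jet_rep (jet1 T M t f))"
    by (simp_all add: jet1_def)
qed

lemma jet_target_jet1: "smooth_near T M t f \<Longrightarrow> jet_target (jet1 T M t f) = f t"
  using jet_rep_jet1(2) by (simp add: jet_target_def jet_source_jet1 same_1jet_def)

lemma jet_representation:
  assumes "e \<in> J1 T M"
  shows "smooth_near T M (jet_source e) (jet_rep e)" "e = jet1 T M (jet_source e) (jet_rep e)"
proof -
  obtain t f where e: "e = jet1 T M t f" "smooth_near T M t f"
    using assms by (auto simp: J1_def)
  show "smooth_near T M (jet_source e) (jet_rep e)"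
    using jet_rep_jet1(1)[OF e(2)] by (simp add: e jet_source_jet1)
  show "e = jet1 T M (jet_source e) (jet_rep e)"
    using jet1_eq[OF jet_rep_jet1(2)[OF e(2)]] by (simp add: e jet_source_jet1)
qed

abbreviation J :: "('a, real^'p) chart \<Rightarrow> ('b, real^'n) chart \<Rightarrow> (('a, 'b) jet, ('p, 'n) jmodel) chart" where
  "J a b \<equiv> induced_chart T M a b"

lemma dom_induced_chart:
  "e \<in> dom_of (J a b) \<longleftrightarrow> e \<in> J1 T M \<and> jet_source e \<in> dom_of a \<and> jet_target e \<in> dom_of b"
  by (simp add: induced_chart_def)

abbreviation jet_derivative ::
  "('a, real^'p) chart \<Rightarrow> ('b, real^'n) chart \<Rightarrow> ('a, 'b) jet \<Rightarrow> real^'p \<Rightarrow> real^'n" where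
  "jet_derivative a b e \<equiv> frechet_derivative (local_rep a b (jet_rep e)) (at (coord a (jet_source e)))"

lemma jet_has_derivative:
  assumes "a \<in> atlas T" "b \<in> atlas M" "e \<in> dom_of (J a b)"
  shows "(local_rep a b (jet_rep e) has_derivative jet_derivative a b e) (at (coord a (jet_source e)))"
  using assms(3) jet_representation(1)[of e]
  by (intro local_rep_has_derivative assms(1,2)) (auto simp: dom_induced_chart jet_target_def)

lemma coord_induced_chart:
  assumes "a \<in> atlas T" "b \<in> atlas M" "e \<in> dom_of (J a b)"
  shows "coord (J a b) e = (coord a (jet_source e), coord b (jet_target e), matrix (jet_derivative a b e))"
proof -
  have "((\<lambda>x. local_rep a b (jet_rep e) x $ i) has_derivative (\<lambda>v. jet_derivative a b e v $ i))
      (at (coord a (jet_source e)))" for i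
    by (rule bounded_linear.has_derivative[OF bounded_linear_vec_nth jet_has_derivative[OF assms]])
  then have "partial a (axis \<alpha> 1) (\<lambda>t. coord b (jet_rep e t) $ i) (jet_source e) =
      jet_derivative a b e (axis \<alpha> 1) $ i" for i \<alpha>
    unfolding partial_def by (subst frechet_derivative_at[symmetric]) (auto simp: o_def)
  then show ?thesis by (simp add: induced_chart_def matrix_def)
qed

lemma jet_derivative_change_charts:
  assumes "a \<in> atlas T" "b \<in> atlas M" "a' \<in> atlas T" "b' \<in> atlas M"
    and "e \<in> dom_of (J a b)" "e \<in> dom_of (J a' b')"
  shows "matrix (jet_derivative a' b' e) =
    jacobi b b' (jet_target e) ** matrix (jet_derivative a b e) ** jacobi a' a (jet_source e)"
proof -
  have e: "jet_source e \<in> dom_of a" "jet_source e \<in> dom_of a'" "jet_target e \<in> dom_of b" "jet_target e \<in> dom_of b'"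
    "smooth_near T M (jet_source e) (jet_rep e)"
    using assms(5,6) jet_representation(1) by (auto simp: dom_induced_chart)
  have lin: "linear (jet_derivative a b e)" "linear (chart_jacobian b b' (jet_target e))"
    "linear (chart_jacobian a' a (jet_source e))"
    using jet_has_derivative[OF assms(1,2,5)] e assms
    by (auto intro: has_derivative_linear T.linear_chart_jacobian M.linear_chart_jacobian)
  have "jet_derivative a' b' e = chart_jacobian b b' (jet_target e) \<circ> (jet_derivative a b e \<circ> chart_jacobian a' a (jet_source e))"
    using local_rep_derivative_change_charts[OF e(5), of a b a' b'] e assms
    by (simp add: jet_target_def o_def)
  then show ?thesis
    by (simp add: matrix_compose lin linear_compose matrix_mul_assoc)
qed

lemma inj_on_induced_chart:
  assumes "a \<in> atlas T" "b \<in> atlas M"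
  shows "inj_on (coord (J a b)) (dom_of (J a b))"
proof (rule inj_onI)
  fix e e' assume e: "e \<in> dom_of (J a b)" and e': "e' \<in> dom_of (J a b)"
    and eq: "coord (J a b) e = coord (J a b) e'"
  have s: "jet_source e = jet_source e'"
    using eq e e' inj_onD[OF T.inj_coord[OF assms(1)]]
    by (auto simp: dom_induced_chart coord_induced_chart[OF assms])
  have t: "jet_target e = jet_target e'"
    using eq e e' inj_onD[OF M.inj_coord[OF assms(2)]]
    by (auto simp: dom_induced_chart coord_induced_chart[OF assms])
  have "matrix (jet_derivative a b e) = matrix (jet_derivative a b e')"
    using eq unfolding coord_induced_chart[OF assms e] coord_induced_chart[OF assms e'] prod.inject
    by (elim conjE)
  then have "jet_derivative a b e = jet_derivative a b e'"
    using matrix_vector_mul(2)[OF has_derivative_linear[OF jet_has_derivative[OF assms e]]]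
      matrix_vector_mul(2)[OF has_derivative_linear[OF jet_has_derivative[OF assms e']]] by metis
  then have "same_1jet T M (jet_source e) (jet_rep e) (jet_rep e')"
    using e e' s t jet_representation(1)[of e] jet_representation(1)[of e']
    by (intro same_1jetI[of _ _ _ a b] assms) (auto simp: dom_induced_chart jet_target_def)
  then show "e = e'"
    using jet1_eq jet_representation(2) e e' s by (metis dom_induced_chart)
qed

end

section \<open>The induced charts of the jet bundle\<close>

context jet_bundle
begin

text \<open>A map that is affine in the charts \<open>a\<close> and \<open>b\<close>, has the value \<open>x\<close> at \<open>t\<close> and the linear part \<open>y\<close>
  has the wanted coordinates. It is defined near \<open>t\<close> only, which is enough for a jet.\<close>

lemma jet_exists:
  assumes a: "a \<in> atlas T" and b: "b \<in> atlas M" and t: "t \<in> dom_of a" and x: "x \<in> dom_of b"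
  obtains e where "e \<in> J1 T M" "jet_source e = t" "jet_target e = x"
    "coord (J a b) e = (coord a t, coord b x, y)"
proof -
  define A where "A = (\<lambda>s. (coord b x - y *v coord a t) + y *v s)"
  define f where "f = (\<lambda>s. inv_chart b (A (coord a s)))"
  define W where "W = {s \<in> dom_of a. A (coord a s) \<in> coord b ` dom_of b}"
  have A_t: "A (coord a t) = coord b x" by (simp add: A_def)
  have A_smooth: "smooth_on UNIV A" unfolding A_def
    by (intro smooth_on_add smooth_on_const smooth_on_bounded_linear open_UNIV
        matrix_vector_mul_bounded_linear)
  have A_der: "(A has_derivative (*v) y) (at s)" for s
    unfolding A_def by (auto intro!: derivative_eq_intros bounded_linear_imp_has_derivative)
  have open_preimage: "openin (mtop T) {s \<in> dom_of a. A (coord a s) \<in> V}" if "open V" for V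
  proof -
    have "open (A -` V)" using smooth_on_continuous[OF A_smooth] that by (rule open_vimage[rotated])
    from openin_coord_preimage[OF smooth_manifold_topological_chart[OF smooth_T a] this]
    show ?thesis by simp
  qed
  have f_eq: "f s \<in> dom_of b" "coord b (f s) = A (coord a s)" if "s \<in> W" for s
  proof -
    obtain z where "z \<in> dom_of b" "A (coord a s) = coord b z" using \<open>s \<in> W\<close> unfolding W_def by blast
    then show "f s \<in> dom_of b" "coord b (f s) = A (coord a s)"
      by (simp_all add: f_def M.inv_chart_coord[OF b])
  qed
  have W_open: "openin (mtop T) W"
    unfolding W_def by (rule open_preimage[OF M.open_coord_dom[OF b]])
  have t_W: "t \<in> W" using t x A_t by (auto simp: W_def)
  have f_t: "f t = x" by (simp add: f_def A_t M.inv_chart_coord[OF b x])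
  \<comment> \<open>continuity of \<open>f\<close> is obtained from the openness of \<open>coord b\<close>, which carries \<open>U\<close> to an
    open set of the model space\<close>
  have preimage: "openin (mtop T) {s \<in> W. f s \<in> U}" if U: "openin (mtop M) U" for U
  proof -
    have "{s \<in> W. f s \<in> U} = {s \<in> dom_of a. A (coord a s) \<in> coord b ` (dom_of b \<inter> U)}"
    proof (intro equalityI subsetI)
      fix s assume "s \<in> {s \<in> W. f s \<in> U}"
      then show "s \<in> {s \<in> dom_of a. A (coord a s) \<in> coord b ` (dom_of b \<inter> U)}"
        using f_eq[of s] by (auto simp: W_def intro!: image_eqI[of _ _ "f s"])
    next
      fix s assume "s \<in> {s \<in> dom_of a. A (coord a s) \<in> coord b ` (dom_of b \<inter> U)}"
      then show "s \<in> {s \<in> W. f s \<in> U}"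
        by (auto simp: W_def f_def M.inv_chart_coord[OF b])
    qed
    moreover have "open (coord b ` (dom_of b \<inter> U))"
      by (rule open_coord_image[OF smooth_manifold_topological_chart[OF smooth_M b]])
         (use openin_dom_of[OF smooth_M b] U in auto)
    ultimately show ?thesis using open_preimage by simp
  qed
  have "continuous_map (subtopology (mtop T) W) (mtop M) f"
    unfolding continuous_map_def topspace_subtopology_subset[OF openin_subset[OF W_open]]
  proof (intro conjI allI impI)
    show "f \<in> W \<rightarrow> topspace (mtop M)"
      using f_eq(1) openin_subset[OF openin_dom_of[OF smooth_M b]] by blast
    fix U assume "openin (mtop M) U"
    from preimage[OF this] show "openin (subtopology (mtop T) W) {s \<in> W. f s \<in> U}"
      by (auto simp: openin_subtopology)
  qed
  moreover have "smooth_on (coord a' ` {s \<in> dom_of a' \<inter> W. f s \<in> dom_of b'}) (coord b' \<circ> f \<circ> inv_chart a')"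
    if a': "a' \<in> atlas T" and b': "b' \<in> atlas M" for a' b'
  proof -
    define S where "S = coord a' ` {s \<in> dom_of a' \<inter> W. f s \<in> dom_of b'}"
    have "{s \<in> dom_of a' \<inter> W. f s \<in> dom_of b'} = dom_of a' \<inter> {s \<in> W. f s \<in> dom_of b'}" by blast
    then have S: "open S" unfolding S_def
      using openin_Int[OF openin_dom_of[OF smooth_T a'] preimage[OF openin_dom_of[OF smooth_M b']]]
      by (intro open_coord_image[OF smooth_manifold_topological_chart[OF smooth_T a']]) auto
    have S_tr: "\<exists>s. s \<in> dom_of a' \<and> s \<in> W \<and> f s \<in> dom_of b' \<and> z = coord a' s \<and>
        transition a' a z = coord a s" if "z \<in> S" for z
      using that by (auto simp: S_def T.transition_coord[OF a'])
    have W_dom: "W \<subseteq> dom_of a" by (auto simp: W_def)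
    have "smooth_on S (transition a' a)"
      using smooth_transition[OF smooth_T a' a] by (rule smooth_on_subset) (use W_dom in \<open>auto simp: S_def\<close>)
    then have inner: "smooth_on S (\<lambda>z. A (transition a' a z))"
      by (rule smooth_on_compose[OF S open_UNIV subset_UNIV _ A_smooth])
    have "smooth_on S (\<lambda>z. transition b b' (A (transition a' a z)))"
    proof (rule smooth_on_compose[OF S M.open_overlap[OF b b'] _ inner smooth_transition[OF smooth_M b b']])
      show "(\<lambda>z. A (transition a' a z)) ` S \<subseteq> coord b ` (dom_of b \<inter> dom_of b')"
      proof (rule image_subsetI)
        fix z assume "z \<in> S"
        from S_tr[OF this] obtain s where "s \<in> W" "f s \<in> dom_of b'" "transition a' a z = coord a s"
          by blast
        then show "A (transition a' a z) \<in> coord b ` (dom_of b \<inter> dom_of b')"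
          using f_eq[of s] by (auto intro!: image_eqI[of _ _ "f s"])
      qed
    qed
    then have "smooth_on S (coord b' \<circ> f \<circ> inv_chart a')"
    proof (rule smooth_on_cong[OF S, rotated])
      fix z assume "z \<in> S"
      from S_tr[OF this] obtain s where s: "s \<in> dom_of a'" "s \<in> W" "z = coord a' s"
        "transition a' a z = coord a s"
        by blast
      then show "transition b b' (A (transition a' a z)) = (coord b' \<circ> f \<circ> inv_chart a') z"
        using f_eq[of s] M.transition_coord[OF b, of "f s" b'] by (simp add: T.inv_chart_coord[OF a'])
    qed
    then show ?thesis by (simp add: S_def)
  qed
  ultimately have "smooth_map_on T M W f" using W_open by (simp add: smooth_map_on_def)
  then have near: "smooth_near T M t f" using t_W by (auto simp: smooth_near_def)
  define e where "e = jet1 T M t f"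
  have e: "e \<in> J1 T M" "jet_source e = t" "jet_target e = x"
    using near openin_subset[OF W_open] t_W
    by (auto simp: e_def J1_def jet_source_jet1 jet_target_jet1 f_t)
  have "(local_rep a b f has_derivative (*v) y) (at (coord a t))"
    using A_der
  proof (rule has_derivative_transform_within_open)
    show "open (coord a ` W)"
      by (rule open_coord_image[OF smooth_manifold_topological_chart[OF smooth_T a] W_open])
         (auto simp: W_def)
    show "coord a t \<in> coord a ` W" using t_W by (rule imageI)
    fix z assume "z \<in> coord a ` W"
    then obtain s where "s \<in> W" "z = coord a s" by blast
    moreover from this have "s \<in> dom_of a" by (simp add: W_def)
    ultimately show "A z = local_rep a b f z" using f_eq[of s] by (simp add: T.inv_chart_coord[OF a])
  qed
  then have "frechet_derivative (local_rep a b f) (at (coord a t)) = (*v) y"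
    by (rule frechet_derivative_at[symmetric])
  moreover have "jet_derivative a b e = frechet_derivative (local_rep a b f) (at (coord a t))"
    using jet_rep_jet1(2)[OF near] t x f_t a b unfolding same_1jet_def e_def jet_source_jet1 by metis
  ultimately have "matrix (jet_derivative a b e) = y" by simp
  moreover have "e \<in> dom_of (J a b)" using e t x by (simp add: dom_induced_chart)
  ultimately have "coord (J a b) e = (coord a t, coord b x, y)"
    using e by (simp add: coord_induced_chart[OF a b])
  with e show ?thesis by (rule that)
qed

text \<open>In particular the image is a product with the whole fibre, so it is open and contains
  the lines in fibre directions through its points.\<close>

lemma coord_induced_chart_image:
  assumes "a \<in> atlas T" "b \<in> atlas M"
  shows "coord (J a b) ` (dom_of (J a b) \<inter> dom_of (J a' b')) =
    (coord a ` (dom_of a \<inter> dom_of a')) \<times> (coord b ` (dom_of b \<inter> dom_of b')) \<times> UNIV" (is "?L = ?R")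
proof (intro equalityI subsetI)
  fix z assume "z \<in> ?L"
  then show "z \<in> ?R" by (auto simp: coord_induced_chart[OF assms] dom_induced_chart)
next
  fix z assume "z \<in> ?R"
  then obtain t x y where z: "z = (coord a t, coord b x, y)" "t \<in> dom_of a" "t \<in> dom_of a'"
    "x \<in> dom_of b" "x \<in> dom_of b'" by auto
  obtain e where "e \<in> J1 T M" "jet_source e = t" "jet_target e = x" "coord (J a b) e = (coord a t, coord b x, y)"
    by (rule jet_exists[OF assms z(2,4), of y])
  then show "z \<in> ?L" using z by (auto simp: dom_induced_chart intro!: image_eqI[of _ _ e])
qed

lemma open_induced_chart_overlap:
  assumes "a \<in> atlas T" "b \<in> atlas M" "a' \<in> atlas T" "b' \<in> atlas M"
  shows "open (coord (J a b) ` (dom_of (J a b) \<inter> dom_of (J a' b')))"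
  unfolding coord_induced_chart_image[OF assms(1,2)]
  by (intro open_Times T.open_overlap M.open_overlap assms open_UNIV)

lemma transition_induced_chart:
  assumes a: "a \<in> atlas T" and b: "b \<in> atlas M" and a': "a' \<in> atlas T" and b': "b' \<in> atlas M"
    and e: "e \<in> dom_of (J a b)" "e \<in> dom_of (J a' b')"
  shows "transition (J a b) (J a' b') (coord (J a b) e) =
    (transition a a' (coord a (jet_source e)), transition b b' (coord b (jet_target e)),
     matrix (frechet_derivative (transition b b') (at (coord b (jet_target e)))) **
       snd (snd (coord (J a b) e)) **
       matrix (frechet_derivative (transition a' a) (at (transition a a' (coord a (jet_source e))))))"
proof -
  have "jet_source e \<in> dom_of a" "jet_target e \<in> dom_of b" using e by (auto simp: dom_induced_chart)
  note tr = T.transition_coord[OF a this(1)] M.transition_coord[OF b this(2)]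
  have "transition (J a b) (J a' b') (coord (J a b) e) = coord (J a' b') e"
    using inv_into_f_f[OF inj_on_induced_chart[OF a b] e(1)] by (simp add: transition_def inv_chart_def)
  also have "\<dots> = (coord a' (jet_source e), coord b' (jet_target e), matrix (jet_derivative a' b' e))"
    by (rule coord_induced_chart[OF a' b' e(2)])
  also have "matrix (jet_derivative a' b' e) =
    jacobi b b' (jet_target e) ** matrix (jet_derivative a b e) ** jacobi a' a (jet_source e)"
    by (rule jet_derivative_change_charts[OF a b a' b' e])
  finally show ?thesis by (simp add: tr coord_induced_chart[OF a b e(1)])
qed

text \<open>The fibre component of the transition map is a product of three matrices, the first depending on \<open>x\<close>
  and the last on \<open>t\<close> only; the formula is its product rule. The derivative of the
  last factor is left unspecified: it is multiplied with the \<open>t\<close>-component of a vector, and the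
  vectors to be transformed in full have no such component.\<close>

lemma transition_induced_chart_has_derivative:
  assumes a: "a \<in> atlas T" and b: "b \<in> atlas M" and a': "a' \<in> atlas T" and b': "b' \<in> atlas M"
    and e: "e \<in> dom_of (J a b)" "e \<in> dom_of (J a' b')"
  obtains K' where "linear K'"
    "(transition (J a b) (J a' b') has_derivative (\<lambda>w.
       (chart_jacobian a a' (jet_source e) (fst w), chart_jacobian b b' (jet_target e) (fst (snd w)),
        jacobi b b' (jet_target e) ** snd (snd (coord (J a b) e)) ** K' (fst w) +
        (jacobi b b' (jet_target e) ** snd (snd w) +
         jacobi_derivative b b' (jet_target e) (fst (snd w)) ** snd (snd (coord (J a b) e))) **
        jacobi a' a (jet_source e)))) (at (coord (J a b) e))"
proof -
  define t x where "t = jet_source e" and "x = jet_target e"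
  have tx: "t \<in> dom_of a" "t \<in> dom_of a'" "x \<in> dom_of b" "x \<in> dom_of b'"
    using e by (auto simp: t_def x_def dom_induced_chart)
  define JJ where "JJ = (\<lambda>z. matrix (frechet_derivative (transition b b') (at z)))"
  define KK where "KK = (\<lambda>z. matrix (frechet_derivative (transition a' a) (at (transition a a' z))))"
  have JJ: "(JJ has_derivative jacobi_derivative b b' x) (at (coord b x))"
    unfolding JJ_def by (rule jacobi_has_derivative[OF smooth_M b b' tx(3,4)])
  have jacobian: "smooth_on (coord a' ` (dom_of a' \<inter> dom_of a))
      (\<lambda>z. matrix (frechet_derivative (transition a' a) (at z)))"
    by (rule smooth_on_jacobian_matrix[OF T.open_overlap[OF a' a] smooth_transition[OF smooth_T a' a]])
  have "smooth_on (coord a ` (dom_of a \<inter> dom_of a')) KK"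
    unfolding KK_def
    by (rule smooth_on_compose[OF T.open_overlap[OF a a'] T.open_overlap[OF a' a] _
          smooth_transition[OF smooth_T a a'] jacobian])
       (auto simp: T.transition_coord[OF a])
  then obtain K' where K': "(KK has_derivative K') (at (coord a t))"
    using smooth_on_has_derivative[of _ KK "coord a t"] tx by blast
  have KK: "KK (coord a t) = jacobi a' a t" by (simp add: KK_def T.transition_coord[OF a tx(1)])
  define p where "p = coord (J a b) e"
  have p: "fst p = coord a t" "fst (snd p) = coord b x"
    by (simp_all add: p_def coord_induced_chart[OF a b e(1)] t_def x_def)
  have d: "(fst has_derivative fst) (at p)" "((\<lambda>z. fst (snd z)) has_derivative (\<lambda>w. fst (snd w))) (at p)"
    "((\<lambda>z. snd (snd z)) has_derivative (\<lambda>w. snd (snd w))) (at p)"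
    by (auto intro!: bounded_linear_imp_has_derivative bounded_linear_fst bounded_linear_snd
        bounded_linear_compose[OF bounded_linear_fst] bounded_linear_compose[OF bounded_linear_snd])
  have d1: "((\<lambda>z. transition a a' (fst z)) has_derivative (\<lambda>w. chart_jacobian a a' t (fst w))) (at p)"
    by (rule has_derivative_compose[OF d(1)]) (use T.transition_has_derivative[OF a a' tx(1,2)] p in simp)
  have d2: "((\<lambda>z. transition b b' (fst (snd z))) has_derivative (\<lambda>w. chart_jacobian b b' x (fst (snd w)))) (at p)"
    by (rule has_derivative_compose[OF d(2)]) (use M.transition_has_derivative[OF b b' tx(3,4)] p in simp)
  have d3: "((\<lambda>z. JJ (fst (snd z))) has_derivative (\<lambda>w. jacobi_derivative b b' x (fst (snd w)))) (at p)"
    by (rule has_derivative_compose[OF d(2)]) (use JJ p in simp)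
  have d4: "((\<lambda>z. KK (fst z)) has_derivative (\<lambda>w. K' (fst w))) (at p)"
    by (rule has_derivative_compose[OF d(1)]) (use K' p in simp)
  note mult = bounded_bilinear.FDERIV[OF bounded_bilinear_matrix_mult]
  have "((\<lambda>z. (transition a a' (fst z), transition b b' (fst (snd z)),
        JJ (fst (snd z)) ** snd (snd z) ** KK (fst z))) has_derivative
      (\<lambda>w. (chart_jacobian a a' t (fst w), chart_jacobian b b' x (fst (snd w)),
        JJ (fst (snd p)) ** snd (snd p) ** K' (fst w) +
        (JJ (fst (snd p)) ** snd (snd w) + jacobi_derivative b b' x (fst (snd w)) ** snd (snd p)) **
        KK (fst p)))) (at p)"
    by (intro has_derivative_Pair d1 d2 mult d3 d(3) d4)
  then have "(transition (J a b) (J a' b') has_derivative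
      (\<lambda>w. (chart_jacobian a a' t (fst w), chart_jacobian b b' x (fst (snd w)),
        JJ (fst (snd p)) ** snd (snd p) ** K' (fst w) +
        (JJ (fst (snd p)) ** snd (snd w) + jacobi_derivative b b' x (fst (snd w)) ** snd (snd p)) **
        KK (fst p)))) (at p)"
  proof (rule has_derivative_transform_within_open[OF _ open_induced_chart_overlap[OF a b a' b']])
    show "p \<in> coord (J a b) ` (dom_of (J a b) \<inter> dom_of (J a' b'))"
      unfolding p_def using e by blast
    fix z assume "z \<in> coord (J a b) ` (dom_of (J a b) \<inter> dom_of (J a' b'))"
    then obtain k where k: "k \<in> dom_of (J a b)" "k \<in> dom_of (J a' b')" "z = coord (J a b) k" by blast
    then show "(transition a a' (fst z), transition b b' (fst (snd z)),
        JJ (fst (snd z)) ** snd (snd z) ** KK (fst z)) = transition (J a b) (J a' b') z"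
      unfolding k(3) transition_induced_chart[OF a b a' b' k(1,2)] JJ_def KK_def
      by (simp add: coord_induced_chart[OF a b k(1)])
  qed
  then have "(transition (J a b) (J a' b') has_derivative (\<lambda>w.
       (chart_jacobian a a' (jet_source e) (fst w), chart_jacobian b b' (jet_target e) (fst (snd w)),
        jacobi b b' (jet_target e) ** snd (snd (coord (J a b) e)) ** K' (fst w) +
        (jacobi b b' (jet_target e) ** snd (snd w) +
         jacobi_derivative b b' (jet_target e) (fst (snd w)) ** snd (snd (coord (J a b) e))) **
        jacobi a' a (jet_source e)))) (at (coord (J a b) e))"
    by (simp only: p KK JJ_def p_def[symmetric] t_def[symmetric] x_def[symmetric])
  with has_derivative_linear[OF K'] show ?thesis by (rule that)
qed

lemma differentiable_atlas_jet_charts: "differentiable_atlas (jet_charts T M)"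
proof
  fix c assume "c \<in> jet_charts T M"
  then obtain a b where c: "c = J a b" and ab: "a \<in> atlas T" "b \<in> atlas M"
    by (auto simp: jet_charts_def)
  show "inj_on (coord c) (dom_of c)" unfolding c by (rule inj_on_induced_chart[OF ab])
  fix d assume "d \<in> jet_charts T M"
  then obtain a' b' where d: "d = J a' b'" and ab': "a' \<in> atlas T" "b' \<in> atlas M"
    by (auto simp: jet_charts_def)
  show "open (coord c ` (dom_of c \<inter> dom_of d))"
    unfolding c d by (rule open_induced_chart_overlap[OF ab ab'])
  fix e assume "e \<in> dom_of c" "e \<in> dom_of d"
  then show "transition c d differentiable (at (coord c e))"
    unfolding c d by (rule transition_induced_chart_has_derivative[OF ab ab']) (blast intro: differentiableI)
qed

sublocale E: differentiable_atlas "jet_charts T M"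
  by (rule differentiable_atlas_jet_charts)

lemma induced_chart_mem: "a \<in> atlas T \<Longrightarrow> b \<in> atlas M \<Longrightarrow> J a b \<in> jet_charts T M"
  unfolding jet_charts_def by blast

text \<open>Vectors tangent to the fibres over \<open>T\<close> stay so, and on them the change of charts acts without the
  second derivatives of the change of charts of \<open>T\<close>.\<close>

lemma jet_chart_jacobian:
  assumes "a \<in> atlas T" "b \<in> atlas M" "a' \<in> atlas T" "b' \<in> atlas M"
    and "e \<in> dom_of (J a b)" "e \<in> dom_of (J a' b')"
  shows "fst (chart_jacobian (J a b) (J a' b') e w) = chart_jacobian a a' (jet_source e) (fst w)"
    and "chart_jacobian (J a b) (J a' b') e (0, v, z) =
      (0, jacobi b b' (jet_target e) *v v,
       (jacobi b b' (jet_target e) ** z +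
        jacobi_derivative b b' (jet_target e) v ** snd (snd (coord (J a b) e))) **
       jacobi a' a (jet_source e))"
proof -
  obtain K' where "linear K'" and
    K': "(transition (J a b) (J a' b') has_derivative (\<lambda>w.
       (chart_jacobian a a' (jet_source e) (fst w), chart_jacobian b b' (jet_target e) (fst (snd w)),
        jacobi b b' (jet_target e) ** snd (snd (coord (J a b) e)) ** K' (fst w) +
        (jacobi b b' (jet_target e) ** snd (snd w) +
         jacobi_derivative b b' (jet_target e) (fst (snd w)) ** snd (snd (coord (J a b) e))) **
        jacobi a' a (jet_source e)))) (at (coord (J a b) e))"
    by (rule transition_induced_chart_has_derivative[OF assms])
  note * = fun_cong[OF frechet_derivative_at[OF K', symmetric]]
  show "fst (chart_jacobian (J a b) (J a' b') e w) = chart_jacobian a a' (jet_source e) (fst w)"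
    by (simp add: *)
  have dom: "jet_source e \<in> dom_of a" "jet_source e \<in> dom_of a'" "jet_target e \<in> dom_of b" "jet_target e \<in> dom_of b'"
    using assms(5,6) by (auto simp: dom_induced_chart)
  show "chart_jacobian (J a b) (J a' b') e (0, v, z) =
      (0, jacobi b b' (jet_target e) *v v,
       (jacobi b b' (jet_target e) ** z +
        jacobi_derivative b b' (jet_target e) v ** snd (snd (coord (J a b) e))) **
       jacobi a' a (jet_source e))"
    using assms dom \<open>linear K'\<close>
    by (simp add: * linear_0 matrix_of_linear_mult M.linear_chart_jacobian T.linear_chart_jacobian)
qed

end

section \<open>Smooth functions in the charts of an atlas\<close>

context differentiable_atlas
begin

lemma smooth_function_in_cong:
  assumes "c \<in> C" "\<And>q. q \<in> dom_of c \<Longrightarrow> F q = G q" "smooth_function_in c F"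
  shows "smooth_function_in c G"
  unfolding smooth_function_in_def
proof (rule smooth_on_cong[OF open_coord_dom[OF assms(1)]])
  show "smooth_on (coord c ` dom_of c) (F \<circ> inv_chart c)"
    using assms(3) by (simp add: smooth_function_in_def)
  fix x assume "x \<in> coord c ` dom_of c"
  then show "(F \<circ> inv_chart c) x = (G \<circ> inv_chart c) x"
    using assms(2)[of "inv_chart c x"] by (simp add: inv_chart_def inv_into_into)
qed

lemma smooth_function_in_const: "c \<in> C \<Longrightarrow> smooth_function_in c (\<lambda>q. r)"
  using smooth_on_const[OF open_coord_dom] by (simp add: smooth_function_in_def o_def)

lemma smooth_function_in_mult:
  "c \<in> C \<Longrightarrow> smooth_function_in c F \<Longrightarrow> smooth_function_in c G \<Longrightarrow> smooth_function_in c (\<lambda>q. F q * G q)"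
  using smooth_on_mult[OF open_coord_dom] by (simp add: smooth_function_in_def o_def)

lemma smooth_function_in_add:
  "c \<in> C \<Longrightarrow> smooth_function_in c F \<Longrightarrow> smooth_function_in c G \<Longrightarrow> smooth_function_in c (\<lambda>q. F q + G q)"
  using smooth_on_add[OF open_coord_dom] by (simp add: smooth_function_in_def o_def)

lemma smooth_function_in_sum:
  "c \<in> C \<Longrightarrow> (\<And>i. i \<in> I \<Longrightarrow> smooth_function_in c (F i)) \<Longrightarrow> smooth_function_in c (\<lambda>q. \<Sum>i\<in>I. F i q)"
  using smooth_on_sum[OF open_coord_dom, of c I "\<lambda>i. F i \<circ> inv_chart c"]
  by (simp add: smooth_function_in_def o_def)

lemma smooth_function_in_coord:
  assumes "c \<in> C" "bounded_linear L"
  shows "smooth_function_in c (\<lambda>q. L (coord c q))"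
  unfolding smooth_function_in_def
proof (rule smooth_on_cong[OF open_coord_dom[OF assms(1)]])
  show "smooth_on (coord c ` dom_of c) L"
    by (rule smooth_on_bounded_linear[OF open_coord_dom[OF assms(1)] assms(2)])
qed (auto simp: inv_chart_coord assms(1))

lemma smooth_function_in_has_derivative:
  assumes "smooth_function_in c F" "q \<in> dom_of c"
  shows "(F \<circ> inv_chart c has_derivative (\<lambda>v. partial c v F q)) (at (coord c q))"
  unfolding partial_def
  using assms unfolding smooth_function_in_def by (blast intro: smooth_on_has_derivative)

lemma smooth_function_in_partial:
  assumes "c \<in> C" "smooth_function_in c F"
  shows "smooth_function_in c (partial c w F)"
  unfolding smooth_function_in_def
proof (rule smooth_on_cong[OF open_coord_dom[OF assms(1)]])
  show "smooth_on (coord c ` dom_of c) (\<lambda>x. frechet_derivative (F \<circ> inv_chart c) (at x) w)"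
    using assms(2) by (simp add: smooth_function_in_def smooth_on_derivative)
qed (auto simp: inv_chart_coord assms(1) partial_def)

end

lemma linear_axis_expansion:
  fixes f :: "real^'n \<Rightarrow> 'v::real_vector"
  assumes "linear f"
  shows "f v = (\<Sum>i\<in>UNIV. (v $ i) *\<^sub>R f (axis i 1))"
proof -
  have "f v = f (\<Sum>i\<in>UNIV. (v $ i) *\<^sub>R axis i 1)"
    using basis_expansion[of v] by (simp add: scalar_mult_eq_scaleR)
  then show ?thesis by (simp add: linear_sum[OF assms] linear_scale[OF assms])
qed

lemma sum_mult_axis_axis:
  fixes r :: "'n::finite \<Rightarrow> 'p::finite \<Rightarrow> real"
  shows "(\<Sum>j\<in>UNIV. \<Sum>\<beta>\<in>UNIV. r j \<beta> * axis j (axis \<beta> 1) $ k $ \<gamma>) = r k \<gamma>"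
    and "(\<Sum>j\<in>UNIV. \<Sum>\<beta>\<in>UNIV. r j \<beta> * axis k (axis \<gamma> 1) $ j $ \<beta>) = r k \<gamma>"
proof -
  have "(\<Sum>j\<in>UNIV. \<Sum>\<beta>\<in>UNIV. r j \<beta> * axis j (axis \<beta> 1) $ k $ \<gamma>) =
      (\<Sum>j\<in>UNIV. if j = k then \<Sum>\<beta>\<in>UNIV. r j \<beta> * (axis \<beta> 1 $ \<gamma>) else 0)"
    by (intro sum.cong refl) (auto simp: axis_def)
  also have "\<dots> = r k \<gamma>" by (simp add: axis_def if_distrib cong: if_cong)
  finally show 1: "(\<Sum>j\<in>UNIV. \<Sum>\<beta>\<in>UNIV. r j \<beta> * axis j (axis \<beta> 1) $ k $ \<gamma>) = r k \<gamma>" .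
  have "axis k (axis \<gamma> 1) $ j $ \<beta> = (axis j (axis \<beta> 1) $ k $ \<gamma> :: real)" for j :: 'n and \<beta> :: 'p
    by (auto simp: axis_def)
  then show "(\<Sum>j\<in>UNIV. \<Sum>\<beta>\<in>UNIV. r j \<beta> * axis k (axis \<gamma> 1) $ j $ \<beta>) = r k \<gamma>"
    by (simp only: 1)
qed

section \<open>Sprays and the spray of a connection\<close>

text \<open>The components of the value of a spray at a tangent vector with \<open>t\<close>-component \<open>u\<close>, at a jet
  with fibre coordinates \<open>y\<close>.\<close>

definition spray_vector ::
  "('n \<Rightarrow> 'p \<Rightarrow> 'p \<Rightarrow> real) \<Rightarrow> real^'p^'n \<Rightarrow> real^'p \<Rightarrow> ('p::finite, 'n::finite) jmodel" where
  "spray_vector g y u = (0, y *v u, \<chi> j \<beta>. - (2 * (\<Sum>\<alpha>\<in>UNIV. g j \<beta> \<alpha> * u $ \<alpha>)))"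

lemma inner_dir_t: "w \<bullet> dir_t \<alpha> = fst w $ \<alpha>"
  by (simp add: dir_t_def inner_prod_def inner_axis)

lemma spray_vector_eq_sum:
  "spray_vector g y u =
    (\<Sum>\<alpha>\<in>UNIV. \<Sum>i\<in>UNIV. (y $ i $ \<alpha> * u $ \<alpha>) *\<^sub>R dir_x i) -
    (\<Sum>\<alpha>\<in>UNIV. \<Sum>j\<in>UNIV. \<Sum>\<beta>\<in>UNIV. (2 * g j \<beta> \<alpha> * u $ \<alpha>) *\<^sub>R dir_y j \<beta>)"
proof -
  let ?V = "(\<Sum>\<alpha>\<in>UNIV. \<Sum>i\<in>UNIV. (y $ i $ \<alpha> * u $ \<alpha>) *\<^sub>R dir_x i) -
    (\<Sum>\<alpha>\<in>UNIV. \<Sum>j\<in>UNIV. \<Sum>\<beta>\<in>UNIV. (2 * g j \<beta> \<alpha> * u $ \<alpha>) *\<^sub>R dir_y j \<beta>)"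
  have "fst ?V = 0" by (simp add: dir_x_def dir_y_def fst_sum)
  moreover have "fst (snd ?V) = y *v u"
    by (simp add: dir_x_def dir_y_def fst_sum snd_sum vec_eq_iff matrix_vector_mult_def axis_def
        if_distrib cong: if_cong)
  moreover have "snd (snd ?V) = (\<chi> j \<beta>. - (2 * (\<Sum>\<alpha>\<in>UNIV. g j \<beta> \<alpha> * u $ \<alpha>)))"
    by (simp add: dir_x_def dir_y_def snd_sum vec_eq_iff sum_mult_axis_axis) (simp add: sum_distrib_left mult.assoc)
  ultimately show ?thesis by (simp add: spray_vector_def prod_eq_iff)
qed

lemma linear_spray_vector: "linear (spray_vector g y)"
  by (rule linearI)
     (auto simp: spray_vector_def matrix_vector_right_distrib vec_eq_iff sum.distrib algebra_simps
      sum_distrib_left matrix_vector_mult_scaleR)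

context jet_bundle
begin

abbreviation fibre :: "('a, real^'p) chart \<Rightarrow> ('b, real^'n) chart \<Rightarrow> ('a, 'b) jet \<Rightarrow> real^'p^'n" where
  "fibre a b e \<equiv> snd (snd (coord (J a b) e))"

lemma spray_formula:
  assumes "a \<in> atlas T" "b \<in> atlas M" "e \<in> dom_of (J a b)"
  shows "(\<lambda>d. (\<Sum>\<alpha>\<in>UNIV. \<Sum>i\<in>UNIV. y_of (J a b) i \<alpha> e *\<^sub>R
        tensor_prod (coord_diff (J a b) (dir_t \<alpha>)) (coord_vec (jet_charts T M) (J a b) (dir_x i) e) v d) -
      (\<Sum>\<alpha>\<in>UNIV. \<Sum>j\<in>UNIV. \<Sum>\<beta>\<in>UNIV. (2 * G a b j \<beta> \<alpha> e) *\<^sub>R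
        tensor_prod (coord_diff (J a b) (dir_t \<alpha>)) (coord_vec (jet_charts T M) (J a b) (dir_y j \<beta>) e) v d)) =
    coord_vec (jet_charts T M) (J a b)
      (spray_vector (\<lambda>j \<beta> \<alpha>. G a b j \<beta> \<alpha> e) (fibre a b e) (fst (v (J a b)))) e"
proof -
  note mem = induced_chart_mem[OF assms(1,2)]
  have one: "coord_vec (jet_charts T M) (J a b) (r *\<^sub>R w) e d = r *\<^sub>R coord_vec (jet_charts T M) (J a b) w e d" for r w d
    using E.coord_vec_sum[OF mem assms(3), of "\<lambda>_. r" "\<lambda>_. w" "{()}" d] by simp
  have sums: "coord_vec (jet_charts T M) (J a b) (\<Sum>i\<in>I. w i) e d = (\<Sum>i\<in>I. coord_vec (jet_charts T M) (J a b) (w i) e d)"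
    for I :: "'i set" and w d
    using E.coord_vec_sum[OF mem assms(3), of "\<lambda>_. 1" w I d] by simp
  show ?thesis
    unfolding spray_vector_eq_sum fun_eq_iff
    by (simp add: E.coord_vec_diff[OF mem assms(3)] one sums tensor_prod_def coord_diff_def inner_dir_t)
qed

text \<open>The defining sum of tensor products is the coordinate vector field with components
  \<open>spray_vector\<close>, so the transformation laws of sprays become statements about a single vector.\<close>

lemma spatial_spray_iff:
  "spatial_spray T M S G \<longleftrightarrow>
    tensor11_field (jet_charts T M) S \<and>
    (\<forall>a\<in>atlas T. \<forall>b\<in>atlas M.
      (\<forall>j \<beta> \<alpha>. smooth_function_in (J a b) (G a b j \<beta> \<alpha>)) \<and>
      (\<forall>e\<in>dom_of (J a b). \<forall>v\<in>tangent_space (jet_charts T M) e.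
        S e v = coord_vec (jet_charts T M) (J a b)
          (spray_vector (\<lambda>j \<beta> \<alpha>. G a b j \<beta> \<alpha> e) (fibre a b e) (fst (v (J a b)))) e))"
  unfolding spatial_spray_def Let_def
  by (intro conj_cong ball_cong refl) (simp add: spray_formula)

lemma jet_dom:
  assumes "e \<in> dom_of (J a b)"
  shows "jet_source e \<in> dom_of a" "jet_target e \<in> dom_of b"
  using assms by (simp_all add: dom_induced_chart)

lemma jacobi_inverse:
  assumes "a \<in> atlas T" "a' \<in> atlas T" "t \<in> dom_of a" "t \<in> dom_of a'"
  shows "jacobi a' a t ** jacobi a a' t = mat 1"
  using assms
  by (simp add: matrix_eq matrix_vector_mul_assoc[symmetric] matrix_of_linear_mult
      T.linear_chart_jacobian T.chart_jacobian_trans T.chart_jacobian_self)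

context
  fixes a a' b b' e
  assumes a: "a \<in> atlas T" and b: "b \<in> atlas M" and a': "a' \<in> atlas T" and b': "b' \<in> atlas M"
    and e: "e \<in> dom_of (J a b)" and e': "e \<in> dom_of (J a' b')"
begin

lemma fibre_change_charts:
  "fibre a' b' e = jacobi b b' (jet_target e) ** fibre a b e ** jacobi a' a (jet_source e)"
  using jet_derivative_change_charts[OF a b a' b' e e']
  by (simp add: coord_induced_chart[OF a b e] coord_induced_chart[OF a' b' e'])

lemma linear_jacobi_derivative_target: "linear (jacobi_derivative b b' (jet_target e))"
  using jet_dom[OF e] jet_dom[OF e'] by (intro linear_jacobi_derivative[OF smooth_M b b'])

lemma partial_x_x: "partial (J a b) (dir_x i) (x_of (J a' b') k) e = jacobi b b' (jet_target e) $ k $ i"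
proof -
  have "bounded_linear (\<lambda>z :: ('p, 'n) jmodel. fst (snd z) $ k)"
    by (intro bounded_linear_compose[OF bounded_linear_vec_nth]
        bounded_linear_compose[OF bounded_linear_fst bounded_linear_snd])
  from E.partial_linear_coord[OF induced_chart_mem[OF a b] induced_chart_mem[OF a' b'] e e' this]
  show ?thesis
    by (simp add: dir_x_def jet_chart_jacobian(2)[OF a b a' b' e e'] matrix_vector_mult_basis column_def)
qed

lemma partial_t_t: "partial (J a' b') (dir_t \<beta>) (t_of (J a b) \<gamma>) e = jacobi a' a (jet_source e) $ \<gamma> $ \<beta>"
proof -
  have "bounded_linear (\<lambda>z :: ('p, 'n) jmodel. fst z $ \<gamma>)"
    by (intro bounded_linear_compose[OF bounded_linear_vec_nth] bounded_linear_fst)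
  from E.partial_linear_coord[OF induced_chart_mem[OF a' b'] induced_chart_mem[OF a b] e' e this]
  show ?thesis
    by (simp add: dir_t_def jet_chart_jacobian(1)[OF a' b' a b e' e] matrix_def)
qed

lemma partial_x_y: "partial (J a b) (dir_x i) (y_of (J a' b') j \<beta>) e =
  (jacobi_derivative b b' (jet_target e) (axis i 1) ** fibre a b e ** jacobi a' a (jet_source e)) $ j $ \<beta>"
proof -
  have "bounded_linear (\<lambda>z :: ('p, 'n) jmodel. snd (snd z) $ j $ \<beta>)"
    by (intro bounded_linear_compose[OF bounded_linear_vec_nth]
        bounded_linear_compose[OF bounded_linear_vec_nth]
        bounded_linear_compose[OF bounded_linear_snd bounded_linear_snd])
  from E.partial_linear_coord[OF induced_chart_mem[OF a b] induced_chart_mem[OF a' b'] e e' this]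
  show ?thesis
    by (simp add: dir_x_def jet_chart_jacobian(2)[OF a b a' b' e e'])
qed

end

text \<open>The partial derivatives in the transformation law, evaluated: all are entries of Jacobian matrices
  and of their derivatives.\<close>

lemma spatial_nonlinear_connection_iff:
  "spatial_nonlinear_connection T M N \<longleftrightarrow>
    (\<forall>a\<in>atlas T. \<forall>b\<in>atlas M. \<forall>j \<beta> i. smooth_function_in (J a b) (N a b j \<beta> i)) \<and>
    (\<forall>a\<in>atlas T. \<forall>b\<in>atlas M. \<forall>a'\<in>atlas T. \<forall>b'\<in>atlas M.
      \<forall>e\<in>dom_of (J a b) \<inter> dom_of (J a' b'). \<forall>j \<beta> i.
        (\<Sum>k\<in>UNIV. N a' b' j \<beta> k e * jacobi b b' (jet_target e) $ k $ i) =
        (\<Sum>k\<in>UNIV. \<Sum>\<gamma>\<in>UNIV. N a b k \<gamma> i e * jacobi b b' (jet_target e) $ j $ k *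
            jacobi a' a (jet_source e) $ \<gamma> $ \<beta>) -
        (jacobi_derivative b b' (jet_target e) (axis i 1) ** fibre a b e ** jacobi a' a (jet_source e)) $ j $ \<beta>)"
  unfolding spatial_nonlinear_connection_def Let_def
  by (intro conj_cong ball_cong refl) (simp add: partial_x_x partial_t_t partial_x_y)

text \<open>With \<open>w = y u\<close> the fibre component of the spray vector is \<open>- N w\<close>. Under the change of charts it
  becomes \<open>(- B (N w) + \<partial>\<^sub>w B y) K\<close>, and contracting the law of the connection with \<open>w\<close> gives the same,
  since \<open>y' u' = (B y K) (P u) = B w\<close>.\<close>

lemma spray_vector_of_connection_change_charts:
  assumes N: "spatial_nonlinear_connection T M N"
    and a: "a \<in> atlas T" and b: "b \<in> atlas M" and a': "a' \<in> atlas T" and b': "b' \<in> atlas M"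
    and e: "e \<in> dom_of (J a b)" "e \<in> dom_of (J a' b')"
  shows "chart_jacobian (J a b) (J a' b') e
      (spray_vector (\<lambda>j \<beta> \<alpha>. spray_of_connection T M N a b j \<beta> \<alpha> e) (fibre a b e) u) =
    spray_vector (\<lambda>j \<beta> \<alpha>. spray_of_connection T M N a' b' j \<beta> \<alpha> e) (fibre a' b' e)
      (chart_jacobian a a' (jet_source e) u)"
proof -
  note dom = jet_dom[OF e(1)] jet_dom[OF e(2)]
  define P K Jb H where "P = jacobi a a' (jet_source e)" and "K = jacobi a' a (jet_source e)"
    and "Jb = jacobi b b' (jet_target e)" and "H = jacobi_derivative b b' (jet_target e)"
  define y w where "y = fibre a b e" and "w = y *v u"
  have P: "chart_jacobian a a' (jet_source e) u = P *v u"
    unfolding P_def by (rule matrix_of_linear_mult[symmetric]) (rule T.linear_chart_jacobian[OF a a' dom(1,3)])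
  have y': "fibre a' b' e = Jb ** y ** K"
    unfolding Jb_def y_def K_def by (rule fibre_change_charts[OF a b a' b' e])
  have "K ** P = mat 1"
    unfolding K_def P_def by (rule jacobi_inverse[OF a a' dom(1,3)])
  then have w': "(Jb ** y ** K) *v (P *v u) = Jb *v w"
    by (simp add: w_def matrix_vector_mul_assoc matrix_mul_assoc[symmetric])
  have spray: "spray_vector (\<lambda>j \<beta> \<alpha>. spray_of_connection T M N a b j \<beta> \<alpha> e) (fibre a b e) u =
      (0, fibre a b e *v u, \<chi> j \<beta>. - (\<Sum>i\<in>UNIV. N a b j \<beta> i e * (fibre a b e *v u) $ i))" for a b u
  proof -
    have "2 * (\<Sum>\<alpha>\<in>UNIV. spray_of_connection T M N a b j \<beta> \<alpha> e * u $ \<alpha>) =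
        (\<Sum>i\<in>UNIV. N a b j \<beta> i e * (fibre a b e *v u) $ i)" for j \<beta>
    proof -
      have "2 * (\<Sum>\<alpha>\<in>UNIV. spray_of_connection T M N a b j \<beta> \<alpha> e * u $ \<alpha>) =
          (\<Sum>\<alpha>\<in>UNIV. \<Sum>i\<in>UNIV. N a b j \<beta> i e * (fibre a b e $ i $ \<alpha> * u $ \<alpha>))"
        by (simp add: spray_of_connection_def sum_divide_distrib sum_distrib_left sum_distrib_right mult.assoc)
      also have "\<dots> = (\<Sum>i\<in>UNIV. \<Sum>\<alpha>\<in>UNIV. N a b j \<beta> i e * (fibre a b e $ i $ \<alpha> * u $ \<alpha>))"
        by (rule sum.swap)
      finally show ?thesis by (simp add: matrix_vector_mult_def sum_distrib_left)
    qed
    then show ?thesis by (simp add: spray_vector_def)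
  qed
  have law: "(\<Sum>k\<in>UNIV. N a' b' j \<beta> k e * Jb $ k $ i) =
      (\<Sum>k\<in>UNIV. \<Sum>\<gamma>\<in>UNIV. N a b k \<gamma> i e * Jb $ j $ k * K $ \<gamma> $ \<beta>) - (H (axis i 1) ** y ** K) $ j $ \<beta>"
    for j \<beta> i
    using N a b a' b' e unfolding spatial_nonlinear_connection_iff Jb_def K_def H_def y_def by blast
  have H_expand: "(H w ** y ** K) $ j $ \<beta> = (\<Sum>i\<in>UNIV. w $ i * (H (axis i 1) ** y ** K) $ j $ \<beta>)" for j \<beta>
  proof -
    have linH: "linear H" unfolding H_def by (rule linear_jacobi_derivative_target[OF a b a' b' e])
    interpret bounded_bilinear "(**) :: real^'n^'n \<Rightarrow> real^'p^'n \<Rightarrow> real^'p^'n"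
      by (rule bounded_bilinear_matrix_mult)
    interpret m: bounded_bilinear "(**) :: real^'p^'n \<Rightarrow> real^'p^'p \<Rightarrow> real^'p^'n"
      by (rule bounded_bilinear_matrix_mult)
    show ?thesis
      by (subst linear_axis_expansion[OF linH])
         (simp add: sum_left m.sum_left scaleR_left m.scaleR_left)
  qed
  have "((Jb ** (\<chi> j \<beta>. - (\<Sum>i\<in>UNIV. N a b j \<beta> i e * w $ i)) + H w ** y) ** K) $ j $ \<beta> =
      - (\<Sum>i\<in>UNIV. N a' b' j \<beta> i e * (Jb *v w) $ i)" for j \<beta>
  proof -
    have "((Jb ** (\<chi> j \<beta>. - (\<Sum>i\<in>UNIV. N a b j \<beta> i e * w $ i)) + H w ** y) ** K) $ j $ \<beta> =
        (\<Sum>\<gamma>\<in>UNIV. \<Sum>k\<in>UNIV. \<Sum>i\<in>UNIV. - (w $ i * (N a b k \<gamma> i e * Jb $ j $ k * K $ \<gamma> $ \<beta>))) + (H w ** y ** K) $ j $ \<beta>"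
      by (simp add: matrix_matrix_mult_def sum_distrib_left sum_distrib_right algebra_simps
          sum.distrib sum_negf sum_subtractf)
    also have "(\<Sum>\<gamma>\<in>UNIV. \<Sum>k\<in>UNIV. \<Sum>i\<in>UNIV. - (w $ i * (N a b k \<gamma> i e * Jb $ j $ k * K $ \<gamma> $ \<beta>))) =
        (\<Sum>k\<in>UNIV. \<Sum>\<gamma>\<in>UNIV. \<Sum>i\<in>UNIV. - (w $ i * (N a b k \<gamma> i e * Jb $ j $ k * K $ \<gamma> $ \<beta>)))"
      by (rule sum.swap)
    also have "\<dots> = (\<Sum>k\<in>UNIV. \<Sum>i\<in>UNIV. \<Sum>\<gamma>\<in>UNIV. - (w $ i * (N a b k \<gamma> i e * Jb $ j $ k * K $ \<gamma> $ \<beta>)))"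
      by (intro sum.cong refl sum.swap)
    also have "\<dots> = (\<Sum>i\<in>UNIV. \<Sum>k\<in>UNIV. \<Sum>\<gamma>\<in>UNIV. - (w $ i * (N a b k \<gamma> i e * Jb $ j $ k * K $ \<gamma> $ \<beta>)))"
      by (rule sum.swap)
    also have "\<dots> + (H w ** y ** K) $ j $ \<beta> = - (\<Sum>i\<in>UNIV. w $ i * (\<Sum>k\<in>UNIV. N a' b' j \<beta> k e * Jb $ k $ i))"
      unfolding law H_expand
      by (simp add: sum_negf sum_distrib_left right_diff_distrib sum_subtractf)
    also have "\<dots> = - (\<Sum>i\<in>UNIV. \<Sum>k\<in>UNIV. N a' b' j \<beta> k e * (Jb $ k $ i * w $ i))"
      by (simp add: sum_distrib_left ac_simps)
    also have "\<dots> = - (\<Sum>k\<in>UNIV. \<Sum>i\<in>UNIV. N a' b' j \<beta> k e * (Jb $ k $ i * w $ i))"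
      by (subst sum.swap) simp
    finally show ?thesis by (simp add: matrix_vector_mult_def sum_distrib_left)
  qed
  then show ?thesis
    unfolding spray P unfolding y' w' jet_chart_jacobian(2)[OF a b a' b' e]
    by (simp add: vec_eq_iff y_def[symmetric] w_def[symmetric] Jb_def[symmetric] H_def[symmetric] K_def[symmetric])
qed

lemma smooth_fibre: "a \<in> atlas T \<Longrightarrow> b \<in> atlas M \<Longrightarrow> smooth_function_in (J a b) (y_of (J a b) i \<alpha>)"
  by (rule E.smooth_function_in_coord[where L = "\<lambda>z. snd (snd z) $ i $ \<alpha>"])
     (auto intro: induced_chart_mem intro!: bounded_linear_compose[OF bounded_linear_vec_nth]
        bounded_linear_compose[OF bounded_linear_snd bounded_linear_snd])

text \<open>At each jet the endomorphism is defined by its components in an arbitrarily selected induced chart;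
  by \<open>spray_vector_of_connection_change_charts\<close> every other induced chart yields the same endomorphism.\<close>

lemma spray_of_connection_is_spray:
  assumes N: "spatial_nonlinear_connection T M N"
  shows "\<exists>S. spatial_spray T M S (spray_of_connection T M N)"
proof -
  define Z where "Z = (\<lambda>a b e. spray_vector (\<lambda>j \<beta> \<alpha>. spray_of_connection T M N a b j \<beta> \<alpha> e) (fibre a b e))"
  define sel where "sel = (\<lambda>e. SOME ab. fst ab \<in> atlas T \<and> snd ab \<in> atlas M \<and> e \<in> dom_of (J (fst ab) (snd ab)))"
  define S :: "(('a, 'b) jet, ('p, 'n) jmodel) tensor11" where
    "S = (\<lambda>e v. case sel e of (a, b) \<Rightarrow> coord_vec (jet_charts T M) (J a b) (Z a b e (fst (v (J a b)))) e)"
  have S: "S e v = coord_vec (jet_charts T M) (J a b) (Z a b e (fst (v (J a b)))) e"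
    if a: "a \<in> atlas T" and b: "b \<in> atlas M" and e: "e \<in> dom_of (J a b)"
      and v: "v \<in> tangent_space (jet_charts T M) e" for a b e v
  proof -
    obtain a' b' where ab': "sel e = (a', b')" by (cases "sel e") auto
    have "fst (sel e) \<in> atlas T \<and> snd (sel e) \<in> atlas M \<and> e \<in> dom_of (J (fst (sel e)) (snd (sel e)))"
      unfolding sel_def by (rule someI[of _ "(a, b)"]) (use a b e in simp)
    then have a': "a' \<in> atlas T" and b': "b' \<in> atlas M" and e': "e \<in> dom_of (J a' b')"
      by (simp_all add: ab')
    note mem = induced_chart_mem[OF a b] induced_chart_mem[OF a' b']
    have "v (J a' b') = chart_jacobian (J a b) (J a' b') e (v (J a b))"
      using v mem e e' unfolding tangent_space_def by blast
    then have "fst (v (J a' b')) = chart_jacobian a a' (jet_source e) (fst (v (J a b)))"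
      by (simp only: jet_chart_jacobian(1)[OF a b a' b' e e'])
    then have "Z a' b' e (fst (v (J a' b'))) = chart_jacobian (J a b) (J a' b') e (Z a b e (fst (v (J a b))))"
      unfolding Z_def using spray_vector_of_connection_change_charts[OF N a b a' b' e e'] by simp
    then show ?thesis
      using E.coord_vec_change_chart[OF mem e e'] by (simp add: S_def ab')
  qed
  have smooth: "smooth_function_in (J a b) (spray_of_connection T M N a b j \<beta> \<alpha>)"
    if a: "a \<in> atlas T" and b: "b \<in> atlas M" for a b j \<beta> \<alpha>
  proof -
    note mem = induced_chart_mem[OF a b]
    have "smooth_function_in (J a b) (N a b j \<beta> i)" for i
      using N a b unfolding spatial_nonlinear_connection_iff by blast
    then have "smooth_function_in (J a b) (\<lambda>e. (\<Sum>i\<in>UNIV. N a b j \<beta> i e * y_of (J a b) i \<alpha> e) * (1 / 2))"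
      by (intro E.smooth_function_in_mult[OF mem] E.smooth_function_in_sum[OF mem]
          E.smooth_function_in_const[OF mem] smooth_fibre[OF a b])
    then show ?thesis by (simp add: spray_of_connection_def[abs_def])
  qed
  have "tensor11_field (jet_charts T M) S"
    unfolding tensor11_field_def
  proof (intro conjI ballI allI)
    fix e assume "e \<in> (\<Union>c\<in>jet_charts T M. dom_of c)"
    then obtain a b where a: "a \<in> atlas T" and b: "b \<in> atlas M" and e: "e \<in> dom_of (J a b)"
      unfolding jet_charts_def by blast
    note mem = induced_chart_mem[OF a b]
    show "S e ` tangent_space (jet_charts T M) e \<subseteq> tangent_space (jet_charts T M) e"
    proof (rule image_subsetI)
      fix v assume "v \<in> tangent_space (jet_charts T M) e"
      from S[OF a b e this] show "S e v \<in> tangent_space (jet_charts T M) e"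
        by (simp only: E.coord_vec_tangent[OF mem e])
    qed
    fix v w r s assume v: "v \<in> tangent_space (jet_charts T M) e" and w: "w \<in> tangent_space (jet_charts T M) e"
    have "(\<lambda>c. r *\<^sub>R v c + s *\<^sub>R w c) = coord_vec (jet_charts T M) (J a b) (r *\<^sub>R v (J a b) + s *\<^sub>R w (J a b)) e"
      unfolding E.coord_vec_lincomb[OF mem e]
      by (simp only: E.tangent_vector_eq_coord_vec[OF v mem e, symmetric]
          E.tangent_vector_eq_coord_vec[OF w mem e, symmetric])
    then have "(\<lambda>c. r *\<^sub>R v c + s *\<^sub>R w c) \<in> tangent_space (jet_charts T M) e"
      by (simp only: E.coord_vec_tangent[OF mem e])
    then show "S e (\<lambda>c. r *\<^sub>R v c + s *\<^sub>R w c) = (\<lambda>c. r *\<^sub>R S e v c + s *\<^sub>R S e w c)"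
      unfolding S[OF a b e v] S[OF a b e w]
      by (simp add: S[OF a b e] Z_def linear_add[OF linear_spray_vector] linear_scale[OF linear_spray_vector]
          E.coord_vec_lincomb[OF mem e])
  next
    fix c and k l :: "('p, 'n) jmodel" assume "c \<in> jet_charts T M"
    then obtain a b where a: "a \<in> atlas T" and b: "b \<in> atlas M" and c: "c = J a b"
      unfolding jet_charts_def by blast
    note mem = induced_chart_mem[OF a b]
    have expand: "Z a b e u \<bullet> l =
        (\<Sum>i\<in>UNIV. (\<Sum>\<alpha>\<in>UNIV. y_of (J a b) i \<alpha> e * u $ \<alpha>) * fst (snd l) $ i) +
        (\<Sum>j\<in>UNIV. \<Sum>\<beta>\<in>UNIV. ((\<Sum>\<alpha>\<in>UNIV. spray_of_connection T M N a b j \<beta> \<alpha> e * u $ \<alpha>) * (- 2)) *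
          snd (snd l) $ j $ \<beta>)" for e u
      by (simp add: Z_def spray_vector_def inner_prod_def inner_vec_def matrix_vector_mult_def mult.commute)
    have "smooth_function_in (J a b) (\<lambda>e. Z a b e (fst k) \<bullet> l)"
      unfolding expand
      by (intro E.smooth_function_in_add[OF mem] E.smooth_function_in_sum[OF mem]
          E.smooth_function_in_mult[OF mem] E.smooth_function_in_const[OF mem] smooth_fibre[OF a b] smooth[OF a b])
    then show "smooth_function_in c (\<lambda>q. coord_diff c l (S q (coord_vec (jet_charts T M) c k q)))"
      unfolding c
      by (rule E.smooth_function_in_cong[OF mem, rotated])
         (simp add: S[OF a b] E.coord_vec_tangent[OF mem] coord_diff_def E.coord_vec_self[OF mem])
  qed
  then have "spatial_spray T M S (spray_of_connection T M N)"
    unfolding spatial_spray_iff using S smooth by (simp add: Z_def)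
  then show ?thesis by blast
qed

end

section \<open>Contraction with the metric\<close>

definition contraction :: "real^'p^'p \<Rightarrow> real^'p^'p \<Rightarrow> real" where
  "contraction N B = (\<Sum>\<alpha>\<in>UNIV. \<Sum>\<beta>\<in>UNIV. N $ \<alpha> $ \<beta> * B $ \<alpha> $ \<beta>)"

lemma contraction_eq_trace: "contraction N B = trace (transpose N ** B)"
proof -
  have "trace (transpose N ** B) = (\<Sum>\<beta>\<in>UNIV. \<Sum>\<alpha>\<in>UNIV. N $ \<alpha> $ \<beta> * B $ \<alpha> $ \<beta>)"
    by (simp add: trace_def matrix_matrix_mult_def transpose_def)
  also have "\<dots> = contraction N B" unfolding contraction_def by (rule sum.swap)
  finally show ?thesis by simp
qed

lemma linear_contraction: "linear (contraction N)"
  by (rule linearI) (simp_all add: contraction_def algebra_simps sum.distrib sum_distrib_left)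

text \<open>The matrices \<open>K\<close> and \<open>P\<close> cancel cyclically under the trace.\<close>

lemma contraction_congruence:
  fixes P K :: "real^'p^'p"
  assumes "K ** P = mat 1"
  shows "contraction (P ** N ** transpose P) (transpose K ** B ** K) = contraction N B"
proof -
  have PK: "transpose P ** transpose K = mat 1"
    using assms by (simp add: matrix_transpose_mul[symmetric])
  have "contraction (P ** N ** transpose P) (transpose K ** B ** K) =
      trace (P ** (transpose N ** (transpose P ** transpose K) ** B ** K))"
    by (simp add: contraction_eq_trace matrix_transpose_mul matrix_mul_assoc)
  also have "\<dots> = trace (transpose N ** B ** (K ** P))"
    by (subst trace_mul_sym) (simp add: PK matrix_mul_assoc)
  finally show ?thesis by (simp add: assms contraction_eq_trace)
qed

lemma matrix_inv_congruence:
  fixes A K P :: "real^'p^'p"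
  assumes "invertible A" "invertible (transpose K ** A ** K)" "K ** P = mat 1" "P ** K = mat 1"
  shows "matrix_inv (transpose K ** A ** K) = P ** matrix_inv A ** transpose P"
proof -
  let ?A' = "transpose K ** A ** K"
  have "?A' ** (P ** matrix_inv A ** transpose P) =
      transpose K ** (A ** (K ** P) ** matrix_inv A) ** transpose P"
    by (simp add: matrix_mul_assoc)
  also have "\<dots> = transpose (P ** K)"
    by (simp add: assms(3) matrix_inv_mult(1)[OF assms(1)] matrix_transpose_mul)
  finally have 1: "?A' ** (P ** matrix_inv A ** transpose P) = mat 1"
    by (simp add: assms(4) transpose_mat)
  have "matrix_inv ?A' = matrix_inv ?A' ** (?A' ** (P ** matrix_inv A ** transpose P))"
    by (simp only: 1 matrix_mul_rid)
  also have "\<dots> = (matrix_inv ?A' ** ?A') ** (P ** matrix_inv A ** transpose P)"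
    by (simp only: matrix_mul_assoc)
  also have "\<dots> = P ** matrix_inv A ** transpose P"
    by (simp only: matrix_inv_mult(2)[OF assms(2)] matrix_mul_lid)
  finally show ?thesis .
qed

lemma matrix_inv_symmetric:
  fixes A :: "real^'p^'p"
  assumes "invertible A" "transpose A = A"
  shows "transpose (matrix_inv A) = matrix_inv A"
proof -
  have "transpose (matrix_inv A) ** A = mat 1"
    using matrix_inv_mult(1)[OF assms(1)] assms(2) by (metis matrix_transpose_mul transpose_mat)
  then have "transpose (matrix_inv A) ** (A ** matrix_inv A) = matrix_inv A"
    by (simp add: matrix_mul_assoc)
  then show ?thesis by (simp add: matrix_inv_mult(1)[OF assms(1)])
qed

text \<open>The quadratic form \<open>h\<^sup>\<alpha>\<^sup>\<beta> H\<^sub>i\<^sub>j y\<^sup>i\<^sub>\<alpha> y\<^sup>j\<^sub>\<beta>\<close>, by which the transformation of the trace of a spray fails to be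
  linear.\<close>

definition fibre_quadratic :: "real^'p^'p \<Rightarrow> real^'n^'n \<Rightarrow> real^'p^'n \<Rightarrow> real" where
  "fibre_quadratic N H y = contraction N (transpose y ** H ** y)"

lemma fibre_quadratic_sum:
  "fibre_quadratic N H y =
    (\<Sum>\<alpha>\<in>UNIV. \<Sum>\<beta>\<in>UNIV. \<Sum>j\<in>UNIV. \<Sum>i\<in>UNIV. N $ \<alpha> $ \<beta> * H $ i $ j * y $ i $ \<alpha> * y $ j $ \<beta>)"
  by (simp add: fibre_quadratic_def contraction_def matrix_matrix_mult_def transpose_def
      sum_distrib_left sum_distrib_right ac_simps)

text \<open>The two terms of the product rule are equal as both matrices are symmetric.\<close>

lemma fibre_quadratic_derivative:
  assumes "transpose N = N" "transpose H = H"
  shows "((\<lambda>s. fibre_quadratic N H (y + s *\<^sub>R axis m (axis \<sigma> 1))) has_real_derivative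
    2 * (H ** y ** N) $ m $ \<sigma>) (at 0)"
proof -
  define E :: "real^'a^'b" where "E = axis m (axis \<sigma> 1)"
  have N: "N $ \<alpha> $ \<beta> = N $ \<beta> $ \<alpha>" for \<alpha> \<beta>
    using arg_cong[OF assms(1), of "\<lambda>X. X $ \<beta> $ \<alpha>"] by (simp add: transpose_def)
  have H: "H $ i $ j = H $ j $ i" for i j
    using arg_cong[OF assms(2), of "\<lambda>X. X $ j $ i"] by (simp add: transpose_def)
  have HyN: "(\<Sum>\<beta>\<in>UNIV. \<Sum>j\<in>UNIV. N $ \<sigma> $ \<beta> * H $ m $ j * y $ j $ \<beta>) = (H ** y ** N) $ m $ \<sigma>"
    by (simp add: matrix_matrix_mult_def sum_distrib_right sum_distrib_left N[of \<sigma>] ac_simps)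
  have E1: "(\<Sum>\<alpha>\<in>UNIV. \<Sum>\<beta>\<in>UNIV. \<Sum>j\<in>UNIV. \<Sum>i\<in>UNIV. N $ \<alpha> $ \<beta> * H $ i $ j * E $ i $ \<alpha> * y $ j $ \<beta>) =
      (H ** y ** N) $ m $ \<sigma>"
  proof -
    have "(\<Sum>\<alpha>\<in>UNIV. \<Sum>\<beta>\<in>UNIV. \<Sum>j\<in>UNIV. \<Sum>i\<in>UNIV. N $ \<alpha> $ \<beta> * H $ i $ j * E $ i $ \<alpha> * y $ j $ \<beta>) =
        (\<Sum>\<alpha>\<in>UNIV. \<Sum>\<beta>\<in>UNIV. \<Sum>i\<in>UNIV. \<Sum>j\<in>UNIV. N $ \<alpha> $ \<beta> * H $ i $ j * E $ i $ \<alpha> * y $ j $ \<beta>)"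
      by (intro sum.cong refl sum.swap)
    also have "\<dots> = (\<Sum>\<alpha>\<in>UNIV. \<Sum>i\<in>UNIV. \<Sum>\<beta>\<in>UNIV. \<Sum>j\<in>UNIV. N $ \<alpha> $ \<beta> * H $ i $ j * E $ i $ \<alpha> * y $ j $ \<beta>)"
      by (intro sum.cong refl sum.swap)
    also have "\<dots> = (\<Sum>i\<in>UNIV. \<Sum>\<alpha>\<in>UNIV. \<Sum>\<beta>\<in>UNIV. \<Sum>j\<in>UNIV. N $ \<alpha> $ \<beta> * H $ i $ j * E $ i $ \<alpha> * y $ j $ \<beta>)"
      by (rule sum.swap)
    also have "\<dots> = (\<Sum>i\<in>UNIV. \<Sum>\<alpha>\<in>UNIV. (\<Sum>\<beta>\<in>UNIV. \<Sum>j\<in>UNIV. N $ \<alpha> $ \<beta> * H $ i $ j * y $ j $ \<beta>) * E $ i $ \<alpha>)"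
      by (simp add: sum_distrib_left sum_distrib_right ac_simps)
    finally show ?thesis unfolding E_def sum_mult_axis_axis(2) HyN .
  qed
  have E2: "(\<Sum>\<alpha>\<in>UNIV. \<Sum>\<beta>\<in>UNIV. \<Sum>j\<in>UNIV. \<Sum>i\<in>UNIV. N $ \<alpha> $ \<beta> * H $ i $ j * y $ i $ \<alpha> * E $ j $ \<beta>) =
      (H ** y ** N) $ m $ \<sigma>"
  proof -
    have "(\<Sum>\<alpha>\<in>UNIV. \<Sum>\<beta>\<in>UNIV. \<Sum>j\<in>UNIV. \<Sum>i\<in>UNIV. N $ \<alpha> $ \<beta> * H $ i $ j * y $ i $ \<alpha> * E $ j $ \<beta>) =
        (\<Sum>\<beta>\<in>UNIV. \<Sum>\<alpha>\<in>UNIV. \<Sum>j\<in>UNIV. \<Sum>i\<in>UNIV. N $ \<alpha> $ \<beta> * H $ i $ j * y $ i $ \<alpha> * E $ j $ \<beta>)"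
      by (rule sum.swap)
    also have "\<dots> = (\<Sum>\<beta>\<in>UNIV. \<Sum>\<alpha>\<in>UNIV. \<Sum>i\<in>UNIV. \<Sum>j\<in>UNIV. N $ \<alpha> $ \<beta> * H $ i $ j * y $ i $ \<alpha> * E $ j $ \<beta>)"
      by (intro sum.cong refl sum.swap)
    also have "\<dots> = (\<Sum>\<beta>\<in>UNIV. \<Sum>\<alpha>\<in>UNIV. \<Sum>i\<in>UNIV. \<Sum>j\<in>UNIV. N $ \<beta> $ \<alpha> * H $ j $ i * E $ j $ \<beta> * y $ i $ \<alpha>)"
      by (intro sum.cong refl) (subst N, subst H, simp)
    also have "\<dots> = (H ** y ** N) $ m $ \<sigma>" by (rule E1)
    finally show ?thesis .
  qed
  have "((\<lambda>s. fibre_quadratic N H (y + s *\<^sub>R E)) has_real_derivative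
      (\<Sum>\<alpha>\<in>UNIV. \<Sum>\<beta>\<in>UNIV. \<Sum>j\<in>UNIV. \<Sum>i\<in>UNIV.
        N $ \<alpha> $ \<beta> * H $ i $ j * E $ i $ \<alpha> * y $ j $ \<beta> + N $ \<alpha> $ \<beta> * H $ i $ j * y $ i $ \<alpha> * E $ j $ \<beta>)) (at 0)"
    unfolding fibre_quadratic_sum by (auto intro!: derivative_eq_intros DERIV_sum)
  then show ?thesis by (simp add: sum.distrib E1 E2 E_def[symmetric])
qed

section \<open>The metric in charts\<close>

locale metric_jet_bundle = jet_bundle T M
  for T :: "('a, real^'p) manifold" and M :: "('b, real^'n) manifold" +
  fixes h :: "('a, real^'p) tensor02"
  assumes metric: "semi_riemannian_metric T h"
begin

lemma dom_topspace: "a \<in> atlas T \<Longrightarrow> q \<in> dom_of a \<Longrightarrow> q \<in> topspace (mtop T)"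
  using openin_subset[OF openin_dom_of[OF smooth_T]] by blast

lemma metric_field: "tensor02_field (atlas T) h"
  using metric by (simp add: semi_riemannian_metric_def)

lemma smooth_metric_matrix: "a \<in> atlas T \<Longrightarrow> smooth_function_in a (\<lambda>q. metric_matrix T h a q $ \<alpha> $ \<beta>)"
  using metric_field unfolding tensor02_field_def metric_matrix_def
  by (simp add: axis_in_Basis_iff)

lemma metric_eq_matrix:
  assumes a: "a \<in> atlas T" and q: "q \<in> dom_of a"
  shows "h q (coord_vec (atlas T) a u q) (coord_vec (atlas T) a w q) = u \<bullet> (metric_matrix T h a q *v w)"
proof -
  have q': "q \<in> (\<Union>c\<in>atlas T. dom_of c)" using a q by blast
  define B where "B = (\<lambda>u w. h q (coord_vec (atlas T) a u q) (coord_vec (atlas T) a w q))"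
  have B1: "B (r *\<^sub>R u + s *\<^sub>R v) w = r * B u w + s * B v w"
    and B2: "B w (r *\<^sub>R u + s *\<^sub>R v) = r * B w u + s * B w v" for r s u v w
    using metric_field q' T.coord_vec_tangent[OF a q]
    unfolding tensor02_field_def B_def T.coord_vec_lincomb[OF a q] by blast+
  have lin: "linear (\<lambda>u. B u w)" "linear (B w)" for w
    using B1[of 1 _ 1] B1[of _ _ 0] B2[of _ 1 _ 1] B2[of _ _ _ 0] by (auto intro!: linearI)
  have "B u w = (\<Sum>\<alpha>\<in>UNIV. \<Sum>\<beta>\<in>UNIV. u $ \<alpha> * (B (axis \<alpha> 1) (axis \<beta> 1) * w $ \<beta>))"
    by (subst linear_axis_expansion[OF lin(1)], subst linear_axis_expansion[OF lin(2)])
       (simp add: sum_distrib_left ac_simps)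
  then show ?thesis
    by (simp add: B_def metric_matrix_def inner_vec_def matrix_vector_mult_def sum_distrib_left)
qed

lemma metric_matrix_symmetric:
  assumes a: "a \<in> atlas T" and q: "q \<in> dom_of a"
  shows "transpose (metric_matrix T h a q) = metric_matrix T h a q"
  using metric dom_topspace[OF a q] T.coord_vec_tangent[OF a q]
  unfolding semi_riemannian_metric_def metric_matrix_def by (simp add: transpose_def vec_eq_iff)

text \<open>A vector in the kernel of the matrix has components of a tangent vector orthogonal to all others, so
  it vanishes by nondegeneracy.\<close>

lemma metric_matrix_invertible:
  assumes a: "a \<in> atlas T" and q: "q \<in> dom_of a"
  shows "invertible (metric_matrix T h a q)"
  unfolding invertible_left_inverse matrix_left_invertible_ker
proof (intro allI impI)
  fix u assume u: "metric_matrix T h a q *v u = 0"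
  have sym: "u \<bullet> (metric_matrix T h a q *v w) = 0" for w
  proof -
    have "u \<bullet> (metric_matrix T h a q *v w) = (transpose (metric_matrix T h a q) *v u) \<bullet> w"
      by (simp add: dot_lmul_matrix)
    then show ?thesis by (simp add: metric_matrix_symmetric[OF a q] u)
  qed
  have "h q (coord_vec (atlas T) a u q) w = 0" if "w \<in> tangent_space (atlas T) q" for w
  proof -
    have "h q (coord_vec (atlas T) a u q) (coord_vec (atlas T) a (w a) q) = 0"
      by (simp add: metric_eq_matrix[OF a q] sym)
    then show ?thesis by (simp only: T.tangent_vector_eq_coord_vec[OF that a q, symmetric])
  qed
  then have "coord_vec (atlas T) a u q = (\<lambda>c. 0)"
    using metric dom_topspace[OF a q] T.coord_vec_tangent[OF a q]
    unfolding semi_riemannian_metric_def by blast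
  then have "coord_vec (atlas T) a u q a = 0" by simp
  then show "u = 0" by (simp add: T.coord_vec_self[OF a q])
qed

lemma metric_matrix_change_charts:
  assumes a: "a \<in> atlas T" and a': "a' \<in> atlas T" and q: "q \<in> dom_of a" and q': "q \<in> dom_of a'"
  shows "metric_matrix T h a' q = transpose (jacobi a' a q) ** metric_matrix T h a q ** jacobi a' a q"
proof -
  have "metric_matrix T h a' q $ \<alpha> $ \<beta> =
      (jacobi a' a q *v axis \<alpha> 1) \<bullet> (metric_matrix T h a q *v (jacobi a' a q *v axis \<beta> 1))" for \<alpha> \<beta>
    unfolding metric_matrix_def[of T h a'] matrix_of_linear_mult[OF T.linear_chart_jacobian[OF a' a q' q]]
    by (simp add: metric_eq_matrix[OF a q, symmetric] T.coord_vec_change_chart[OF a' a q' q])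
  moreover have "(X *v axis \<alpha> 1) \<bullet> (Y *v (X *v axis \<beta> 1)) = (transpose X ** Y ** X) $ \<alpha> $ \<beta>"
    for X Y :: "real^'p^'p" and \<alpha> \<beta>
  proof -
    have "(X *v axis \<alpha> 1) \<bullet> (Y *v (X *v axis \<beta> 1)) = axis \<alpha> 1 \<bullet> (transpose X *v (Y *v (X *v axis \<beta> 1)))"
      by (metis dot_lmul_matrix inner_commute transpose_matrix_vector transpose_transpose)
    also have "\<dots> = axis \<alpha> 1 \<bullet> ((transpose X ** Y ** X) *v axis \<beta> 1)"
      by (simp add: matrix_vector_mul_assoc matrix_mul_assoc)
    finally show ?thesis by (simp add: inner_axis' matrix_vector_mult_basis column_def)
  qed
  ultimately show ?thesis by (simp add: vec_eq_iff)
qed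

lemma smooth_inverse_metric:
  assumes a: "a \<in> atlas T"
  shows "smooth_function_in a (\<lambda>q. matrix_inv (metric_matrix T h a q) $ \<alpha> $ \<beta>)"
proof -
  have "smooth_on (coord a ` dom_of a) (\<lambda>x. matrix_inv (metric_matrix T h a (inv_chart a x)) $ \<alpha> $ \<beta>)"
  proof (rule smooth_on_matrix_inv[OF T.open_coord_dom[OF a]])
    show "smooth_on (coord a ` dom_of a) (\<lambda>x. metric_matrix T h a (inv_chart a x) $ i $ j)" for i j
      using smooth_metric_matrix[OF a, of i j] by (simp add: smooth_function_in_def o_def)
    show "invertible (metric_matrix T h a (inv_chart a x))" if "x \<in> coord a ` dom_of a" for x
      using that by (intro metric_matrix_invertible[OF a]) (auto simp: inv_chart_def inv_into_into)
  qed
  then show ?thesis by (simp add: smooth_function_in_def o_def)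
qed

lemma smooth_pullback:
  assumes a: "a \<in> atlas T" and b: "b \<in> atlas M" and F: "smooth_function_in a F"
  shows "smooth_function_in (J a b) (\<lambda>e. F (jet_source e))"
  unfolding smooth_function_in_def
proof (rule smooth_on_cong[OF E.open_coord_dom[OF induced_chart_mem[OF a b]]])
  note open_dom = E.open_coord_dom[OF induced_chart_mem[OF a b]]
  show "smooth_on (coord (J a b) ` dom_of (J a b)) (\<lambda>z. (F \<circ> inv_chart a) (fst z))"
    by (rule smooth_on_compose[OF open_dom T.open_coord_dom[OF a] _
          smooth_on_bounded_linear[OF open_dom bounded_linear_fst] F[unfolded smooth_function_in_def]])
       (auto simp: coord_induced_chart[OF a b] dom_induced_chart)
  fix z assume "z \<in> coord (J a b) ` dom_of (J a b)"
  then obtain e where e: "e \<in> dom_of (J a b)" "z = coord (J a b) e" by blast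
  have "fst (coord (J a b) e) = coord a (jet_source e)" by (simp add: coord_induced_chart[OF a b e(1)])
  then show "(F \<circ> inv_chart a) (fst z) = ((\<lambda>e. F (jet_source e)) \<circ> inv_chart (J a b)) z"
    by (simp add: e(2) E.inv_chart_coord[OF induced_chart_mem[OF a b] e(1)]
        T.inv_chart_coord[OF a jet_dom(1)[OF e(1)]])
qed

lemma h_trace_contraction:
  "h_trace T h G a b i e = contraction (matrix_inv (metric_matrix T h a (jet_source e))) (\<chi> \<alpha> \<beta>. G a b i \<alpha> \<beta> e)"
  by (simp add: h_trace_def contraction_def)

lemma smooth_h_trace:
  assumes a: "a \<in> atlas T" and b: "b \<in> atlas M"
    and G: "\<And>i \<alpha> \<beta>. smooth_function_in (J a b) (G a b i \<alpha> \<beta>)"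
  shows "smooth_function_in (J a b) (h_trace T h G a b i)"
proof -
  note mem = induced_chart_mem[OF a b]
  show ?thesis
    unfolding h_trace_def[abs_def]
    by (intro E.smooth_function_in_sum[OF mem] E.smooth_function_in_mult[OF mem] G
        smooth_pullback[OF a b smooth_inverse_metric[OF a]])
qed

text \<open>The Hessian of the \<open>k\<close>-th component of the change of charts of \<open>M\<close>.\<close>

definition hessian :: "('b, real^'n) chart \<Rightarrow> ('b, real^'n) chart \<Rightarrow> 'b \<Rightarrow> 'n \<Rightarrow> real^'n^'n" where
  "hessian b b' x k = (\<chi> j i. jacobi_derivative b b' x (axis i 1) $ k $ j)"

lemma hessian_mult:
  assumes "b \<in> atlas M" "b' \<in> atlas M" "x \<in> dom_of b" "x \<in> dom_of b'"
  shows "(hessian b b' x k *v w) $ j = jacobi_derivative b b' x w $ k $ j"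
  by (subst linear_axis_expansion[OF linear_jacobi_derivative[OF smooth_M assms]])
     (simp add: hessian_def matrix_vector_mult_def mult.commute)

lemma hessian_symmetric:
  assumes "b \<in> atlas M" "b' \<in> atlas M" "x \<in> dom_of b" "x \<in> dom_of b'"
  shows "transpose (hessian b b' x k) = hessian b b' x k"
  by (simp add: hessian_def transpose_def vec_eq_iff jacobi_derivative_symmetric[OF smooth_M assms])

end

section \<open>The connection of a spray\<close>

context metric_jet_bundle
begin

context
  fixes S :: "(('a, 'b) jet, ('p, 'n) jmodel) tensor11" and G :: "('a, 'b, 'p, 'n) spray_components"
  assumes spray: "spatial_spray T M S G"
begin

abbreviation spray_matrix where
  "spray_matrix a b i e \<equiv> (\<chi> \<alpha> \<beta>. G a b i \<alpha> \<beta> e)"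

lemma smooth_spray_components:
  "a \<in> atlas T \<Longrightarrow> b \<in> atlas M \<Longrightarrow> smooth_function_in (J a b) (G a b i \<alpha> \<beta>)"
  using spray unfolding spatial_spray_iff by blast

lemma smooth_spray_trace:
  "a \<in> atlas T \<Longrightarrow> b \<in> atlas M \<Longrightarrow> smooth_function_in (J a b) (h_trace T h G a b i)"
  by (intro smooth_h_trace smooth_spray_components)

lemma spray_vector_change_charts:
  assumes a: "a \<in> atlas T" and b: "b \<in> atlas M" and a': "a' \<in> atlas T" and b': "b' \<in> atlas M"
    and e: "e \<in> dom_of (J a b)" "e \<in> dom_of (J a' b')"
  shows "chart_jacobian (J a b) (J a' b') e (spray_vector (\<lambda>j \<beta> \<alpha>. G a b j \<beta> \<alpha> e) (fibre a b e) u) =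
    spray_vector (\<lambda>j \<beta> \<alpha>. G a' b' j \<beta> \<alpha> e) (fibre a' b' e) (chart_jacobian a a' (jet_source e) u)"
proof -
  note mem = induced_chart_mem[OF a b] induced_chart_mem[OF a' b']
  have S: "S e v = coord_vec (jet_charts T M) (J a b)
      (spray_vector (\<lambda>j \<beta> \<alpha>. G a b j \<beta> \<alpha> e) (fibre a b e) (fst (v (J a b)))) e"
    if "a \<in> atlas T" "b \<in> atlas M" "e \<in> dom_of (J a b)" "v \<in> tangent_space (jet_charts T M) e" for a b v
    using spray that unfolding spatial_spray_iff by blast
  define v where "v = coord_vec (jet_charts T M) (J a b) (u, 0, 0) e"
  have v: "v \<in> tangent_space (jet_charts T M) e"
    unfolding v_def by (rule E.coord_vec_tangent[OF mem(1) e(1)])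
  have fst_v: "fst (v (J a b)) = u" "fst (v (J a' b')) = chart_jacobian a a' (jet_source e) u"
    by (simp_all add: v_def E.coord_vec_self[OF mem(1) e(1)] E.coord_vec_apply[OF mem(2) e(2)]
        jet_chart_jacobian(1)[OF a b a' b' e])
  have "S e v (J a' b') = chart_jacobian (J a b) (J a' b') e
      (spray_vector (\<lambda>j \<beta> \<alpha>. G a b j \<beta> \<alpha> e) (fibre a b e) u)"
    by (simp add: S[OF a b e(1) v] E.coord_vec_apply[OF mem(2) e(2)] fst_v)
  moreover have "S e v (J a' b') = spray_vector (\<lambda>j \<beta> \<alpha>. G a' b' j \<beta> \<alpha> e) (fibre a' b' e)
      (chart_jacobian a a' (jet_source e) u)"
    by (simp add: S[OF a' b' e(2) v] E.coord_vec_self[OF mem(2) e(2)] fst_v)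
  ultimately show ?thesis by simp
qed

text \<open>Evaluating the law for spray vectors at the tangent vectors \<open>u\<close> that are the coordinate vectors of the
  second chart, the left factor \<open>P\<close> that the components in the second chart come with becomes the
  identity; this produces the right factor \<open>K\<close> of the congruence.\<close>

lemma spray_matrix_change_charts:
  assumes a: "a \<in> atlas T" and b: "b \<in> atlas M" and a': "a' \<in> atlas T" and b': "b' \<in> atlas M"
    and e: "e \<in> dom_of (J a b)" "e \<in> dom_of (J a' b')"
  shows "spray_matrix a' b' k e =
    transpose (jacobi a' a (jet_source e)) **
      ((\<Sum>j\<in>UNIV. (jacobi b b' (jet_target e) $ k $ j) *\<^sub>R spray_matrix a b j e) -
       (1 / 2) *\<^sub>R (transpose (fibre a b e) ** hessian b b' (jet_target e) k ** fibre a b e)) **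
      jacobi a' a (jet_source e)"
proof -
  note dom = jet_dom[OF e(1)] jet_dom[OF e(2)]
  define P K Jb Hk where "P = jacobi a a' (jet_source e)" and "K = jacobi a' a (jet_source e)"
    and "Jb = jacobi b b' (jet_target e)" and "Hk = hessian b b' (jet_target e) k"
  define y where "y = fibre a b e"
  have transpose_mult: "(transpose X *v q) $ \<beta> = (\<Sum>j\<in>UNIV. X $ j $ \<beta> * q $ j)"
    for X :: "real^'k^'l" and q \<beta>
    by (simp add: matrix_vector_mult_def transpose_def)
  define B where "B = (\<Sum>j\<in>UNIV. (Jb $ k $ j) *\<^sub>R spray_matrix a b j e) -
      (1 / 2) *\<^sub>R (transpose y ** Hk ** y)"
  have PK: "P ** K = mat 1" unfolding P_def K_def by (rule jacobi_inverse[OF a' a dom(3,1)])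
  have "spray_matrix a' b' k e $ \<gamma> $ \<alpha> = (transpose K ** B ** K) $ \<gamma> $ \<alpha>" for \<gamma> \<alpha>
  proof -
    define u where "u = K *v axis \<alpha> 1"
    have u: "chart_jacobian a a' (jet_source e) u = axis \<alpha> 1"
    proof -
      have "chart_jacobian a a' (jet_source e) u = P *v u"
        unfolding P_def by (rule matrix_of_linear_mult[OF T.linear_chart_jacobian[OF a a' dom(1,3)], symmetric])
      then show ?thesis by (simp add: u_def matrix_vector_mul_assoc PK)
    qed
    define X where "X = (\<chi> j \<beta>. - (2 * (\<Sum>\<alpha>\<in>UNIV. G a b j \<beta> \<alpha> e * u $ \<alpha>)))"
    have "((Jb ** X + jacobi_derivative b b' (jet_target e) (y *v u) ** y) ** K) $ k $ \<gamma> =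
        snd (snd (chart_jacobian (J a b) (J a' b') e (spray_vector (\<lambda>j \<beta> \<alpha>. G a b j \<beta> \<alpha> e) (fibre a b e) u))) $ k $ \<gamma>"
      by (simp add: spray_vector_def jet_chart_jacobian(2)[OF a b a' b' e] Jb_def y_def X_def K_def)
    also have "\<dots> = - 2 * G a' b' k \<gamma> \<alpha> e"
      unfolding spray_vector_change_charts[OF a b a' b' e] u
      by (simp add: spray_vector_def axis_def if_distrib cong: if_cong)
    finally have 1: "((Jb ** X + jacobi_derivative b b' (jet_target e) (y *v u) ** y) ** K) $ k $ \<gamma> =
        - 2 * G a' b' k \<gamma> \<alpha> e" .
    have row: "(Jb ** X + jacobi_derivative b b' (jet_target e) (y *v u) ** y) $ k $ \<beta> = - 2 * (B *v u) $ \<beta>" for \<beta>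
    proof -
      have "(jacobi_derivative b b' (jet_target e) (y *v u) ** y) $ k $ \<beta> =
          (\<Sum>j\<in>UNIV. (Hk *v (y *v u)) $ j * y $ j $ \<beta>)"
        by (simp add: matrix_matrix_mult_def Hk_def hessian_mult[OF b b' dom(2,4)])
      also have "\<dots> = ((transpose y ** Hk ** y) *v u) $ \<beta>"
        by (simp only: matrix_vector_mul_assoc[symmetric] transpose_mult mult.commute)
      finally have "(jacobi_derivative b b' (jet_target e) (y *v u) ** y) $ k $ \<beta> =
          ((transpose y ** Hk ** y) *v u) $ \<beta>" .
      moreover have "(Jb ** X) $ k $ \<beta> =
          - 2 * ((\<Sum>j\<in>UNIV. (Jb $ k $ j) *\<^sub>R spray_matrix a b j e) *v u) $ \<beta>"
      proof -
        have "((\<Sum>j\<in>UNIV. (Jb $ k $ j) *\<^sub>R spray_matrix a b j e) *v u) $ \<beta> =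
            (\<Sum>\<alpha>\<in>UNIV. \<Sum>j\<in>UNIV. Jb $ k $ j * (G a b j \<beta> \<alpha> e * u $ \<alpha>))"
          by (simp add: matrix_vector_mult_def sum_distrib_right mult.assoc)
        also have "\<dots> = (\<Sum>j\<in>UNIV. \<Sum>\<alpha>\<in>UNIV. Jb $ k $ j * (G a b j \<beta> \<alpha> e * u $ \<alpha>))"
          by (rule sum.swap)
        finally show ?thesis
          by (simp add: matrix_matrix_mult_def X_def sum_distrib_left sum_negf[symmetric] ac_simps)
      qed
      ultimately show ?thesis
        by (simp add: B_def matrix_vector_mult_diff_rdistrib scaleR_matrix_vector_assoc[symmetric])
    qed
    have "((Jb ** X + jacobi_derivative b b' (jet_target e) (y *v u) ** y) ** K) $ k $ \<gamma> =
        - 2 * (transpose K *v (B *v u)) $ \<gamma>"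
      by (subst matrix_matrix_mult_def)
         (simp add: row transpose_mult sum_distrib_left ac_simps
           del: vector_add_component transpose_matrix_vector)
    also have "(transpose K *v (B *v u)) = (transpose K ** B ** K) *v axis \<alpha> 1"
      by (simp add: u_def matrix_vector_mul_assoc matrix_mul_assoc)
    also have "\<dots> $ \<gamma> = (transpose K ** B ** K) $ \<gamma> $ \<alpha>"
      by (simp add: matrix_vector_mult_basis column_def)
    finally show ?thesis using 1 by simp
  qed
  then have "spray_matrix a' b' k e = transpose K ** B ** K" by (simp add: vec_eq_iff)
  then show ?thesis by (simp add: B_def K_def Jb_def Hk_def y_def)
qed

text \<open>The inverse metric transforms by \<open>P\<close> and the matrix of the spray by its inverse \<open>K\<close>, so the
  contraction sees neither.\<close>

lemma spray_trace_change_charts: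
  assumes a: "a \<in> atlas T" and b: "b \<in> atlas M" and a': "a' \<in> atlas T" and b': "b' \<in> atlas M"
    and e: "e \<in> dom_of (J a b)" "e \<in> dom_of (J a' b')"
  shows "h_trace T h G a' b' k e =
    (\<Sum>j\<in>UNIV. jacobi b b' (jet_target e) $ k $ j * h_trace T h G a b j e) -
    (1 / 2) * fibre_quadratic (matrix_inv (metric_matrix T h a (jet_source e)))
      (hessian b b' (jet_target e) k) (fibre a b e)"
proof -
  note dom = jet_dom[OF e(1)] jet_dom[OF e(2)]
  define A where "A = metric_matrix T h a (jet_source e)"
  define P K where "P = jacobi a a' (jet_source e)" and "K = jacobi a' a (jet_source e)"
  have PK: "P ** K = mat 1" "K ** P = mat 1"
    unfolding P_def K_def by (rule jacobi_inverse[OF a' a dom(3,1)], rule jacobi_inverse[OF a a' dom(1,3)])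
  have A': "metric_matrix T h a' (jet_source e) = transpose K ** A ** K"
    unfolding A_def K_def by (rule metric_matrix_change_charts[OF a a' dom(1,3)])
  have inv: "matrix_inv (metric_matrix T h a' (jet_source e)) = P ** matrix_inv A ** transpose P"
    using metric_matrix_invertible[OF a' dom(3)] metric_matrix_invertible[OF a dom(1)]
    unfolding A' A_def[symmetric] by (intro matrix_inv_congruence PK)
  have "h_trace T h G a' b' k e = contraction (matrix_inv A)
      ((\<Sum>j\<in>UNIV. (jacobi b b' (jet_target e) $ k $ j) *\<^sub>R spray_matrix a b j e) -
       (1 / 2) *\<^sub>R (transpose (fibre a b e) ** hessian b b' (jet_target e) k ** fibre a b e))"
    unfolding h_trace_contraction inv spray_matrix_change_charts[OF a b a' b' e] K_def[symmetric]
    by (rule contraction_congruence[OF PK(2)])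
  then show ?thesis
    by (simp add: linear_diff[OF linear_contraction] linear_sum[OF linear_contraction]
        linear_scale[OF linear_contraction] h_trace_contraction fibre_quadratic_def A_def)
qed

text \<open>A line in fibre direction stays in the domains of both charts, and its source and target are
  constant. So along it all coefficients of the law for the traces are constant.\<close>

lemma fibre_line:
  assumes a: "a \<in> atlas T" and b: "b \<in> atlas M" and a': "a' \<in> atlas T" and b': "b' \<in> atlas M"
    and e: "e \<in> dom_of (J a b)" "e \<in> dom_of (J a' b')"
  obtains l where "\<And>s. l s = inv_chart (J a b) (coord (J a b) e + s *\<^sub>R dir_y m \<sigma>)"
    "\<And>s. l s \<in> dom_of (J a b)" "\<And>s. l s \<in> dom_of (J a' b')"
    "\<And>s. jet_source (l s) = jet_source e" "\<And>s. jet_target (l s) = jet_target e"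
    "\<And>s. fibre a b (l s) = fibre a b e + s *\<^sub>R axis m (axis \<sigma> 1)"
proof -
  note mem = induced_chart_mem[OF a b]
  define l where "l = (\<lambda>s. inv_chart (J a b) (coord (J a b) e + s *\<^sub>R dir_y m \<sigma>))"
  have l: "l s \<in> dom_of (J a b) \<and> l s \<in> dom_of (J a' b') \<and>
      coord (J a b) (l s) = coord (J a b) e + s *\<^sub>R dir_y m \<sigma>" for s
  proof -
    have "coord (J a b) e + s *\<^sub>R dir_y m \<sigma> \<in> coord (J a b) ` (dom_of (J a b) \<inter> dom_of (J a' b'))"
      unfolding coord_induced_chart_image[OF a b]
      using jet_dom[OF e(1)] jet_dom[OF e(2)] by (simp add: coord_induced_chart[OF a b e(1)] dir_y_def)
    then obtain k where k: "k \<in> dom_of (J a b)" "k \<in> dom_of (J a' b')"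
      "coord (J a b) e + s *\<^sub>R dir_y m \<sigma> = coord (J a b) k" by blast
    then show ?thesis by (simp add: l_def E.inv_chart_coord[OF mem])
  qed
  have "coord a (jet_source (l s)) = coord a (jet_source e) \<and> coord b (jet_target (l s)) = coord b (jet_target e)" for s
  proof -
    have "fst (coord (J a b) (l s)) = fst (coord (J a b) e) \<and>
        fst (snd (coord (J a b) (l s))) = fst (snd (coord (J a b) e))"
      using l[of s] by (simp add: dir_y_def)
    then show ?thesis
      unfolding coord_induced_chart[OF a b conjunct1[OF l[of s]]] coord_induced_chart[OF a b e(1)]
      by (simp only: fst_conv snd_conv)
  qed
  then have base: "jet_source (l s) = jet_source e" "jet_target (l s) = jet_target e" for s
    using jet_dom[OF e(1)] jet_dom[of "l s" a b] l[of s]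
      inj_onD[OF T.inj_coord[OF a]] inj_onD[OF M.inj_coord[OF b]] by blast+
  show ?thesis
  proof (rule that[of l])
    show "fibre a b (l s) = fibre a b e + s *\<^sub>R axis m (axis \<sigma> 1)" for s
      using l[of s] by (simp add: dir_y_def)
  qed (use l base in \<open>simp_all add: l_def\<close>)
qed

abbreviation trace_gradient where
  "trace_gradient a b k e \<equiv> (\<chi> m \<sigma>. partial (J a b) (dir_y m \<sigma>) (h_trace T h G a b k) e)"

text \<open>Both sides of the law for the traces are differentiated along a line in fibre direction. On
  the left, the chain rule expresses the direction in the second chart, where it has
  the components of \<open>B E K\<close> with \<open>E\<close> the matrix unit of the direction.\<close>

lemma trace_gradient_change_charts:
  assumes a: "a \<in> atlas T" and b: "b \<in> atlas M" and a': "a' \<in> atlas T" and b': "b' \<in> atlas M"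
    and e: "e \<in> dom_of (J a b)" "e \<in> dom_of (J a' b')"
  shows "transpose (jacobi b b' (jet_target e)) ** trace_gradient a' b' k e ** transpose (jacobi a' a (jet_source e)) =
    (\<Sum>j\<in>UNIV. (jacobi b b' (jet_target e) $ k $ j) *\<^sub>R trace_gradient a b j e) -
    hessian b b' (jet_target e) k ** fibre a b e ** matrix_inv (metric_matrix T h a (jet_source e))"
proof -
  note dom = jet_dom[OF e(1)] jet_dom[OF e(2)]
  note mem = induced_chart_mem[OF a b] induced_chart_mem[OF a' b']
  define A where "A = metric_matrix T h a (jet_source e)"
  define K Jb Hk where "K = jacobi a' a (jet_source e)"
    and "Jb = jacobi b b' (jet_target e)" and "Hk = hessian b b' (jet_target e) k"
  define y where "y = fibre a b e"
  have "(transpose Jb ** trace_gradient a' b' k e ** transpose K) $ m $ \<sigma> =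
      (\<Sum>j\<in>UNIV. Jb $ k $ j * trace_gradient a b j e $ m $ \<sigma>) - (Hk ** y ** matrix_inv A) $ m $ \<sigma>" for m \<sigma>
  proof -
    obtain l where l: "\<And>s. l s = inv_chart (J a b) (coord (J a b) e + s *\<^sub>R dir_y m \<sigma>)"
      "\<And>s. l s \<in> dom_of (J a b)" "\<And>s. l s \<in> dom_of (J a' b')"
      "\<And>s. jet_source (l s) = jet_source e" "\<And>s. jet_target (l s) = jet_target e"
      "\<And>s. fibre a b (l s) = y + s *\<^sub>R axis m (axis \<sigma> 1)"
      unfolding y_def by (rule fibre_line[OF a b a' b' e, of m \<sigma>]) blast
    let ?w = "dir_y m \<sigma> :: ('p, 'n) jmodel"
    have along_l: "((\<lambda>s. F (l s)) has_real_derivative F' ?w) (at 0)"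
      if "(F \<circ> inv_chart (J a b) has_derivative F') (at (coord (J a b) e))" for F F'
      using has_derivative_along_line[of "F \<circ> inv_chart (J a b)" F' "coord (J a b) e" 0 ?w] that
      by (simp add: l(1))
    have old: "((\<lambda>s. h_trace T h G a b j (l s)) has_real_derivative trace_gradient a b j e $ m $ \<sigma>) (at 0)" for j
      using along_l[OF E.smooth_function_in_has_derivative[OF smooth_spray_trace[OF a b] e(1)]] by simp
    have new': "(h_trace T h G a' b' k \<circ> inv_chart (J a' b') has_derivative
        (\<lambda>v. partial (J a' b') v (h_trace T h G a' b' k) e)) (at (coord (J a' b') e))"
      by (rule E.smooth_function_in_has_derivative[OF smooth_spray_trace[OF a' b'] e(2)])
    have lin: "linear (\<lambda>v. partial (J a' b') v (h_trace T h G a' b' k) e)"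
      by (rule has_derivative_linear[OF new'])
    have "chart_jacobian (J a b) (J a' b') e ?w = (0, 0, Jb ** axis m (axis \<sigma> 1) ** K)"
      unfolding dir_y_def jet_chart_jacobian(2)[OF a b a' b' e]
      by (simp add: Jb_def K_def linear_0[OF linear_jacobi_derivative_target[OF a b a' b' e]])
    also have "\<dots> = (\<Sum>i\<in>UNIV. \<Sum>\<delta>\<in>UNIV. (Jb $ i $ m * K $ \<sigma> $ \<delta>) *\<^sub>R dir_y i \<delta>)"
    proof -
      have "(Jb ** axis m (axis \<sigma> 1) ** K) $ i $ \<delta> = Jb $ i $ m * K $ \<sigma> $ \<delta>" for i \<delta>
      proof -
        have "(Jb ** axis m (axis \<sigma> 1)) $ i $ \<alpha> = (\<Sum>k\<in>UNIV. if k = m then Jb $ i $ m * axis \<sigma> 1 $ \<alpha> else 0)" for \<alpha>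
        proof -
          have "(Jb ** axis m (axis \<sigma> 1)) $ i $ \<alpha> = (\<Sum>k\<in>UNIV. Jb $ i $ k * axis m (axis \<sigma> 1) $ k $ \<alpha>)"
            by (simp add: matrix_matrix_mult_def)
          also have "\<dots> = (\<Sum>k\<in>UNIV. if k = m then Jb $ i $ m * axis \<sigma> 1 $ \<alpha> else 0)"
            by (intro sum.cong refl) (auto simp: axis_def)
          finally show ?thesis .
        qed
        then have col: "(Jb ** axis m (axis \<sigma> 1)) $ i $ \<alpha> = Jb $ i $ m * axis \<sigma> 1 $ \<alpha>" for \<alpha> by simp
        have "(Jb ** axis m (axis \<sigma> 1) ** K) $ i $ \<delta> =
            (\<Sum>\<alpha>\<in>UNIV. (Jb ** axis m (axis \<sigma> 1)) $ i $ \<alpha> * K $ \<alpha> $ \<delta>)"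
          by (simp add: matrix_matrix_mult_def[of _ K])
        also have "\<dots> = (\<Sum>\<alpha>\<in>UNIV. if \<alpha> = \<sigma> then Jb $ i $ m * K $ \<sigma> $ \<delta> else 0)"
          unfolding col by (intro sum.cong refl) (simp add: axis_def)
        finally show ?thesis by simp
      qed
      then show ?thesis
        by (intro prod_eqI) (simp_all add: dir_y_def fst_sum snd_sum vec_eq_iff sum_mult_axis_axis(1))
    qed
    finally have w: "chart_jacobian (J a b) (J a' b') e ?w =
        (\<Sum>i\<in>UNIV. \<Sum>\<delta>\<in>UNIV. (Jb $ i $ m * K $ \<sigma> $ \<delta>) *\<^sub>R dir_y i \<delta>)" .
    have "partial (J a' b') (chart_jacobian (J a b) (J a' b') e ?w) (h_trace T h G a' b' k) e =
        (\<Sum>i\<in>UNIV. \<Sum>\<delta>\<in>UNIV. Jb $ i $ m * K $ \<sigma> $ \<delta> * trace_gradient a' b' k e $ i $ \<delta>)"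
      unfolding w by (simp add: linear_sum[OF lin] linear_scale[OF lin])
    also have "\<dots> = (\<Sum>\<delta>\<in>UNIV. \<Sum>i\<in>UNIV. Jb $ i $ m * K $ \<sigma> $ \<delta> * trace_gradient a' b' k e $ i $ \<delta>)"
      by (rule sum.swap)
    also have "\<dots> = (transpose Jb ** trace_gradient a' b' k e ** transpose K) $ m $ \<sigma>"
      by (simp add: matrix_matrix_mult_def transpose_def sum_distrib_left sum_distrib_right ac_simps)
    finally have new: "((\<lambda>s. h_trace T h G a' b' k (l s)) has_real_derivative
        (transpose Jb ** trace_gradient a' b' k e ** transpose K) $ m $ \<sigma>) (at 0)"
      using along_l[OF E.has_derivative_change_chart[OF mem e new']] by simp
    have "h_trace T h G a' b' k (l s) = (\<Sum>j\<in>UNIV. Jb $ k $ j * h_trace T h G a b j (l s)) -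
        (1 / 2) * fibre_quadratic (matrix_inv A) Hk (y + s *\<^sub>R axis m (axis \<sigma> 1))" for s
      unfolding spray_trace_change_charts[OF a b a' b' l(2,3)] by (simp only: l(4-6) Jb_def A_def Hk_def)
    then have eq: "(\<lambda>s. h_trace T h G a' b' k (l s)) = (\<lambda>s. (\<Sum>j\<in>UNIV. Jb $ k $ j * h_trace T h G a b j (l s)) -
        (1 / 2) * fibre_quadratic (matrix_inv A) Hk (y + s *\<^sub>R axis m (axis \<sigma> 1)))" by (rule ext)
    have "((\<lambda>s. (\<Sum>j\<in>UNIV. Jb $ k $ j * h_trace T h G a b j (l s)) -
        (1 / 2) * fibre_quadratic (matrix_inv A) Hk (y + s *\<^sub>R axis m (axis \<sigma> 1))) has_real_derivative
        (\<Sum>j\<in>UNIV. Jb $ k $ j * trace_gradient a b j e $ m $ \<sigma>) -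
        (1 / 2) * (2 * (Hk ** y ** matrix_inv A) $ m $ \<sigma>)) (at 0)"
    proof (intro DERIV_diff DERIV_sum DERIV_cmult old fibre_quadratic_derivative)
      show "transpose (matrix_inv A) = matrix_inv A"
        unfolding A_def by (rule matrix_inv_symmetric[OF metric_matrix_invertible[OF a dom(1)]
              metric_matrix_symmetric[OF a dom(1)]])
      show "transpose Hk = Hk" unfolding Hk_def by (rule hessian_symmetric[OF b b' dom(2,4)])
    qed
    from DERIV_unique[OF new this[folded eq]] show ?thesis by simp
  qed
  then show ?thesis by (simp add: vec_eq_iff K_def Jb_def Hk_def A_def y_def)
qed

text \<open>The coefficients of the connection are the entries of the product of the gradient of the trace with
  the metric. Multiplying the law of the gradient by \<open>h K\<close> gives \<open>K\<^sup>T h K\<close>, the metric of the second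
  chart, on the left, and removes the inverse metric on the right.\<close>

lemma connection_of_spray_is_connection:
  "spatial_nonlinear_connection T M (connection_of_spray T M h G)"
  unfolding spatial_nonlinear_connection_iff
proof (intro conjI ballI allI)
  fix a b j \<beta> i assume a: "a \<in> atlas T" and b: "b \<in> atlas M"
  note mem = induced_chart_mem[OF a b]
  show "smooth_function_in (J a b) (connection_of_spray T M h G a b j \<beta> i)"
    unfolding connection_of_spray_def[abs_def]
    by (intro E.smooth_function_in_sum[OF mem] E.smooth_function_in_mult[OF mem]
        E.smooth_function_in_partial[OF mem] smooth_spray_trace[OF a b]
        smooth_pullback[OF a b smooth_metric_matrix[OF a]])
next
  fix a b a' b' e k \<beta> i
  assume a: "a \<in> atlas T" and b: "b \<in> atlas M" and a': "a' \<in> atlas T" and b': "b' \<in> atlas M"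
    and "e \<in> dom_of (J a b) \<inter> dom_of (J a' b')"
  then have e: "e \<in> dom_of (J a b)" "e \<in> dom_of (J a' b')" by auto
  note dom = jet_dom[OF e(1)] jet_dom[OF e(2)]
  define A where "A = metric_matrix T h a (jet_source e)"
  define K Jb Hk where "K = jacobi a' a (jet_source e)"
    and "Jb = jacobi b b' (jet_target e)" and "Hk = hessian b b' (jet_target e) k"
  define y where "y = fibre a b e"
  define \<Gamma> where "\<Gamma> = (\<Sum>j\<in>UNIV. (Jb $ k $ j) *\<^sub>R trace_gradient a b j e)"
  have A': "metric_matrix T h a' (jet_source e) = transpose K ** A ** K"
    unfolding A_def K_def by (rule metric_matrix_change_charts[OF a a' dom(1,3)])
  have A_inv: "matrix_inv A ** A = mat 1"
    unfolding A_def by (rule matrix_inv_mult(2)[OF metric_matrix_invertible[OF a dom(1)]])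
  have N: "connection_of_spray T M h G a b j \<beta> i e =
      (trace_gradient a b j e ** metric_matrix T h a (jet_source e)) $ i $ \<beta>" for a b j \<beta> i
    by (simp add: connection_of_spray_def matrix_matrix_mult_def)
  have "transpose Jb ** (trace_gradient a' b' k e ** metric_matrix T h a' (jet_source e)) =
      (transpose Jb ** trace_gradient a' b' k e ** transpose K) ** (A ** K)"
    by (simp add: A' matrix_mul_assoc)
  also have "\<dots> = (\<Gamma> - Hk ** y ** matrix_inv A) ** (A ** K)"
    using trace_gradient_change_charts[OF a b a' b' e, of k]
    by (simp only: Jb_def K_def \<Gamma>_def Hk_def y_def A_def)
  also have "\<dots> = \<Gamma> ** A ** K - Hk ** (y ** (matrix_inv A ** A) ** K)"
    by (simp add: bounded_bilinear.diff_left[OF bounded_bilinear_matrix_mult] matrix_mul_assoc)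
  finally have law: "transpose Jb ** (trace_gradient a' b' k e ** metric_matrix T h a' (jet_source e)) =
      \<Gamma> ** A ** K - Hk ** (y ** K)"
    by (simp add: A_inv)
  have "(\<Sum>l\<in>UNIV. connection_of_spray T M h G a' b' k \<beta> l e * Jb $ l $ i) =
      (transpose Jb ** (trace_gradient a' b' k e ** metric_matrix T h a' (jet_source e))) $ i $ \<beta>"
    unfolding N by (subst (2) matrix_matrix_mult_def) (simp add: transpose_def mult.commute)
  also have "\<dots> = (\<Gamma> ** A ** K) $ i $ \<beta> - (Hk ** (y ** K)) $ i $ \<beta>"
    unfolding law by simp
  also have "(Hk ** (y ** K)) $ i $ \<beta> = (jacobi_derivative b b' (jet_target e) (axis i 1) ** y ** K) $ k $ \<beta>"
  proof -
    have "Hk $ i $ j = jacobi_derivative b b' (jet_target e) (axis i 1) $ k $ j" for j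
      by (simp add: Hk_def hessian_def jacobi_derivative_symmetric[OF smooth_M b b' dom(2,4)])
    then show ?thesis
      unfolding matrix_mul_assoc[symmetric]
      by (simp add: matrix_matrix_mult_def[of Hk] matrix_matrix_mult_def[of "jacobi_derivative _ _ _ _"])
  qed
  also have "(\<Gamma> ** A ** K) $ i $ \<beta> =
      (\<Sum>j\<in>UNIV. \<Sum>\<gamma>\<in>UNIV. connection_of_spray T M h G a b j \<gamma> i e * Jb $ k $ j * K $ \<gamma> $ \<beta>)"
  proof -
    interpret bounded_bilinear "(**) :: real^'p^'n \<Rightarrow> real^'p^'p \<Rightarrow> real^'p^'n"
      by (rule bounded_bilinear_matrix_mult)
    have "(\<Gamma> ** A ** K) $ i $ \<beta> = (\<Sum>j\<in>UNIV. Jb $ k $ j * ((trace_gradient a b j e ** A) ** K) $ i $ \<beta>)"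
      by (simp add: \<Gamma>_def sum_left scaleR_left)
    also have "\<dots> = (\<Sum>j\<in>UNIV. \<Sum>\<gamma>\<in>UNIV. (trace_gradient a b j e ** A) $ i $ \<gamma> * Jb $ k $ j * K $ \<gamma> $ \<beta>)"
      unfolding matrix_matrix_mult_def[of "_ ** A" K] by (simp add: sum_distrib_left ac_simps)
    finally show ?thesis by (simp only: N A_def)
  qed
  finally show "(\<Sum>l\<in>UNIV. connection_of_spray T M h G a' b' k \<beta> l e * jacobi b b' (jet_target e) $ l $ i) =
      (\<Sum>j\<in>UNIV. \<Sum>\<gamma>\<in>UNIV. connection_of_spray T M h G a b j \<gamma> i e * jacobi b b' (jet_target e) $ k $ j *
          jacobi a' a (jet_source e) $ \<gamma> $ \<beta>) -
      (jacobi_derivative b b' (jet_target e) (axis i 1) ** fibre a b e ** jacobi a' a (jet_source e)) $ k $ \<beta>"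
    by (simp only: Jb_def K_def y_def)
qed

end

end

theorem theorem3p3:
  fixes T :: "('a, real^'p) manifold" and M :: "('b, real^'n) manifold"
    and h :: "('a, real^'p) tensor02"
  assumes "smooth_manifold T" and "smooth_manifold M" and "semi_riemannian_metric T h"
  shows "(\<forall>(S :: (('a, 'b) jet, ('p, 'n) jmodel) tensor11)
            (G :: ('a, 'b, 'p, 'n) spray_components).
            spatial_spray T M S G \<longrightarrow>
            spatial_nonlinear_connection T M (connection_of_spray T M h G)) \<and>
         (\<forall>N :: ('a, 'b, 'p, 'n) connection_coefficients.
            spatial_nonlinear_connection T M N \<longrightarrow>
            (\<exists>S :: (('a, 'b) jet, ('p, 'n) jmodel) tensor11.
               spatial_spray T M S (spray_of_connection T M N)))"
proof -
  interpret metric_jet_bundle T M h using assms by unfold_locales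
  show ?thesis
    using connection_of_spray_is_connection spray_of_connection_is_spray by blast
qed

end
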